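(* Let $-A$ be the generator of a bounded $C_0$-semigroup $(T(t))_{t\ge 0}$ on a Banach space $X$, and let $B(A)=A(I+A)^{-1}$. Assume that $T(t)A\ne 0$ for each $t>0$. There exists a constant $c>0$ such that the following hold. (a) If $A$ is invertible, $f$ is a complete Bernstein function, $\gamma\le 1$, and $A^{\gamma}f(A^{-1})$ is a bounded operator, then $$\|T(t_1)A^{\gamma}f(A^{-1})\|\ge c\,\frac{\|T(t_1+t_2)A^{\gamma-1}\|}{\|T(t_2)A^{-1}\|}\,f\big(\|T(t_2)A^{-1}\|\big)$$ for all $t_1,t_2\ge 0$. (b) If $f$ is a bounded complete Bernstein function and $\gamma>0$, then $$\|T(t_1)B(A)^{\gamma}f(A)\|\ge c\,\frac{\|T(t_1+t_2)B(A)^{\gamma+1}\|}{\|T(t_2)B(A)\|}\,f\big(\|T(t_2)B(A)\|\big)$$ for all $t_1,t_2\ge 0$.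
   Context: A densely defined operator $A$ on a Banach space is sectorial if $(-\infty,0)\subset\rho(A)$ and $\sup_{\lambda>0}\|\lambda(\lambda+A)^{-1}\|<\infty$. If $-A$ generates a bounded $C_0$-semigroup then $A$, $B(A)=A(I+A)^{-1}$ and (if $A$ is invertible) $A^{-1}$ are sectorial; the powers $A^\gamma$, $B(A)^{\gamma}$ are the usual fractional powers of sectorial operators. A complete Bernstein function is a function $f:(0,\infty)\to[0,\infty)$ of the form $f(\lambda)=a+b\lambda+\int_{0+}^\infty\frac{\lambda}{s+\lambda}\,d\mu(s)$, where $a,b\ge 0$ and $\mu$ is a positive Radon measure on $(0,\infty)$ with $\int_{0+}^\infty\frac{d\mu(s)}{s+1}<\infty$ (the triple $(a,b,\mu)$ is unique). For a sectorial operator $S$, $f(S)$ is defined as the closure of the (closable) operator with domain $\operatorname{dom}(S)$ given by $x\mapsto ax+bSx+\int_{0+}^\infty S(\lambda+S)^{-1}x\,d\mu(\lambda)$. If $S$ is bounded, or if $f$ is bounded, then $f(S)$ is a bounded operator. *)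

theory Defs
  imports "HOL-Analysis.Analysis"
begin

text \<open>
  A (possibly unbounded, partially defined) operator on \<open>'a\<close> is represented by its graph, so that
  the inverse of an operator is its converse relation and its closure is the topological closure of
  the graph in \<open>'a \<times> 'a\<close>. Composition and integer powers, with their natural domains, are
  relation composition and relation powers; the scalars are real, which includes complex Banach
  spaces by restriction of scalars.
\<close>

type_synonym 'a operator = "('a \<times> 'a) set"

text \<open>\<open>R \<odot> S\<close> applies \<open>S\<close> first, whereas \<open>R O S\<close> applies \<open>R\<close> first.\<close>

abbreviation op_comp :: "'a operator \<Rightarrow> 'a operator \<Rightarrow> 'a operator" (infixr "\<odot>" 75)
  where "R \<odot> S \<equiv> S O R"

definition bop :: "('a::real_normed_vector \<Rightarrow>\<^sub>L 'a) \<Rightarrow> 'a operator"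
  where "bop T = range (\<lambda>x. (x, blinfun_apply T x))"

definition bounded_op :: "'a::real_normed_vector operator \<Rightarrow> bool"
  where "bounded_op R \<longleftrightarrow> (\<exists>T. R = bop T)"

definition invertible_op :: "'a::real_normed_vector operator \<Rightarrow> bool"
  where "invertible_op A \<longleftrightarrow> bounded_op (A\<inverse>)"

text \<open>Meaningful only if \<open>x\<close> lies in the domain of the (single-valued) operator \<open>R\<close>.\<close>

definition app :: "'a operator \<Rightarrow> 'a \<Rightarrow> 'a"
  where "app R x = (THE y. (x, y) \<in> R)"

text \<open>Meaningful only for bounded operators.\<close>

definition op_norm :: "'a::real_normed_vector operator \<Rightarrow> real"
  where "op_norm R = onorm (app R)"

lemma app_bop: "app (bop T) = blinfun_apply T"
  by (auto simp: app_def bop_def fun_eq_iff)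

lemma op_norm_bop: "op_norm (bop T) = norm T"
  by (simp add: op_norm_def app_bop norm_blinfun.rep_eq)

text \<open>The operator \<open>(s + A)\<inverse>\<close>.\<close>

definition shift_inv :: "real \<Rightarrow> 'a::real_normed_vector operator \<Rightarrow> 'a operator"
  where "shift_inv s A = {(s *\<^sub>R x + y, x) | x y. (x, y) \<in> A}"

definition B_op :: "'a::real_normed_vector operator \<Rightarrow> 'a operator"
  where "B_op A = A \<odot> shift_inv 1 A"


definition bounded_C0_semigroup :: "(real \<Rightarrow> 'a::real_normed_vector \<Rightarrow>\<^sub>L 'a) \<Rightarrow> bool"
  where "bounded_C0_semigroup T \<longleftrightarrow>
    T 0 = id_blinfun \<and>
    (\<forall>s\<ge>0. \<forall>t\<ge>0. T (s + t) = T s o\<^sub>L T t) \<and>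
    (\<forall>x. ((\<lambda>t. blinfun_apply (T t) x) \<longlongrightarrow> x) (at_right 0)) \<and>
    (\<exists>M. \<forall>t\<ge>0. norm (T t) \<le> M)"

definition generator :: "(real \<Rightarrow> 'a::real_normed_vector \<Rightarrow>\<^sub>L 'a) \<Rightarrow> 'a operator"
  where "generator T =
    {(x, y). ((\<lambda>t. (1 / t) *\<^sub>R (blinfun_apply (T t) x - x)) \<longlongrightarrow> y) (at_right 0)}"

definition neg_op :: "'a::real_normed_vector operator \<Rightarrow> 'a operator"
  where "neg_op A = {(x, - y) | x y. (x, y) \<in> A}"


text \<open>
  The library's \<^const>\<open>has_bochner_integral\<close> is restricted to second countable spaces. The same
  definition is repeated here without that restriction; strong measurability is not lost, as the
  approximation by simple functions in mean already implies it.
\<close>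

definition has_strong_integral :: "'b measure \<Rightarrow> ('b \<Rightarrow> 'a::real_normed_vector) \<Rightarrow> 'a \<Rightarrow> bool"
  where "has_strong_integral M f x \<longleftrightarrow>
    f \<in> borel_measurable M \<and>
    (\<exists>s. (\<forall>i. Bochner_Integration.simple_bochner_integrable M (s i)) \<and>
      (\<lambda>i::nat. \<integral>\<^sup>+ t. ennreal (norm (f t - s i t)) \<partial>M) \<longlonglongrightarrow> 0 \<and>
      (\<lambda>i. Bochner_Integration.simple_bochner_integral M (s i)) \<longlonglongrightarrow> x)"

lemma has_strong_integral_eq_has_bochner_integral:
  fixes f :: "'b \<Rightarrow> 'a::{real_normed_vector, second_countable_topology}"
  shows "has_strong_integral M f x \<longleftrightarrow> has_bochner_integral M f x"
  unfolding has_strong_integral_def has_bochner_integral.simps by blast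


text \<open>
  For \<open>0 < r < 1\<close> the power \<open>A\<^sup>r\<close> is given on \<open>dom A\<close> by Balakrishnan's formula
  \<open>sin (\<pi> r) / \<pi> \<cdot> \<integral> s\<^sup>r\<^sup>-\<^sup>1 (s + A)\<inverse> A x ds\<close> over \<open>(0,\<infinity>)\<close>, and \<open>dom A\<close> is a core for it.
  For \<open>\<alpha> \<ge> 0\<close>, \<open>A\<^sup>\<alpha> = A\<^sup>n A\<^sup>r\<close> with \<open>n\<close> the integer and \<open>r\<close> the fractional part of \<open>\<alpha>\<close>
  (for sectorial \<open>A\<close> the law of exponents \<open>A\<^sup>\<alpha>\<^sup>+\<^sup>\<beta> = A\<^sup>\<alpha> A\<^sup>\<beta>\<close> holds with equality of domains),
  and \<open>A\<^sup>-\<^sup>\<alpha> = (A\<^sup>\<alpha>)\<inverse>\<close>.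
\<close>

definition balakrishnan :: "'a::real_normed_vector operator \<Rightarrow> real \<Rightarrow> 'a operator"
  where "balakrishnan A r = closure
    {(x, z). \<exists>y. (x, y) \<in> A \<and>
       has_strong_integral (restrict_space lborel {0<..})
         (\<lambda>s. (sin (pi * r) / pi * s powr (r - 1)) *\<^sub>R app (shift_inv s A) y) z}"

definition frac_pow_nonneg :: "'a::real_normed_vector operator \<Rightarrow> real \<Rightarrow> 'a operator"
  where "frac_pow_nonneg A \<alpha> =
    (A ^^ nat \<lfloor>\<alpha>\<rfloor>) \<odot> (if frac \<alpha> = 0 then Id else balakrishnan A (frac \<alpha>))"

definition frac_pow :: "'a::real_normed_vector operator \<Rightarrow> real \<Rightarrow> 'a operator"
  where "frac_pow A \<alpha> =
    (if 0 \<le> \<alpha> then frac_pow_nonneg A \<alpha> else (frac_pow_nonneg A (- \<alpha>))\<inverse>)"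


text \<open>
  The Radon measures on \<open>(0,\<infinity>)\<close> are the Borel measures there that are finite on compact sets.
  Only the values of \<open>f\<close> on \<open>(0,\<infinity>)\<close> matter.
\<close>

definition cbf_triple :: "(real \<Rightarrow> real) \<Rightarrow> real \<times> real \<times> real measure \<Rightarrow> bool"
  where "cbf_triple f = (\<lambda>(a, b, \<mu>).
    0 \<le> a \<and> 0 \<le> b \<and>
    sets \<mu> = sets (restrict_space borel {0<..}) \<and>
    (\<forall>K. compact K \<and> K \<subseteq> {0<..} \<longrightarrow> emeasure \<mu> K < \<infinity>) \<and>
    (\<integral>\<^sup>+ s. ennreal (1 / (s + 1)) \<partial>\<mu>) < \<infinity> \<and>
    (\<forall>x>0. f x = a + b * x + (\<integral> s. x / (s + x) \<partial>\<mu>)))"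

definition complete_bernstein :: "(real \<Rightarrow> real) \<Rightarrow> bool"
  where "complete_bernstein f \<longleftrightarrow> (\<exists>p. cbf_triple f p)"

text \<open>The operator \<open>f(S)\<close>; the triple chosen by \<open>SOME\<close> is unique.\<close>

definition cbf_op :: "(real \<Rightarrow> real) \<Rightarrow> 'a::real_normed_vector operator \<Rightarrow> 'a operator"
  where "cbf_op f S = (case (SOME p. cbf_triple f p) of (a, b, \<mu>) \<Rightarrow>
    closure {(x, a *\<^sub>R x + b *\<^sub>R y + z) | x y z. (x, y) \<in> S \<and>
      has_strong_integral \<mu> (\<lambda>s. app (S \<odot> shift_inv s S) x) z})"

end

theory Submission
  imports Defs
begin

text \<open>
  Let \<open>M \<ge> 1\<close> bound all \<open>\<parallel>T(t)\<parallel>\<close>, and let \<open>R(s) = (s + A)\<inverse>\<close> and \<open>D(s) = A (s + A)\<inverse> = I - s R(s)\<close>. Both lower bounds are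
  consequences of a single inequality: if \<open>f\<close> is a complete Bernstein function with triple
  \<open>(a, b, \<mu>)\<close> and \<open>f(A) z\<close> stands for \<open>a z + b A z + \<integral> D(s) z d\<mu>(s)\<close>, then
  \<open>f(\<tau>) \<parallel>D(\<tau>) z\<parallel> \<le> 2 M \<parallel>f(A) z\<parallel>\<close> for all \<open>\<tau> > 0\<close>.
  For bounded \<open>f\<close> put \<open>\<tau> = \<parallel>T(t\<^sub>2) B(A)\<parallel>\<close>: then \<open>T(t\<^sub>2) B(A) = (\<tau> T(t\<^sub>2) R(1) + T(t\<^sub>2) B(A)) D(\<tau>)\<close>
  has a first factor of norm at most \<open>(1 + M\<^sup>2) \<tau>\<close>, whence
  \<open>f(\<tau>) \<parallel>T(t\<^sub>2) B(A) z\<parallel> \<le> 2 M (1 + M\<^sup>2) \<tau> \<parallel>f(A) z\<parallel>\<close>, and it remains to take \<open>z\<close> in the range of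
  \<open>T(t\<^sub>1) B(A)\<^sup>\<gamma>\<close>. If \<open>A\<close> is invertible, \<open>f(A\<inverse>) x = h(A) A\<inverse> x\<close> for the complete Bernstein function
  \<open>h(\<lambda>) = \<lambda> f(1/\<lambda>)\<close>, and the same inequality for \<open>h\<close> at \<open>1/\<tau>\<close> and the vector \<open>A\<inverse> x\<close> reads
  \<open>(f(\<tau>)/\<tau>) \<parallel>R(1/\<tau>) x\<parallel> \<le> 2 M \<parallel>f(A\<inverse>) x\<parallel>\<close>; one concludes in the same way.

  The inequality says that \<open>f(A)\<close> has an approximate inverse whose size is dictated by the scalar
  function; analytically it rests on the fact that \<open>\<lambda>/f(\<lambda>)\<close> is again a complete Bernstein function.
  Here a discrete form of this fact is used. The pair \<open>(f(A) z, f(\<tau>))\<close> belongs to the closed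
  convex cone generated by the pairs \<open>(D(s) z, \<tau>/(\<tau> + s))\<close>, so that \<open>f(A)\<close> may be replaced by a
  finite sum \<open>H = \<Sum> m\<^sub>j D(s\<^sub>j)\<close> with \<open>m\<^sub>j \<ge> 0\<close>. For large \<open>\<sigma>\<close> the operator \<open>K = \<sigma> R(\<sigma>)\<close> is power
  bounded by \<open>M\<close>, and \<open>D(s) = (1 - K)/(1 - \<rho> K)\<close> with \<open>\<rho> = 1 - s/\<sigma>\<close>. Hence \<open>H = (1 - K) U(K)\<close>, where
  the coefficients \<open>u\<^sub>n = \<Sum> m\<^sub>j \<rho>\<^sub>j\<^sup>n\<close> of \<open>U\<close> form a decreasing log-convex sequence. By Kaluza's theorem
  \<open>u\<^sub>0/U = 1 - F\<close> where \<open>F\<close> has nonnegative coefficients of sum at most \<open>1\<close>. With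
  \<open>q(z) = (1 - F(z))/(1 - r z)\<close> and \<open>r = 1 - \<tau>/\<sigma>\<close> this gives \<open>q(K) H = u\<^sub>0 D(\<tau>)\<close>, and the signs of
  the coefficients yield \<open>\<Sum> \<bar>q\<^sub>n\<bar> \<le> 2 u\<^sub>0/((1 - r) U(r))\<close>, where \<open>(1 - r) U(r)\<close> dominates the scalar
  sum \<open>\<Sum> m\<^sub>j \<tau>/(\<tau> + s\<^sub>j)\<close> (lemmas \<open>kaluza\<close>, \<open>kaluza_quotient_estimate\<close>, \<open>finite_sum_estimate\<close>).

  Fractional powers enter only mildly. Since \<open>\<gamma>\<close> and \<open>\<gamma> + 1\<close> have the same fractional part,
  \<open>B(A)\<^sup>\<gamma>\<^sup>+\<^sup>1 = B(A) B(A)\<^sup>\<gamma>\<close> is immediate. For invertible \<open>A\<close> one needs that \<open>E = A\<^sup>\<gamma>\<^sup>-\<^sup>1\<close> is bounded and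
  that \<open>A\<inverse> y = E x\<close> whenever \<open>y = A\<^sup>\<gamma> x\<close>; apart from integer powers this is the law
  \<open>A\<^sup>-\<^sup>r A\<^sup>-\<^sup>(\<^sup>1\<^sup>-\<^sup>r\<^sup>) = A\<inverse>\<close> for \<open>0 < r < 1\<close> (lemma \<open>W_law\<close>). It follows from a differential equation: with
  \<open>W\<^sub>r(t) = (t + A)\<^sup>r\<^sup>-\<^sup>1\<close>, given by Balakrishnan's integral, \<open>W\<^sub>r' = -(1 - r) (t + A)\<inverse> W\<^sub>r\<close>, so
  \<open>A\<inverse> (t + A) W\<^sub>r(t) W\<^sub>1\<^sub>-\<^sub>r(t)\<close> does not depend on \<open>t\<close>, and the limit \<open>t \<rightarrow> \<infinity>\<close> identifies it.
\<close>

section \<open>Power series in a power bounded operator\<close>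

definition l1_fps :: "real fps \<Rightarrow> bool"
  where "l1_fps p \<longleftrightarrow> summable (\<lambda>n. \<bar>fps_nth p n\<bar>)"

definition geom_fps :: "real \<Rightarrow> real fps"
  where "geom_fps c = Abs_fps (\<lambda>n. c ^ n)"

lemma geom_fps_nth [simp]: "fps_nth (geom_fps c) n = c ^ n"
  by (simp add: geom_fps_def)

lemma geom_fps_inverse: "(1 - fps_const c * fps_X) * geom_fps c = 1"
proof (rule fps_ext)
  fix n
  show "fps_nth ((1 - fps_const c * fps_X) * geom_fps c) n = fps_nth 1 n"
    by (cases n) (simp_all add: algebra_simps mult.assoc)
qed

lemma geom_fps_1_inverse: "(1 - fps_X) * geom_fps 1 = 1"
  using geom_fps_inverse[of 1] by simp

lemma l1_fps_mult:
  assumes "l1_fps p" "l1_fps q"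
  shows "l1_fps (p * q)"
proof -
  have "summable (\<lambda>k. \<Sum>i\<le>k. \<bar>fps_nth p i\<bar> * \<bar>fps_nth q (k - i)\<bar>)"
    using assms unfolding l1_fps_def by (intro summable_Cauchy_product) auto
  then show ?thesis unfolding l1_fps_def
    by (rule summable_comparison_test'[where N=0])
      (auto simp: fps_mult_nth atLeast0AtMost simp flip: abs_mult intro!: sum_abs)
qed

lemma l1_fps_const: "l1_fps (fps_const c)"
  unfolding l1_fps_def by (rule summable_finite[of "{0}"]) (auto simp: fps_nth_fps_const)

lemma l1_fps_1: "l1_fps 1"
  using l1_fps_const[of 1] by simp

lemma l1_fps_X: "l1_fps (fps_X)"
  unfolding l1_fps_def by (rule summable_finite[of "{1}"]) (auto simp: fps_X_def)

lemma l1_fps_add: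
  assumes "l1_fps p" "l1_fps q"
  shows "l1_fps (p + q)"
  using summable_add[OF assms[unfolded l1_fps_def]] unfolding l1_fps_def
  by (rule summable_comparison_test'[where N=0]) auto

lemma l1_fps_diff:
  assumes "l1_fps p" "l1_fps q"
  shows "l1_fps (p - q)"
  using summable_add[OF assms[unfolded l1_fps_def]] unfolding l1_fps_def
  by (rule summable_comparison_test'[where N=0]) auto

lemma l1_fps_sum: "(\<And>j. j \<in> J \<Longrightarrow> l1_fps (p j)) \<Longrightarrow> l1_fps (\<Sum>j\<in>J. p j)"
  by (induction J rule: infinite_finite_induct) (auto intro: l1_fps_add simp: l1_fps_const[of 0, simplified])

lemma l1_fps_geom: "\<bar>c\<bar> < 1 \<Longrightarrow> l1_fps (geom_fps c)"
  unfolding l1_fps_def by (simp add: power_abs summable_geometric)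

text \<open>
  At \<open>c = 1\<close> the geometric series is not summable, but the factor \<open>1 - z\<close> cancels it.
\<close>

lemma l1_fps_geom':
  assumes "0 < c" "c \<le> 1"
  shows "l1_fps ((1 - fps_X) * geom_fps c)"
proof (cases "c = 1")
  case False
  then show ?thesis using assms
    by (intro l1_fps_mult l1_fps_diff l1_fps_1 l1_fps_X l1_fps_geom) auto
qed (simp add: geom_fps_1_inverse l1_fps_1)

text \<open>
  The operator \<open>p(K)\<close>. It is formed on vectors because the bounded operators on a Banach space do not
  constitute a type of class \<open>real_normed_algebra\<close>.
\<close>

definition fps_act :: "('a::banach \<Rightarrow>\<^sub>L 'a) \<Rightarrow> real fps \<Rightarrow> 'a \<Rightarrow> 'a"
  where "fps_act K p x = (\<Sum>n. fps_nth p n *\<^sub>R (blinfun_apply K ^^ n) x)"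

lemma funpow_blinfun_linear: "bounded_linear (blinfun_apply K ^^ n)"
  for K :: "'a::real_normed_vector \<Rightarrow>\<^sub>L 'a"
proof (induction n)
  case 0
  then show ?case by (simp add: id_def bounded_linear_ident)
next
  case (Suc n)
  then show ?case using bounded_linear_compose[OF blinfun.bounded_linear_right[of K]]
    by (simp add: o_def)
qed

locale power_bounded =
  fixes K :: "'a::banach \<Rightarrow>\<^sub>L 'a" and M :: real
  assumes pow_bound: "norm ((blinfun_apply K ^^ n) x) \<le> M * norm x"
    and M_nonneg: "0 \<le> M"
begin

lemma summable_norm_act:
  assumes "l1_fps p"
  shows "summable (\<lambda>n. norm (fps_nth p n *\<^sub>R (blinfun_apply K ^^ n) x))"
proof (rule summable_comparison_test'[where N=0])
  show "summable (\<lambda>n. \<bar>fps_nth p n\<bar> * (M * norm x))"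
    using assms unfolding l1_fps_def by (rule summable_mult2)
qed (auto intro!: mult_left_mono pow_bound)

lemma sums_act: "l1_fps p \<Longrightarrow> (\<lambda>n. fps_nth p n *\<^sub>R (blinfun_apply K ^^ n) x) sums fps_act K p x"
  unfolding fps_act_def by (intro summable_sums summable_norm_cancel[OF summable_norm_act])

lemma norm_act_partial:
  "norm (\<Sum>n<N. fps_nth p n *\<^sub>R (blinfun_apply K ^^ n) x) \<le> M * (\<Sum>n<N. \<bar>fps_nth p n\<bar>) * norm x"
proof -
  have "norm (\<Sum>n<N. fps_nth p n *\<^sub>R (blinfun_apply K ^^ n) x) \<le> (\<Sum>n<N. \<bar>fps_nth p n\<bar> * (M * norm x))"
    by (intro sum_norm_le) (auto intro!: mult_left_mono pow_bound)
  then show ?thesis by (simp add: sum_distrib_left sum_distrib_right mult_ac)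
qed

lemma norm_act:
  assumes p: "l1_fps p" and b: "\<And>N. (\<Sum>n<N. \<bar>fps_nth p n\<bar>) \<le> b"
  shows "norm (fps_act K p x) \<le> M * b * norm x"
proof (rule LIMSEQ_le_const2)
  show "(\<lambda>N. norm (\<Sum>n<N. fps_nth p n *\<^sub>R (blinfun_apply K ^^ n) x)) \<longlonglongrightarrow> norm (fps_act K p x)"
    using sums_act[OF p] unfolding sums_def by (rule tendsto_norm)
  show "\<exists>N0. \<forall>N\<ge>N0. norm (\<Sum>n<N. fps_nth p n *\<^sub>R (blinfun_apply K ^^ n) x) \<le> M * b * norm x"
    using norm_act_partial b M_nonneg
    by (meson mult_left_mono mult_right_mono norm_ge_zero order_trans)
qed

text \<open>
  The product of the partial sums is a sum over a square of indices, the partial sum of the product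
  series is the sum over a triangle. The difference is controlled by the same difference for the
  absolute values of the coefficients, which tends to \<open>0\<close> by the scalar Cauchy product.
\<close>

lemma act_mult:
  assumes p: "l1_fps p" and q: "l1_fps q"
  shows "fps_act K p (fps_act K q x) = fps_act K (p * q) x"
proof -
  let ?k = "\<lambda>n. blinfun_apply K ^^ n"
  let ?P = "\<lambda>N y. \<Sum>n<N. fps_nth p n *\<^sub>R ?k n y"
  let ?Q = "\<lambda>N y. \<Sum>n<N. fps_nth q n *\<^sub>R ?k n y"
  let ?T = "\<lambda>N. \<Sum>k<N. fps_nth (p * q) k *\<^sub>R ?k k x"
  let ?y = "fps_act K q x"
  let ?a = "\<lambda>i. \<bar>fps_nth p i\<bar>" and ?b = "\<lambda>i. \<bar>fps_nth q i\<bar>"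
  have lin: "?k n (sum f A) = (\<Sum>i\<in>A. ?k n (f i))" "?k n (c *\<^sub>R y) = c *\<^sub>R ?k n y" "?k n (y - z) = ?k n y - ?k n z"
    for n c y z and A :: "nat set" and f
    using funpow_blinfun_linear[of n K] by (auto simp: linear_simps linear_sum bounded_linear.linear)
  have sa: "summable ?a" and sb: "summable ?b" using p q by (auto simp: l1_fps_def)
  have lim1: "(\<lambda>N. ?P N (?Q N x)) \<longlonglongrightarrow> fps_act K p ?y"
  proof -
    have "(\<lambda>N. ?P N (?Q N x - ?y)) \<longlonglongrightarrow> 0"
    proof (rule Lim_null_comparison)
      show "\<forall>\<^sub>F N in sequentially. norm (?P N (?Q N x - ?y)) \<le> M * (\<Sum>n. ?a n) * norm (?Q N x - ?y)"
        using norm_act_partial[where p=p] sum_le_suminf[OF sa] M_nonneg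
        by (intro always_eventually allI order_trans[OF norm_act_partial] mult_right_mono mult_left_mono) auto
      have "(\<lambda>N. ?Q N x - ?y) \<longlonglongrightarrow> 0"
        using sums_act[OF q] unfolding sums_def by (rule LIM_zero)
      then show "(\<lambda>N. M * (\<Sum>n. ?a n) * norm (?Q N x - ?y)) \<longlonglongrightarrow> 0"
        by (intro tendsto_mult_right_zero tendsto_norm_zero)
    qed
    moreover have "(\<lambda>N. ?P N ?y) \<longlonglongrightarrow> fps_act K p ?y"
      using sums_act[OF p] unfolding sums_def .
    ultimately have "(\<lambda>N. ?P N (?Q N x - ?y) + ?P N ?y) \<longlonglongrightarrow> 0 + fps_act K p ?y"
      by (rule tendsto_add)
    then show ?thesis by (simp add: lin sum_subtractf scaleR_right_diff_distrib)
  qed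
  have lim2: "?T \<longlonglongrightarrow> fps_act K (p * q) x"
    using sums_act[OF l1_fps_mult[OF p q]] unfolding sums_def .
  have sq: "?P N (?Q N x) = (\<Sum>(i,j)\<in>{..<N}\<times>{..<N}. (fps_nth p i * fps_nth q j) *\<^sub>R ?k (i + j) x)" for N
    by (simp add: lin scaleR_sum_right sum.cartesian_product funpow_add)
  have tr: "?T N = (\<Sum>(i,j)\<in>{(i,j). i + j < N}. (fps_nth p i * fps_nth q j) *\<^sub>R ?k (i + j) x)" for N
    unfolding sum.triangle_reindex by (simp add: fps_mult_nth scaleR_sum_left atLeast0AtMost)
  have sub: "{(i,j). i + j < N} \<subseteq> {..<N}\<times>{..<N}" for N :: nat by auto
  have "(\<lambda>N. ?P N (?Q N x) - ?T N) \<longlonglongrightarrow> 0"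
  proof (rule Lim_null_comparison)
    let ?R = "\<lambda>N. (\<Sum>i<N. ?a i) * (\<Sum>j<N. ?b j) - (\<Sum>k<N. \<Sum>i\<le>k. ?a i * ?b (k - i))"
    have "?R \<longlonglongrightarrow> (\<Sum>i. ?a i) * (\<Sum>j. ?b j) - (\<Sum>i. ?a i) * (\<Sum>j. ?b j)"
      using Cauchy_product_sums[of ?a ?b] sa sb
      by (intro tendsto_diff tendsto_mult summable_LIMSEQ) (auto simp: sums_def)
    then show "(\<lambda>N. ?R N * (M * norm x)) \<longlonglongrightarrow> 0"
      by (auto intro: tendsto_mult_left_zero)
    have "norm (?P N (?Q N x) - ?T N) \<le> ?R N * (M * norm x)" for N
    proof -
      let ?S = "{..<N}\<times>{..<N} - {(i,j). i + j < N}"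
      have "?P N (?Q N x) - ?T N = (\<Sum>(i,j)\<in>?S. (fps_nth p i * fps_nth q j) *\<^sub>R ?k (i + j) x)"
        unfolding sq tr by (subst sum_diff[OF _ sub]) auto
      also have "norm \<dots> \<le> (\<Sum>(i,j)\<in>?S. ?a i * ?b j * (M * norm x))"
        by (rule sum_norm_le) (auto simp: abs_mult intro!: mult_left_mono pow_bound)
      also have "\<dots> = (\<Sum>(i,j)\<in>?S. ?a i * ?b j) * (M * norm x)"
        by (simp add: sum_distrib_right case_prod_unfold)
      also have "(\<Sum>(i,j)\<in>?S. ?a i * ?b j) = ?R N"
        by (subst sum_diff[OF _ sub]) (auto simp: sum_product sum.cartesian_product sum.triangle_reindex)
      finally show ?thesis .
    qed
    then show "\<forall>\<^sub>F N in sequentially. norm (?P N (?Q N x) - ?T N) \<le> ?R N * (M * norm x)"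
      by simp
  qed
  from tendsto_diff[OF lim1 lim2] this have "fps_act K p ?y - fps_act K (p * q) x = 0"
    by (rule LIMSEQ_unique)
  then show ?thesis by simp
qed

lemma act_const: "fps_act K (fps_const c) x = c *\<^sub>R x"
proof -
  have "(\<lambda>n. fps_nth (fps_const c) n *\<^sub>R (blinfun_apply K ^^ n) x) sums (\<Sum>n\<in>{0}. fps_nth (fps_const c) n *\<^sub>R (blinfun_apply K ^^ n) x)"
    by (rule sums_finite) (auto simp: fps_nth_fps_const)
  then show ?thesis unfolding fps_act_def by (simp add: sums_iff)
qed

lemma act_1: "fps_act K 1 x = x"
  using act_const[of 1] by simp

lemma act_X: "fps_act K fps_X x = K x"
proof -
  have "(\<lambda>n. fps_nth fps_X n *\<^sub>R (blinfun_apply K ^^ n) x) sums (\<Sum>n\<in>{1}. fps_nth fps_X n *\<^sub>R (blinfun_apply K ^^ n) x)"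
    by (rule sums_finite) (auto simp: fps_X_def)
  then show ?thesis unfolding fps_act_def by (simp add: sums_iff)
qed

lemma act_diff: "l1_fps p \<Longrightarrow> l1_fps q \<Longrightarrow> fps_act K (p - q) x = fps_act K p x - fps_act K q x"
  using sums_diff[OF sums_act sums_act, of p q x x] sums_act[OF l1_fps_diff, of p q x]
  by (simp add: scaleR_left_diff_distrib sums_iff)

lemma act_add: "l1_fps p \<Longrightarrow> l1_fps q \<Longrightarrow> fps_act K (p + q) x = fps_act K p x + fps_act K q x"
  using sums_add[OF sums_act sums_act, of p q x x] sums_act[OF l1_fps_add, of p q x]
  by (simp add: scaleR_left_distrib sums_iff)

lemma act_sum: "(\<And>j. j \<in> J \<Longrightarrow> l1_fps (p j)) \<Longrightarrow> fps_act K (\<Sum>j\<in>J. p j) x = (\<Sum>j\<in>J. fps_act K (p j) x)"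
  by (induction J rule: infinite_finite_induct) (auto simp: act_add l1_fps_sum act_const[of 0, simplified])

text \<open>
  The series \<open>(1 - z)/(1 - \<rho> z)\<close> at \<open>K\<close> solves the same equation as \<open>d\<close>, and \<open>1 - \<rho> K\<close> is injective
  because \<open>\<rho>\<^sup>n K\<^sup>n\<close> tends to \<open>0\<close>.
\<close>

lemma act_geom:
  assumes d: "d - \<rho> *\<^sub>R K d = z - K z" and \<rho>: "0 < \<rho>" "\<rho> < 1"
  shows "fps_act K ((1 - fps_X) * geom_fps \<rho>) z = d"
proof -
  define e where "e = fps_act K ((1 - fps_X) * geom_fps \<rho>) z"
  have l: "l1_fps (1 - fps_const \<rho> * fps_X)" "l1_fps ((1 - fps_X) * geom_fps \<rho>)"
    using \<rho> by (auto intro: l1_fps_geom' l1_fps_diff l1_fps_1 l1_fps_mult l1_fps_const l1_fps_X)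
  have "fps_act K (1 - fps_const \<rho> * fps_X) e = fps_act K (1 - fps_X) z"
    unfolding e_def act_mult[OF l]
    using geom_fps_inverse[of \<rho>] by (simp add: mult.left_commute[of _ "1 - fps_X"])
  moreover have "fps_act K (fps_const \<rho> * fps_X) e = \<rho> *\<^sub>R K e"
    using act_mult[OF l1_fps_const l1_fps_X] by (simp add: act_const act_X)
  ultimately have "e - \<rho> *\<^sub>R K e = z - K z"
    by (simp add: act_diff act_1 act_X l1_fps_1 l1_fps_X l1_fps_mult l1_fps_const)
  have "d - e = ((d - \<rho> *\<^sub>R K d) - (e - \<rho> *\<^sub>R K e)) + (\<rho> *\<^sub>R K d - \<rho> *\<^sub>R K e)"
    by simp
  also have "\<dots> = \<rho> *\<^sub>R K (d - e)"
    unfolding d \<open>e - \<rho> *\<^sub>R K e = z - K z\<close> by (simp add: blinfun.diff_right scaleR_diff_right)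
  finally have w: "d - e = \<rho> *\<^sub>R K (d - e)" .
  have pw: "d - e = (\<rho> ^ n) *\<^sub>R (blinfun_apply K ^^ n) (d - e)" for n
  proof (induction n)
    case (Suc n)
    have "K (d - e) = (\<rho> ^ n) *\<^sub>R K ((blinfun_apply K ^^ n) (d - e))"
      by (subst Suc) (simp add: blinfun.scaleR_right)
    then show ?case by (subst w) simp
  qed simp
  have "norm (d - e) \<le> 0"
  proof (rule LIMSEQ_le_const)
    show "(\<lambda>n. \<rho> ^ n * (M * norm (d - e))) \<longlonglongrightarrow> 0"
      using \<rho> by (intro tendsto_mult_left_zero LIMSEQ_power_zero) auto
    have "norm (d - e) \<le> \<rho> ^ n * (M * norm (d - e))" for n
      using \<rho> by (subst pw[of n]) (auto intro!: mult_left_mono pow_bound)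
    then show "\<exists>N. \<forall>n\<ge>N. norm (d - e) \<le> \<rho> ^ n * (M * norm (d - e))" by blast
  qed
  then show ?thesis by (simp add: e_def)
qed

end

text \<open>
  Kaluza's theorem. The convolution equations for \<open>\<Phi>\<close> at the indices \<open>m\<close> and \<open>m + 1\<close>, the first one
  multiplied by \<open>u\<^sub>m\<^sub>+\<^sub>1/u\<^sub>m\<close>, differ by terms \<open>\<phi>\<^sub>k (u\<^sub>m\<^sub>+\<^sub>1\<^sub>-\<^sub>k - (u\<^sub>m\<^sub>+\<^sub>1/u\<^sub>m) u\<^sub>m\<^sub>-\<^sub>k)\<close>. These are nonnegative by
  induction, because the quotients \<open>u\<^sub>n\<^sub>+\<^sub>1/u\<^sub>n\<close> of a log-convex sequence increase; so \<open>\<phi>\<^sub>m\<^sub>+\<^sub>1 u\<^sub>0 \<le> 0\<close>.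
  The partial sums are nonnegative because \<open>u\<close> decreases:
  \<open>0 = \<Sum> \<phi>\<^sub>k u\<^sub>n\<^sub>-\<^sub>k \<le> u\<^sub>n \<Sum> \<phi>\<^sub>k\<close>.
\<close>

lemma kaluza:
  fixes U :: "real fps"
  assumes pos: "\<And>n. fps_nth U n > 0"
    and lc: "\<And>n. (fps_nth U (Suc n))\<^sup>2 \<le> fps_nth U n * fps_nth U (Suc (Suc n))"
    and dec: "\<And>n. fps_nth U (Suc n) \<le> fps_nth U n"
  defines "\<Phi> \<equiv> fps_const (fps_nth U 0) * inverse U"
  shows "\<Phi> * U = fps_const (fps_nth U 0)"
    and "fps_nth \<Phi> 0 = 1"
    and "n > 0 \<Longrightarrow> fps_nth \<Phi> n \<le> 0"
    and "0 \<le> (\<Sum>k\<le>n. fps_nth \<Phi> k)"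
proof -
  let ?u = "fps_nth U" and ?\<phi> = "fps_nth \<Phi>"
  have U0: "?u 0 \<noteq> 0" using pos[of 0] by simp
  show prod: "\<Phi> * U = fps_const (?u 0)"
    unfolding \<Phi>_def by (simp add: mult.assoc inverse_mult_eq_1[OF U0])
  show \<phi>0: "?\<phi> 0 = 1"
    unfolding \<Phi>_def using U0 by simp
  have rec: "(\<Sum>k\<le>n. ?\<phi> k * ?u (n - k)) = 0" if "n > 0" for n
    using arg_cong[OF prod, of "\<lambda>p. fps_nth p n"] that by (simp add: fps_mult_nth atLeast0AtMost)
  have ratio: "?u (Suc m) / ?u m \<le> ?u (Suc n) / ?u n" if "m \<le> n" for m n
    using that
  proof (rule lift_Suc_mono_le[rotated])
    show "?u (Suc n) / ?u n \<le> ?u (Suc (Suc n)) / ?u (Suc n)" for n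
      using lc[of n] pos[of n] pos[of "Suc n"] by (simp add: field_simps power2_eq_square)
  qed
  show neg: "?\<phi> n \<le> 0" if "n > 0" for n
    using that
  proof (induction n rule: less_induct)
    case (less n)
    show ?case
    proof (cases "n = 1")
      case True
      then have "?\<phi> 1 * ?u 0 = - ?u 1" using rec[of 1] \<phi>0 by (simp add: numeral_2_eq_2)
      then show ?thesis using pos[of 0] pos[of 1] True by (metis less_eq_real_def linorder_not_le mult_pos_pos neg_less_0_iff_less order_less_trans)
    next
      case False
      with less.prems obtain m where n: "n = Suc m" "m > 0" by (cases n) auto
      let ?q = "?u (Suc m) / ?u m"
      have s: "{..m} = insert 0 {1..m}" by auto
      have e1: "?u m + (\<Sum>k=1..m. ?\<phi> k * ?u (m - k)) = 0"
        using rec[of m] n \<phi>0 unfolding s by simp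
      have e2: "?u (Suc m) + (\<Sum>k=1..m. ?\<phi> k * ?u (Suc m - k)) + ?\<phi> n * ?u 0 = 0"
        using rec[of "Suc m"] n \<phi>0 unfolding atMost_Suc s by simp
      have "(\<Sum>k=1..m. ?\<phi> k * (?q * ?u (m - k))) \<le> (\<Sum>k=1..m. ?\<phi> k * ?u (Suc m - k))"
      proof (rule sum_mono)
        fix k assume k: "k \<in> {1..m}"
        have "?u (Suc (m - k)) / ?u (m - k) \<le> ?q" by (rule ratio) simp
        then have "?u (Suc m - k) \<le> ?q * ?u (m - k)"
          using pos[of "m - k"] k by (simp add: pos_divide_le_eq Suc_diff_le)
        moreover have "?\<phi> k \<le> 0" using less.IH[of k] k n by auto
        ultimately show "?\<phi> k * (?q * ?u (m - k)) \<le> ?\<phi> k * ?u (Suc m - k)"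
          by (rule mult_left_mono_neg)
      qed
      also have "(\<Sum>k=1..m. ?\<phi> k * (?q * ?u (m - k))) = ?q * (\<Sum>k=1..m. ?\<phi> k * ?u (m - k))"
        by (simp add: sum_distrib_left mult_ac)
      also have "\<dots> = - ?u (Suc m)"
        using e1 pos[of m] by (simp add: eq_neg_iff_add_eq_0[symmetric] add.commute[of "?u m"])
      finally have "?\<phi> n * ?u 0 \<le> 0" using e2 by linarith
      then show ?thesis using pos[of 0] by (simp add: mult_le_0_iff)
    qed
  qed
  show "0 \<le> (\<Sum>k\<le>n. ?\<phi> k)"
  proof (cases "n = 0")
    case False
    have decr: "?u m \<le> ?u k" if "k \<le> m" for k m
      using that by (rule lift_Suc_antimono_le[rotated]) (rule dec)
    have "0 = (\<Sum>k\<le>n. ?\<phi> k * ?u (n - k))" using rec[of n] False by simp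
    also have "\<dots> \<le> (\<Sum>k\<le>n. ?\<phi> k * ?u n)"
    proof (rule sum_mono)
      fix k assume "k \<in> {..n}"
      show "?\<phi> k * ?u (n - k) \<le> ?\<phi> k * ?u n"
      proof (cases "k = 0")
        case False
        then show ?thesis using neg[of k] by (intro mult_left_mono_neg decr) auto
      qed simp
    qed
    finally show ?thesis using pos[of n] by (simp add: sum_distrib_right[symmetric] zero_le_mult_iff)
  qed (simp add: \<phi>0)
qed

context power_bounded begin

text \<open>
  The vectors \<open>d\<^sub>j\<close> and \<open>e\<close> are \<open>(1 - K)/(1 - \<rho>\<^sub>j K) z\<close> and \<open>(1 - K)/(1 - r K) z\<close>. The value \<open>\<rho>\<^sub>j = 1\<close>,
  for which the equation does not determine \<open>d\<^sub>j\<close>, accounts for multiples of the identity.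

  With \<open>\<Phi> = u\<^sub>0/U\<close> and \<open>q = \<Phi>/(1 - r z)\<close> one has \<open>q(K) (\<Sum> m\<^sub>j d\<^sub>j) = u\<^sub>0 e\<close>, so everything depends on the
  \<open>\<ell>\<^sup>1\<close> norm of \<open>q\<close>. Let \<open>Q\<^sub>n\<close> be the partial sums of the coefficients of \<open>\<Phi>\<close>. Kaluza's theorem gives
  \<open>q\<^sub>n \<le> r\<^sup>n Q\<^sub>n\<close>, and the partial sums of \<open>q\<close> are nonnegative, so \<open>\<Sum> \<bar>q\<^sub>n\<bar> \<le> 2 \<Sum> r\<^sup>n Q\<^sub>n\<close>; finally
  \<open>U \<cdot> \<Sum> Q\<^sub>n z\<^sup>n = u\<^sub>0/(1 - z)\<close> evaluates the right-hand side at \<open>z = r\<close>.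
\<close>

lemma kaluza_quotient_estimate:
  fixes m \<rho> :: "'i \<Rightarrow> real" and d :: "'i \<Rightarrow> 'a"
  assumes J: "finite J" "\<And>j. j \<in> J \<Longrightarrow> 0 \<le> m j" "0 < (\<Sum>j\<in>J. m j)"
    and \<rho>: "\<And>j. j \<in> J \<Longrightarrow> 0 < \<rho> j" "\<And>j. j \<in> J \<Longrightarrow> \<rho> j \<le> 1"
    and d: "\<And>j. j \<in> J \<Longrightarrow> d j - \<rho> j *\<^sub>R K (d j) = z - K z"
    and d1: "\<And>j. j \<in> J \<Longrightarrow> \<rho> j = 1 \<Longrightarrow> d j = z"
    and r: "0 < r" "r < 1" and e: "e - r *\<^sub>R K e = z - K z"
  shows "(\<Sum>j\<in>J. m j * ((1 - r) / (1 - r * \<rho> j))) * norm e \<le> 2 * M * norm (\<Sum>j\<in>J. m j *\<^sub>R d j)"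
proof -
  define U where "U = (\<Sum>j\<in>J. fps_const (m j) * geom_fps (\<rho> j))"
  have u: "fps_nth U n = (\<Sum>j\<in>J. m j * \<rho> j ^ n)" for n
    by (simp add: U_def fps_sum_nth)
  define u0 where "u0 = fps_nth U 0"
  have u0: "u0 > 0" using J by (simp add: u0_def u)
  obtain j0 where j0: "j0 \<in> J" "m j0 > 0"
    using J by (metis less_eq_real_def linorder_not_le sum_nonpos)
  have pos: "fps_nth U n > 0" for n
    unfolding u using j0 J \<rho> by (intro sum_pos2[of J j0]) (auto simp: less_imp_le)
  have dec: "fps_nth U (Suc n) \<le> fps_nth U n" for n
    unfolding u using J \<rho> by (intro sum_mono mult_left_mono power_Suc_le_self) (auto simp: less_imp_le)
  have lc: "(fps_nth U (Suc n))\<^sup>2 \<le> fps_nth U n * fps_nth U (Suc (Suc n))" for n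
  proof -
    \<comment> \<open>log-convexity from the nonnegativity of \<open>\<Sum> m\<^sub>j \<rho>\<^sub>j\<^sup>n (\<rho>\<^sub>j - t)\<^sup>2\<close> at its minimum in \<open>t\<close>\<close>
    define t where "t = fps_nth U (Suc n) / fps_nth U n"
    have "0 \<le> (\<Sum>j\<in>J. m j * \<rho> j ^ n * (\<rho> j - t)\<^sup>2)"
      using J \<rho> by (intro sum_nonneg mult_nonneg_nonneg) (auto simp: less_imp_le)
    also have "\<dots> = fps_nth U (Suc (Suc n)) - 2 * t * fps_nth U (Suc n) + t\<^sup>2 * fps_nth U n"
      unfolding u sum_distrib_left sum_subtractf[symmetric] sum.distrib[symmetric]
      by (intro sum.cong) (auto simp: power2_eq_square algebra_simps)
    also have "\<dots> = fps_nth U (Suc (Suc n)) - (fps_nth U (Suc n))\<^sup>2 / fps_nth U n"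
      using pos[of n] by (simp add: t_def power2_eq_square)
    finally show ?thesis using pos[of n] by (simp add: field_simps)
  qed
  define \<Phi> where "\<Phi> = fps_const (fps_nth U 0) * inverse U"
  let ?\<phi> = "fps_nth \<Phi>"
  note kal = kaluza[OF pos lc dec, folded \<Phi>_def]
  define Q where "Q = (\<lambda>n. \<Sum>k\<le>n. ?\<phi> k)"
  have Q: "0 \<le> Q n" "Q n \<le> 1" for n
  proof -
    show "0 \<le> Q n" unfolding Q_def by (rule kal(4))
    have "Q n = ?\<phi> 0 + (\<Sum>k\<in>{1..n}. ?\<phi> k)"
      unfolding Q_def by (subst sum.remove[of _ 0]) (auto intro!: sum.cong)
    also have "(\<Sum>k\<in>{1..n}. ?\<phi> k) \<le> 0" by (intro sum_nonpos kal(3)) auto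
    finally show "Q n \<le> 1" using kal(2) by simp
  qed
  have l\<Phi>: "l1_fps \<Phi>"
    unfolding l1_fps_def
  proof (rule summableI_nonneg_bounded)
    fix n
    show "(\<Sum>k<n. \<bar>?\<phi> k\<bar>) \<le> 2"
    proof (cases n)
      case (Suc l)
      have "(\<Sum>k<n. \<bar>?\<phi> k\<bar>) = ?\<phi> 0 + (\<Sum>k\<in>{1..l}. - ?\<phi> k)"
        unfolding Suc lessThan_Suc_atMost using kal(2) kal(3)
        by (subst sum.remove[of _ 0]) (auto intro!: sum.cong simp: abs_of_nonpos)
      also have "\<dots> = 2 * ?\<phi> 0 - Q l"
        unfolding Q_def by (subst (2) sum.remove[of _ 0]) (auto intro!: sum.cong simp: sum_negf)
      finally show ?thesis using Q[of l] kal(2) by simp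
    qed simp
  qed simp
  define q where "q = \<Phi> * geom_fps r"
  have qn: "fps_nth q n = (\<Sum>k\<le>n. ?\<phi> k * r ^ (n - k))" for n
    by (simp add: q_def fps_mult_nth atLeast0AtMost)
  have lq: "l1_fps q" unfolding q_def using r by (intro l1_fps_mult l\<Phi> l1_fps_geom) auto
  have q_le: "fps_nth q n \<le> r ^ n * Q n" for n
    unfolding qn Q_def sum_distrib_left
  proof (rule sum_mono)
    fix k assume k: "k \<in> {..n}"
    show "?\<phi> k * r ^ (n - k) \<le> r ^ n * ?\<phi> k"
    proof (cases "k = 0")
      case False
      have "r ^ n \<le> r ^ (n - k)" using r by (intro power_decreasing) auto
      then show ?thesis using mult_left_mono_neg[of "r ^ n" "r ^ (n - k)" "?\<phi> k"] kal(3)[of k] False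
        by (simp add: mult.commute)
    qed simp
  qed
  have q_rec: "fps_nth q (Suc n) = r * fps_nth q n + ?\<phi> (Suc n)" for n
  proof -
    have "(\<Sum>k\<le>n. ?\<phi> k * r ^ (Suc n - k)) = (\<Sum>k\<le>n. r * (?\<phi> k * r ^ (n - k)))"
      by (intro sum.cong) (auto simp: Suc_diff_le)
    then show ?thesis unfolding qn by (simp add: sum_distrib_left)
  qed
  have q_sum: "0 \<le> (\<Sum>n\<le>N. fps_nth q n)" for N
  proof (induction N)
    case 0
    then show ?case using kal(2) by (simp add: qn)
  next
    case (Suc N)
    have "(\<Sum>n\<le>Suc N. fps_nth q n) = fps_nth q 0 + (\<Sum>n\<le>N. fps_nth q (Suc n))"
      by (rule sum.atMost_Suc_shift)
    also have "\<dots> = r * (\<Sum>n\<le>N. fps_nth q n) + (?\<phi> 0 + (\<Sum>n\<le>N. ?\<phi> (Suc n)))"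
      by (simp add: q_rec sum.distrib sum_distrib_left) (simp add: qn)
    also have "?\<phi> 0 + (\<Sum>n\<le>N. ?\<phi> (Suc n)) = Q (Suc N)"
      unfolding Q_def by (rule sum.atMost_Suc_shift[symmetric])
    finally show ?case using Suc r Q[of "Suc N"] by simp
  qed
  define V where "V = (\<Sum>j\<in>J. m j / (1 - r * \<rho> j))"
  have r\<rho>: "0 < r * \<rho> j" "r * \<rho> j < 1" if "j \<in> J" for j
  proof -
    show "0 < r * \<rho> j" using r \<rho>[OF that] by simp
    have "r * \<rho> j \<le> r * 1" using r \<rho>[OF that] by (intro mult_left_mono) auto
    then show "r * \<rho> j < 1" using r by linarith
  qed
  have sV: "(\<lambda>n. r ^ n * fps_nth U n) sums V"
  proof -
    have "(\<lambda>n. \<Sum>j\<in>J. m j * (r * \<rho> j) ^ n) sums (\<Sum>j\<in>J. m j * (1 / (1 - r * \<rho> j)))"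
      using r\<rho> by (intro sums_sum sums_mult geometric_sums) (auto simp: abs_of_pos)
    then show ?thesis by (simp add: u V_def sum_distrib_left power_mult_distrib mult_ac)
  qed
  have V: "V > 0"
    unfolding V_def using j0 J r\<rho> by (intro sum_pos2[of J j0]) (auto simp: less_imp_le)
  have sQ: "summable (\<lambda>n. \<bar>r ^ n * Q n\<bar>)"
    using r Q by (intro summable_comparison_test'[where N=0, OF summable_geometric[of r]])
      (auto simp: abs_mult power_abs intro!: mult_left_le)
  have prodQ: "(\<Sum>n. r ^ n * Q n) * V = u0 / (1 - r)"
  proof -
    have "(\<lambda>k. \<Sum>i\<le>k. (r ^ i * Q i) * (r ^ (k - i) * fps_nth U (k - i))) sums
       ((\<Sum>n. r ^ n * Q n) * (\<Sum>n. r ^ n * fps_nth U n))"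
      using sQ sums_summable[OF sV] pos r
      by (intro Cauchy_product_sums) (auto simp: abs_mult less_imp_le)
    moreover have "(\<Sum>i\<le>k. (r ^ i * Q i) * (r ^ (k - i) * fps_nth U (k - i))) = u0 * r ^ k" for k
    proof -
      have "Q i = fps_nth (\<Phi> * geom_fps 1) i" for i
        by (simp add: Q_def fps_mult_nth atLeast0AtMost)
      then have "(\<Sum>i\<le>k. Q i * fps_nth U (k - i)) = fps_nth (\<Phi> * geom_fps 1 * U) k"
        by (simp add: fps_mult_nth[of _ U] atLeast0AtMost)
      also have "\<Phi> * geom_fps 1 * U = fps_const u0 * geom_fps 1"
        using kal(1) by (simp add: u0_def mult_ac)
      finally have "(\<Sum>i\<le>k. Q i * fps_nth U (k - i)) = u0" by simp
      moreover have "(\<Sum>i\<le>k. (r ^ i * Q i) * (r ^ (k - i) * fps_nth U (k - i))) = (\<Sum>i\<le>k. r ^ k * (Q i * fps_nth U (k - i)))"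
        by (intro sum.cong) (auto simp: power_add[symmetric] mult_ac)
      ultimately show ?thesis by (simp add: sum_distrib_left[symmetric] mult.commute)
    qed
    ultimately have "(\<lambda>k. u0 * r ^ k) sums ((\<Sum>n. r ^ n * Q n) * V)"
      using sV by (simp add: sums_iff)
    moreover have "(\<lambda>k. u0 * r ^ k) sums (u0 * (1 / (1 - r)))"
      using r by (intro sums_mult geometric_sums) auto
    ultimately show ?thesis using sums_unique2 by fastforce
  qed
  have q_abs: "(\<Sum>n<N. \<bar>fps_nth q n\<bar>) \<le> 2 * (u0 / ((1 - r) * V))" for N
  proof (cases N)
    case (Suc L)
    have "(\<Sum>n<N. \<bar>fps_nth q n\<bar>) \<le> (\<Sum>n\<le>L. 2 * (r ^ n * Q n) - fps_nth q n)"
      unfolding Suc lessThan_Suc_atMost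
    proof (rule sum_mono)
      fix n
      have "0 \<le> r ^ n * Q n" using r Q by simp
      then show "\<bar>fps_nth q n\<bar> \<le> 2 * (r ^ n * Q n) - fps_nth q n" using q_le[of n] by linarith
    qed
    also have "\<dots> \<le> 2 * (\<Sum>n\<le>L. r ^ n * Q n)"
      using q_sum[of L] by (simp add: sum_subtractf sum_distrib_left)
    also have "(\<Sum>n\<le>L. r ^ n * Q n) \<le> (\<Sum>n. r ^ n * Q n)"
      using r Q by (intro sum_le_suminf summable_rabs_cancel[OF sQ]) auto
    also have "(\<Sum>n. r ^ n * Q n) = u0 / ((1 - r) * V)"
      using prodQ V r by (simp add: field_simps)
    finally show ?thesis by simp
  qed (use u0 V r in simp)
  define y where "y = (\<Sum>j\<in>J. m j *\<^sub>R d j)"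
  have lG: "l1_fps ((1 - fps_X) * geom_fps (\<rho> j))" if "j \<in> J" for j
    using \<rho>[OF that] by (rule l1_fps_geom')
  have dj: "fps_act K ((1 - fps_X) * geom_fps (\<rho> j)) z = d j" if "j \<in> J" for j
  proof (cases "\<rho> j = 1")
    case True
    then show ?thesis using d1[OF that] by (simp add: geom_fps_1_inverse act_1)
  next
    case False
    then show ?thesis using act_geom[OF d[OF that]] \<rho>[OF that] by simp
  qed
  have vU: "(1 - fps_X) * U = (\<Sum>j\<in>J. fps_const (m j) * ((1 - fps_X) * geom_fps (\<rho> j)))"
    unfolding U_def by (simp add: sum_distrib_left mult.left_commute)
  have lv: "l1_fps ((1 - fps_X) * U)"
    unfolding vU by (intro l1_fps_sum l1_fps_mult[OF l1_fps_const] lG)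
  have y: "fps_act K ((1 - fps_X) * U) z = y"
    unfolding vU y_def
    by (subst act_sum) (auto intro!: l1_fps_mult[OF l1_fps_const] lG simp: act_mult[symmetric] l1_fps_const lG act_const dj)
  have "fps_act K q y = fps_act K (q * ((1 - fps_X) * U)) z"
    unfolding y[symmetric] by (rule act_mult[OF lq lv])
  also have "q * ((1 - fps_X) * U) = (\<Phi> * U) * ((1 - fps_X) * geom_fps r)"
    unfolding q_def by (simp only: mult_ac)
  also have "\<dots> = fps_const u0 * ((1 - fps_X) * geom_fps r)"
    by (simp add: kal(1) u0_def)
  also have "fps_act K \<dots> z = u0 *\<^sub>R e"
    using act_mult[OF l1_fps_const l1_fps_geom'[of r], of u0 z] r act_geom[OF e r] by (simp add: act_const)
  finally have "u0 * norm e = norm (fps_act K q y)" using u0 by simp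
  also have "\<dots> \<le> M * (2 * (u0 / ((1 - r) * V))) * norm y"
    by (rule norm_act[OF lq q_abs])
  finally have "u0 * ((1 - r) * V * norm e) \<le> u0 * (2 * M * norm y)"
    using V r u0 by (simp add: field_simps)
  then have "(1 - r) * V * norm e \<le> 2 * M * norm y"
    using u0 by simp
  then show ?thesis by (simp add: V_def y_def sum_distrib_left mult.commute)
qed

end

section \<open>Bounded semigroups and the resolvents of their generators\<close>

text \<open>
  Generators are defined by one-sided limits at \<open>0\<close>.
\<close>

lemma right_difference_quotient:
  fixes f :: "real \<Rightarrow> 'a::real_normed_vector"
  assumes "(f has_vector_derivative D) (at 0 within S)" and "{0..\<delta>} \<subseteq> S" "\<delta> > 0"
  shows "((\<lambda>t. (1 / t) *\<^sub>R (f t - f 0)) \<longlongrightarrow> D) (at_right 0)"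
proof -
  have ev: "\<forall>\<^sub>F t in at_right 0. (0::real) < t"
    by (rule eventually_at_right_less)
  have "(f has_vector_derivative D) (at 0 within {0..\<delta>})"
    using assms(1,2) has_vector_derivative_within_subset by blast
  then have "((\<lambda>y. (f y - (f 0 + (y - 0) *\<^sub>R D)) /\<^sub>R norm (y - 0)) \<longlongrightarrow> 0) (at 0 within {0..\<delta>})"
    unfolding has_vector_derivative_def has_derivative_within by (simp add: divide_inverse)
  also have "at 0 within {0..\<delta>} = at_right 0"
    using assms(3) by (rule at_within_Icc_at_right)
  finally have "((\<lambda>y. (f y - (f 0 + (y - 0) *\<^sub>R D)) /\<^sub>R norm (y - 0) + D) \<longlongrightarrow> 0 + D) (at_right 0)"
    by (intro tendsto_add tendsto_const)
  then have "((\<lambda>y. (f y - (f 0 + (y - 0) *\<^sub>R D)) /\<^sub>R norm (y - 0) + D) \<longlongrightarrow> D) (at_right 0)"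
    by simp
  then show ?thesis
  proof (rule Lim_transform_eventually)
    show "\<forall>\<^sub>F y in at_right 0. (f y - (f 0 + (y - 0) *\<^sub>R D)) /\<^sub>R norm (y - 0) + D = (1 / y) *\<^sub>R (f y - f 0)"
      using ev by eventually_elim (auto simp: algebra_simps divide_inverse)
  qed
qed

locale bounded_semigroup =
  fixes T :: "real \<Rightarrow> 'a::banach \<Rightarrow>\<^sub>L 'a" and A :: "'a operator" and M :: real
  assumes T_0: "T 0 = id_blinfun"
    and T_plus: "0 \<le> s \<Longrightarrow> 0 \<le> t \<Longrightarrow> T (s + t) = T s o\<^sub>L T t"
    and T_cont0: "((\<lambda>t. T t x) \<longlongrightarrow> x) (at_right 0)"
    and T_bound: "0 \<le> t \<Longrightarrow> norm (T t) \<le> M"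
    and M_ge_1: "1 \<le> M"
    and gen: "generator T = neg_op A"
begin

lemma T_norm: "0 \<le> t \<Longrightarrow> norm (T t x) \<le> M * norm x"
  using norm_blinfun[of "T t" x] mult_right_mono[OF T_bound[of t] norm_ge_zero[of x]] by linarith

lemma T_T: "0 \<le> s \<Longrightarrow> 0 \<le> t \<Longrightarrow> T s (T t x) = T (s + t) x"
  by (simp add: T_plus)

lemma A_iff: "(x, y) \<in> A \<longleftrightarrow> ((\<lambda>t. (1 / t) *\<^sub>R (T t x - x)) \<longlongrightarrow> - y) (at_right 0)"
proof -
  have "(x, y) \<in> A \<longleftrightarrow> (x, - y) \<in> neg_op A"
    by (auto simp: neg_op_def)
  then show ?thesis by (simp add: gen[symmetric] generator_def)
qed

lemma A_add: "(x, y) \<in> A \<Longrightarrow> (x', y') \<in> A \<Longrightarrow> (x + x', y + y') \<in> A"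
  unfolding A_iff using tendsto_add[of "\<lambda>t. (1 / t) *\<^sub>R (T t x - x)" "- y" "at_right 0" "\<lambda>t. (1 / t) *\<^sub>R (T t x' - x')" "- y'"]
  by (simp add: blinfun.add_right algebra_simps)

lemma A_scaleR: "(x, y) \<in> A \<Longrightarrow> (c *\<^sub>R x, c *\<^sub>R y) \<in> A"
  unfolding A_iff using tendsto_scaleR[OF tendsto_const[of c], of "\<lambda>t. (1 / t) *\<^sub>R (T t x - x)" "- y" "at_right 0"]
  by (simp add: blinfun.scaleR_right algebra_simps)

lemma A_T:
  assumes "(x, y) \<in> A" "0 \<le> t"
  shows "(T t x, T t y) \<in> A"
  unfolding A_iff
proof (rule Lim_transform_eventually)
  show "((\<lambda>h. T t ((1 / h) *\<^sub>R (T h x - x))) \<longlongrightarrow> - T t y) (at_right 0)"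
    using blinfun.tendsto[OF tendsto_const[of "T t"] assms(1)[unfolded A_iff]] by (simp add: blinfun.minus_right)
  have "\<forall>\<^sub>F h in at_right 0. (0::real) < h" by (simp add: eventually_at_right_less)
  then show "\<forall>\<^sub>F h in at_right 0. T t ((1 / h) *\<^sub>R (T h x - x)) = (1 / h) *\<^sub>R (T h (T t x) - T t x)"
    by eventually_elim (use assms in \<open>simp add: blinfun.scaleR_right blinfun.diff_right T_T add.commute\<close>)
qed

text \<open>
  An equivalent norm that turns \<open>T\<close> into a contraction semigroup. It makes the resolvent estimate
  hold with constant \<open>1\<close>, which is what survives taking powers.
\<close>

definition orbit_norm :: "'a \<Rightarrow> real" where "orbit_norm x = (SUP t\<in>{0..}. norm (T t x))"

lemma orbit_norm_bdd: "bdd_above ((\<lambda>t. norm (T t x)) ` {0..})"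
  using T_norm by (auto intro!: bdd_aboveI[of _ "M * norm x"])

lemma T_le_orbit_norm: "0 \<le> t \<Longrightarrow> norm (T t x) \<le> orbit_norm x"
  unfolding orbit_norm_def by (rule cSUP_upper) (auto simp: orbit_norm_bdd)

lemma orbit_norm_leI: "(\<And>t. 0 \<le> t \<Longrightarrow> norm (T t x) \<le> b) \<Longrightarrow> orbit_norm x \<le> b"
  unfolding orbit_norm_def by (rule cSUP_least) auto

lemma norm_le_orbit_norm: "norm x \<le> orbit_norm x"
  using T_le_orbit_norm[of 0 x] by (simp add: T_0)

lemma orbit_norm_le: "orbit_norm x \<le> M * norm x"
  by (rule orbit_norm_leI) (rule T_norm)

lemma orbit_norm_T: "0 \<le> t \<Longrightarrow> orbit_norm (T t x) \<le> orbit_norm x"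
  by (rule orbit_norm_leI) (simp add: T_T T_le_orbit_norm)

lemma orbit_norm_triangle: "orbit_norm (x + y) \<le> orbit_norm x + orbit_norm y"
proof (rule orbit_norm_leI)
  fix t :: real assume t: "0 \<le> t"
  have "norm (T t (x + y)) \<le> norm (T t x) + norm (T t y)"
    by (simp add: blinfun.add_right norm_triangle_ineq)
  with T_le_orbit_norm[OF t, of x] T_le_orbit_norm[OF t, of y] show "norm (T t (x + y)) \<le> orbit_norm x + orbit_norm y" by linarith
qed

lemma orbit_norm_scaleR_le: "0 < c \<Longrightarrow> orbit_norm (c *\<^sub>R x) \<le> c * orbit_norm x"
  by (rule orbit_norm_leI) (simp add: blinfun.scaleR_right T_le_orbit_norm)

lemma orbit_norm_scaleR: "0 < c \<Longrightarrow> orbit_norm (c *\<^sub>R x) = c * orbit_norm x"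
  using orbit_norm_scaleR_le[of c x] orbit_norm_scaleR_le[of "1/c" "c *\<^sub>R x"] by (simp add: field_simps)

text \<open>
  The vector \<open>w\<^sub>h = s x - (T(h) x - x)/h\<close> tends to \<open>s x + y\<close> and satisfies
  \<open>(1 + s h) x = h w\<^sub>h + T(h) x\<close>; since \<open>T(h)\<close> is a contraction for the norm \<open>orbit_norm\<close>, it has
  \<open>s orbit_norm x \<le> orbit_norm w\<^sub>h\<close>.
\<close>

lemma dissipative:
  assumes A: "(x, y) \<in> A" and s: "0 < s"
  shows "s * orbit_norm x \<le> orbit_norm (s *\<^sub>R x + y)"
proof -
  define w where "w = (\<lambda>h. s *\<^sub>R x - (1 / h) *\<^sub>R (T h x - x))"
  have lim: "(w \<longlongrightarrow> s *\<^sub>R x + y) (at_right 0)"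
    unfolding w_def using tendsto_diff[OF tendsto_const A[unfolded A_iff]] by simp
  have "((\<lambda>h. orbit_norm (s *\<^sub>R x + y) + M * norm (w h - (s *\<^sub>R x + y))) \<longlongrightarrow> orbit_norm (s *\<^sub>R x + y) + M * 0) (at_right 0)"
    by (intro tendsto_intros tendsto_norm_zero LIM_zero lim)
  moreover have "\<forall>\<^sub>F h in at_right 0. s * orbit_norm x \<le> orbit_norm (s *\<^sub>R x + y) + M * norm (w h - (s *\<^sub>R x + y))"
    using eventually_at_right_less[of 0]
  proof eventually_elim
    case (elim h)
    have "(1 + s * h) *\<^sub>R x = h *\<^sub>R w h + T h x"
      using elim by (simp add: w_def algebra_simps)
    then have "(1 + s * h) * orbit_norm x = orbit_norm (h *\<^sub>R w h + T h x)"
      using orbit_norm_scaleR[of "1 + s * h" x] elim s by (simp add: add_pos_pos)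
    also have "\<dots> \<le> h * orbit_norm (w h) + orbit_norm x"
      using orbit_norm_triangle[of "h *\<^sub>R w h" "T h x"] orbit_norm_T[of h x] orbit_norm_scaleR[of h] elim by simp
    finally have "h * (s * orbit_norm x) \<le> h * orbit_norm (w h)" by (simp add: algebra_simps)
    then have "s * orbit_norm x \<le> orbit_norm (w h)" using elim by simp
    also have "orbit_norm (w h) \<le> orbit_norm (s *\<^sub>R x + y) + orbit_norm (w h - (s *\<^sub>R x + y))"
      using orbit_norm_triangle[of "s *\<^sub>R x + y" "w h - (s *\<^sub>R x + y)"] by simp
    finally show ?case using orbit_norm_le[of "w h - (s *\<^sub>R x + y)"] by linarith
  qed
  ultimately have "s * orbit_norm x \<le> orbit_norm (s *\<^sub>R x + y) + M * 0"
    by (rule tendsto_lowerbound) simp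
  then show ?thesis by simp
qed

lemma orbit_continuous: "continuous_on {0..} (\<lambda>t. T t x)"
proof (rule continuous_onI)
  have M: "M > 0" using M_ge_1 by simp
  fix t e :: real assume t: "t \<in> {0..}" and e: "e > 0"
  have "\<forall>\<^sub>F h in at_right 0. dist (T h x) x < e / (2 * M)"
    using tendstoD[OF T_cont0[of x], of "e / (2 * M)"] e M by simp
  then obtain d where d: "d > 0" "\<And>h. 0 < h \<Longrightarrow> h < d \<Longrightarrow> dist (T h x) x < e / (2 * M)"
    unfolding eventually_at_right_field by auto
  have main: "dist (T (u + h) x) (T u x) \<le> e" if "0 \<le> u" "0 \<le> h" "h < d" for u h
  proof (cases "h = 0")
    case False
    have "dist (T (u + h) x) (T u x) = norm (T u (T h x - x))"
      using that by (simp add: dist_norm T_T[symmetric] blinfun.diff_right)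
    also have "\<dots> \<le> M * norm (T h x - x)" using that by (intro T_norm)
    also have "\<dots> \<le> M * (e / (2 * M))"
      using d(2)[of h] that False M by (intro mult_left_mono) (auto simp: dist_norm)
    also have "\<dots> \<le> e" using M e by simp
    finally show ?thesis .
  qed (use e in simp)
  show "\<exists>d>0. \<forall>t'\<in>{0..}. dist t' t < d \<longrightarrow> dist (T t' x) (T t x) \<le> e"
  proof (intro exI[of _ d] conjI ballI impI d(1))
    fix t' :: real assume t': "t' \<in> {0..}" "dist t' t < d"
    show "dist (T t' x) (T t x) \<le> e"
    proof (cases "t \<le> t'")
      case True
      then show ?thesis using main[of t "t' - t"] t t' by (simp add: dist_real_def)
    next
      case False
      then show ?thesis using main[of t' "t - t'"] t t' by (simp add: dist_real_def dist_commute)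
    qed
  qed
qed

text \<open>
  For \<open>s > 0\<close> and large \<open>b\<close> the vector \<open>v\<close> nearly solves \<open>(s + A) v = x\<close>; for \<open>s = 0\<close> and small \<open>b\<close> the
  means \<open>v/b\<close> show that the domain is dense.
\<close>

lemma truncated_laplace:
  fixes x :: 'a and b s :: real
  assumes b: "0 < b" and s: "0 \<le> s"
  defines "v \<equiv> integral {0..b} (\<lambda>t. exp (- s * t) *\<^sub>R T t x)"
  shows "(v, x - exp (- s * b) *\<^sub>R T b x - s *\<^sub>R v) \<in> A"
    and "((\<lambda>b. (1 / b) *\<^sub>R integral {0..b} (\<lambda>t. exp (- s * t) *\<^sub>R T t x)) \<longlongrightarrow> x) (at_right 0)"
proof -
  define u where "u = (\<lambda>t. exp (- s * t) *\<^sub>R T t x)"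
  have cu: "continuous_on {0..} u"
    unfolding u_def by (intro continuous_intros orbit_continuous)
  define P where "P = (\<lambda>t. integral {0..t} u)"
  have cu': "continuous_on {0..c} u" for c by (rule continuous_on_subset[OF cu]) auto
  have dP: "(P has_vector_derivative u t) (at t within {0..c})" if "0 \<le> t" "t \<le> c" for t c
    unfolding P_def using that by (intro integral_has_vector_derivative cu') auto
  have P0: "P 0 = 0" by (simp add: P_def)
  have u0: "u 0 = x" by (simp add: u_def T_0)
  show "((\<lambda>b. (1 / b) *\<^sub>R integral {0..b} (\<lambda>t. exp (- s * t) *\<^sub>R T t x)) \<longlongrightarrow> x) (at_right 0)"
  proof -
    have "((\<lambda>t. (1 / t) *\<^sub>R (P t - P 0)) \<longlongrightarrow> u 0) (at_right 0)"
      by (rule right_difference_quotient[OF dP[of 0 1], where \<delta>=1]) auto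
    then show ?thesis unfolding P0 u0 by (simp add: P_def u_def)
  qed
  define \<phi> where "\<phi> = (\<lambda>h. exp (s * h) *\<^sub>R (P (b + h) - P h))"
  have "((\<lambda>h. P (b + h)) has_vector_derivative u b) (at 0 within {0..1})"
  proof -
    have "((P \<circ> (\<lambda>h. b + h)) has_vector_derivative 1 *\<^sub>R u b) (at 0 within {0..1})"
    proof (rule vector_diff_chain_within)
      show "((+) b has_vector_derivative 1) (at 0 within {0..1})"
        by (auto intro!: derivative_eq_intros)
      show "(P has_vector_derivative u b) (at (b + 0) within (+) b ` {0..1})"
        using dP[of b "b + 1"] b by (auto intro: has_vector_derivative_within_subset)
    qed
    then show ?thesis by (simp add: o_def)
  qed
  moreover have "(P has_vector_derivative u 0) (at 0 within {0..1})" by (rule dP) auto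
  ultimately have "((\<lambda>h. P (b + h) - P h) has_vector_derivative u b - u 0) (at 0 within {0..1})"
    by (rule has_vector_derivative_diff)
  moreover have "((\<lambda>h. exp (s * h)) has_field_derivative s) (at 0 within {0..1})"
    by (auto intro!: derivative_eq_intros)
  ultimately have "(\<phi> has_vector_derivative exp (s * 0) *\<^sub>R (u b - u 0) + s *\<^sub>R (P (b + 0) - P 0)) (at 0 within {0..1})"
    unfolding \<phi>_def by (intro has_vector_derivative_scaleR)
  then have d\<phi>: "(\<phi> has_vector_derivative (u b - x) + s *\<^sub>R P b) (at 0 within {0..1})"
    by (simp add: P0 u0)
  have vP: "v = P b" unfolding v_def P_def u_def by simp
  have Tv: "T h v = \<phi> h" if h: "0 < h" for h
  proof -
    have i: "u integrable_on {0..c}" for c by (rule integrable_continuous_real[OF cu'])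
    have "(u has_integral (P b)) {0..b}"
      unfolding P_def using i by (rule integrable_integral)
    then have "((\<lambda>t. T h (u t)) has_integral T h (P b)) {0..b}"
      using has_integral_linear[of u "P b" "{0..b}" "blinfun_apply (T h)"] by (simp add: o_def blinfun.bounded_linear_right)
    moreover have "((\<lambda>t. T h (u t)) has_integral \<phi> h) {0..b}"
    proof -
      have "integral {0..h} u + integral {h..b + h} u = integral {0..b + h} u"
        using h b by (intro Henstock_Kurzweil_Integration.integral_combine i) auto
      then have "(u has_integral (P (b + h) - P h)) {h..b + h}"
        using i[of "b + h"] h
        by (simp add: P_def algebra_simps has_integral_iff) (metis integrable_on_subinterval atLeastatMost_subset_iff less_eq_real_def order_refl)
      then have "((u \<circ> (+) h) has_integral (P (b + h) - P h)) {0..b}"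
        unfolding has_integral_shift_Icc_real by simp
      then have "((\<lambda>t. exp (s * h) *\<^sub>R (u \<circ> (+) h) t) has_integral \<phi> h) {0..b}"
        unfolding \<phi>_def by (rule has_integral_cmul)
      then show ?thesis
      proof (rule has_integral_eq[rotated])
        fix t assume "t \<in> {0..b}"
        then show "exp (s * h) *\<^sub>R (u \<circ> (+) h) t = T h (u t)"
          using h by (simp add: u_def blinfun.scaleR_right T_T exp_add[symmetric] algebra_simps)
      qed
    qed
    ultimately have "T h (P b) = \<phi> h" by (rule has_integral_unique)
    then show ?thesis by (simp add: vP)
  qed
  have \<phi>0: "\<phi> 0 = v" by (simp add: \<phi>_def P0 vP)
  have "((\<lambda>h. (1 / h) *\<^sub>R (\<phi> h - \<phi> 0)) \<longlongrightarrow> (u b - x) + s *\<^sub>R v) (at_right 0)"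
    unfolding vP by (rule right_difference_quotient[OF d\<phi>, where \<delta>=1]) auto
  then have "((\<lambda>h. (1 / h) *\<^sub>R (T h v - v)) \<longlongrightarrow> (u b - x) + s *\<^sub>R v) (at_right 0)"
    by (rule Lim_transform_eventually) (use eventually_at_right_less[of 0] in \<open>eventually_elim, simp add: Tv \<phi>0\<close>)
  then show "(v, x - exp (- s * b) *\<^sub>R T b x - s *\<^sub>R v) \<in> A"
    unfolding A_iff by (simp add: u_def algebra_simps)
qed

text \<open>
  The range of \<open>s + A\<close> contains all \<open>z - e\<^sup>-\<^sup>s\<^sup>b T(b) z\<close>. For \<open>b\<close> so large that \<open>e\<^sup>-\<^sup>s\<^sup>b M \<le> 1/2\<close>, every
  vector has this form by the contraction principle.
\<close>

lemma resolvent_surjective: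
  assumes s: "0 < s"
  shows "\<exists>x y. (x, y) \<in> A \<and> s *\<^sub>R x + y = w"
proof -
  define b where "b = 2 * M / s"
  have b: "b > 0" using s M_ge_1 by (simp add: b_def)
  have c: "exp (- s * b) * M \<le> 1 / 2"
  proof -
    have "s * b = 2 * M" using s by (simp add: b_def)
    then have "2 * M \<le> exp (s * b)" using exp_ge_add_one_self[of "s * b"] by linarith
    then show ?thesis by (simp add: exp_minus field_simps)
  qed
  have "\<exists>!z. w + exp (- s * b) *\<^sub>R T b z = z"
  proof (rule banach_fix_type[where c="1/2"])
    show "\<forall>x y. dist (w + exp (- s * b) *\<^sub>R T b x) (w + exp (- s * b) *\<^sub>R T b y) \<le> 1 / 2 * dist x y"
    proof (intro allI)
      fix x y
      have "dist (w + exp (- s * b) *\<^sub>R T b x) (w + exp (- s * b) *\<^sub>R T b y) = exp (- s * b) * norm (T b (x - y))"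
        by (simp add: dist_norm blinfun.diff_right flip: scaleR_diff_right)
      also have "\<dots> \<le> exp (- s * b) * (M * norm (x - y))"
        using b by (intro mult_left_mono T_norm) auto
      also have "\<dots> \<le> 1 / 2 * dist x y"
        using mult_right_mono[OF c, of "dist x y"] by (simp add: dist_norm mult_ac)
      finally show "dist (w + exp (- s * b) *\<^sub>R T b x) (w + exp (- s * b) *\<^sub>R T b y) \<le> 1 / 2 * dist x y" .
    qed
  qed auto
  then obtain z where z: "w + exp (- s * b) *\<^sub>R T b z = z" by blast
  then have "z - exp (- s * b) *\<^sub>R T b z = w" by (metis add_diff_cancel_right')
  with truncated_laplace(1)[OF b, of s z] s show ?thesis
    by (intro exI conjI) (assumption | simp)+
qed

lemma resolvent_injective:
  assumes "(x, y) \<in> A" "(x', y') \<in> A" "0 < s" "s *\<^sub>R x + y = s *\<^sub>R x' + y'"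
  shows "x = x'"
proof -
  have "(x + (-1) *\<^sub>R x', y + (-1) *\<^sub>R y') \<in> A"
    by (intro A_add A_scaleR assms)
  from dissipative[OF this assms(3)] have "s * orbit_norm (x - x') \<le> orbit_norm 0"
    using assms(4) by (simp add: algebra_simps)
  moreover have "s * norm (x - x') \<le> s * orbit_norm (x - x')"
    using assms(3) norm_le_orbit_norm by (intro mult_left_mono) auto
  ultimately have "s * norm (x - x') \<le> 0" using orbit_norm_le[of 0] by simp
  then show ?thesis using assms(3) by (simp add: mult_le_0_iff)
qed

text \<open>
  The resolvent \<open>(s + A)\<inverse>\<close>.
\<close>

definition R :: "real \<Rightarrow> 'a \<Rightarrow>\<^sub>L 'a" where "R s = Blinfun (\<lambda>w. THE x. (x, w - s *\<^sub>R x) \<in> A)"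

lemma R_props:
  assumes s: "0 < s"
  shows "(R s w, w - s *\<^sub>R R s w) \<in> A" and "s * orbit_norm (R s w) \<le> orbit_norm w"
proof -
  let ?f = "\<lambda>w. THE x. (x, w - s *\<^sub>R x) \<in> A"
  have ex: "\<exists>!x. (x, w - s *\<^sub>R x) \<in> A" for w
  proof -
    obtain x y where "(x, y) \<in> A" "s *\<^sub>R x + y = w" using resolvent_surjective[OF s] by blast
    moreover from this have "y = w - s *\<^sub>R x" by (simp add: algebra_simps)
    ultimately show ?thesis using resolvent_injective[OF _ _ s] by (intro ex1I[of _ x]) auto
  qed
  have f: "(?f w, w - s *\<^sub>R ?f w) \<in> A" for w by (rule theI'[OF ex])
  have fI: "?f w = x" if "(x, w - s *\<^sub>R x) \<in> A" for w x
    using ex[of w] that by (rule the1_equality)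
  have pf: "s * orbit_norm (?f w) \<le> orbit_norm w" for w using dissipative[OF f s, of w] by simp
  have "bounded_linear ?f"
  proof (rule bounded_linear_intro[where K="M / s"])
    show "?f (x + y) = ?f x + ?f y" for x y
      by (rule fI) (use A_add[OF f f, of x y] in \<open>simp add: algebra_simps\<close>)
    show "?f (c *\<^sub>R x) = c *\<^sub>R ?f x" for c x
      by (rule fI) (use A_scaleR[OF f, of c x] in \<open>simp add: algebra_simps\<close>)
    show "norm (?f x) \<le> norm x * (M / s)" for x
    proof -
      have "s * norm (?f x) \<le> s * orbit_norm (?f x)" using s norm_le_orbit_norm by (intro mult_left_mono) auto
      also have "\<dots> \<le> M * norm x" using pf[of x] orbit_norm_le[of x] by linarith
      finally show ?thesis using s by (simp add: field_simps)
    qed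
  qed
  then have "R s w = ?f w" for w
    by (simp add: R_def bounded_linear_Blinfun_apply)
  then show "(R s w, w - s *\<^sub>R R s w) \<in> A" "s * orbit_norm (R s w) \<le> orbit_norm w"
    using f pf by simp_all
qed

lemma R_left: "0 < s \<Longrightarrow> (x, y) \<in> A \<Longrightarrow> R s (s *\<^sub>R x + y) = x"
  by (rule resolvent_injective[where x'=x and y'=y and s=s, OF R_props(1)[where s=s]]) auto

lemma shift_inv_A: "0 < s \<Longrightarrow> shift_inv s A = bop (R s)"
proof safe
  fix w x assume s: "0 < s"
  show "(w, x) \<in> bop (R s)" if "(w, x) \<in> shift_inv s A"
    using that R_left[OF s] by (auto simp: shift_inv_def bop_def)
  show "(w, x) \<in> shift_inv s A" if "(w, x) \<in> bop (R s)"
    using that R_props(1)[OF s, of w] by (force simp: shift_inv_def bop_def)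
qed

text \<open>
  For the norm \<open>orbit_norm\<close>, which lies between the given norm and its multiple by \<open>M\<close>, the operator
  \<open>s R(s)\<close> is a contraction.
\<close>

lemma R_power_bounded:
  assumes s: "0 < s"
  shows "power_bounded (s *\<^sub>R R s) M"
proof
  have "orbit_norm ((blinfun_apply (s *\<^sub>R R s) ^^ n) x) \<le> orbit_norm x" for n x
  proof (induction n)
    case (Suc n)
    have "orbit_norm ((blinfun_apply (s *\<^sub>R R s) ^^ Suc n) x) = s * orbit_norm (R s ((blinfun_apply (s *\<^sub>R R s) ^^ n) x))"
      using s by (simp add: blinfun.scaleR_left orbit_norm_scaleR)
    also have "\<dots> \<le> orbit_norm x" using R_props(2)[OF s] Suc order_trans by blast
    finally show ?case .
  qed simp
  then show "norm ((blinfun_apply (s *\<^sub>R R s) ^^ n) x) \<le> M * norm x" for n x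
    using norm_le_orbit_norm orbit_norm_le by (meson order_trans)
qed (use M_ge_1 in simp)

lemma R_norm: "0 < s \<Longrightarrow> norm (s *\<^sub>R R s x) \<le> M * norm x"
  using power_bounded.pow_bound[OF R_power_bounded, of s, where n=1 and x=x] by (simp add: blinfun.scaleR_left)

lemma norm_R: "0 < s \<Longrightarrow> norm (R s) \<le> M / s"
  using R_norm[of s] M_ge_1 by (intro norm_blinfun_bound) (auto simp: field_simps)

lemma R_resolvent:
  assumes s: "0 < s" and t: "0 < t"
  shows "(t - s) *\<^sub>R R s (R t w) = R s w - R t w"
  using R_left[OF s R_props(1)[OF t, of w]]
  by (simp add: blinfun.add_right blinfun.scaleR_right blinfun.diff_right algebra_simps)

lemma R_commute:
  assumes s: "0 < s" and t: "0 < t"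
  shows "R s (R t w) = R t (R s w)"
proof (cases "s = t")
  case False
  have "(t - s) *\<^sub>R R t (R s w) = - ((s - t) *\<^sub>R R t (R s w))"
    by (simp add: algebra_simps)
  also have "\<dots> = (t - s) *\<^sub>R R s (R t w)"
    unfolding R_resolvent[OF s t] R_resolvent[OF t s] by simp
  finally show ?thesis using False by simp
qed simp

lemma R_T: "0 < s \<Longrightarrow> 0 \<le> t \<Longrightarrow> R s (T t w) = T t (R s w)"
  using R_left[OF _ A_T[OF R_props(1)], of s s t w]
  by (simp add: blinfun.diff_right blinfun.scaleR_right)

lemma A_dense: "closure (Domain A) = UNIV"
proof -
  have "x \<in> closure (Domain A)" for x
  proof (rule Lim_in_closed_set[OF closed_closure _ _ truncated_laplace(2)[of 1 0 x]])
    show "\<forall>\<^sub>F b in at_right 0. (1 / b) *\<^sub>R integral {0..b} (\<lambda>t. exp (- 0 * t) *\<^sub>R T t x) \<in> closure (Domain A)"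
      using eventually_at_right_less[of 0]
    proof eventually_elim
      case (elim b)
      then show ?case using A_scaleR[OF truncated_laplace(1)[of b 0 x], of "1 / b"]
        by (intro closure_subset[THEN subsetD]) auto
    qed
  qed auto
  then show ?thesis by auto
qed

lemma R_approx: "((\<lambda>s. s *\<^sub>R R s x) \<longlongrightarrow> x) at_top"
proof (rule tendstoI)
  fix e :: real assume e: "e > 0"
  have "x \<in> closure (Domain A)" by (simp add: A_dense)
  moreover have "e / (2 * (M + 1)) > 0" using e M_ge_1 by simp
  ultimately obtain x' where x': "x' \<in> Domain A" "dist x' x < e / (2 * (M + 1))"
    unfolding closure_approachable by blast
  then obtain y where y: "(x', y) \<in> A" by blast
  have "((\<lambda>s. M / s * norm y) \<longlongrightarrow> 0) at_top"
    by (intro tendsto_mult_left_zero tendsto_divide_0[OF tendsto_const] filterlim_at_top_imp_at_infinity filterlim_ident)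
  then have "\<forall>\<^sub>F s in at_top. M / s * norm y < e / 2"
    by (rule order_tendstoD) (use e in simp)
  then show "\<forall>\<^sub>F s in at_top. dist (s *\<^sub>R R s x) x < e"
    using eventually_gt_at_top[of 0]
  proof eventually_elim
    case (elim s)
    have "s *\<^sub>R R s x' - x' = - R s y"
      using R_left[OF elim(2) y] by (simp add: blinfun.add_right blinfun.scaleR_right algebra_simps)
    then have "norm (s *\<^sub>R R s x' - x') \<le> M / s * norm y"
      using norm_blinfun[of "R s" y] mult_right_mono[OF norm_R[OF elim(2)] norm_ge_zero[of y]] by simp
    moreover have "norm (s *\<^sub>R R s (x - x')) \<le> M * norm (x - x')" by (rule R_norm[OF elim(2)])
    moreover have "s *\<^sub>R R s x - x = s *\<^sub>R R s (x - x') + (s *\<^sub>R R s x' - x') + (x' - x)"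
      by (simp add: blinfun.diff_right algebra_simps)
    then have "norm (s *\<^sub>R R s x - x) \<le> norm (s *\<^sub>R R s (x - x')) + norm (s *\<^sub>R R s x' - x') + norm (x' - x)"
      by (simp only: norm_triangle_le[OF add_right_mono[OF norm_triangle_ineq]])
    moreover have "M * norm (x - x') + norm (x' - x) = (M + 1) * dist x' x"
      by (simp add: dist_norm norm_minus_commute algebra_simps)
    moreover have "(M + 1) * dist x' x < (M + 1) * (e / (2 * (M + 1)))"
      using x'(2) M_ge_1 by (intro mult_strict_left_mono) auto
    moreover have "(M + 1) * (e / (2 * (M + 1))) = e / 2" using M_ge_1 by (simp add: field_simps)
    ultimately show ?case using elim(1) unfolding dist_norm by linarith
  qed
qed

text \<open>
  The operator \<open>A (s + A)\<inverse>\<close>; for \<open>s = 0\<close> the formula gives the identity, which represents the constant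
  term of a complete Bernstein function.
\<close>

definition D :: "real \<Rightarrow> 'a \<Rightarrow>\<^sub>L 'a" where "D s = id_blinfun - s *\<^sub>R R s"

lemma D_apply: "D s x = x - s *\<^sub>R R s x"
  by (simp add: D_def blinfun.diff_left blinfun.scaleR_left)

lemma D_0: "D 0 x = x" by (simp add: D_apply)

lemma A_R: "0 < s \<Longrightarrow> (R s x, D s x) \<in> A"
  by (simp add: D_apply R_props)

lemma D_A: "0 < s \<Longrightarrow> (x, y) \<in> A \<Longrightarrow> D s x = R s y"
  using R_left[of s x y] by (simp add: D_apply blinfun.add_right blinfun.scaleR_right algebra_simps)

lemma norm_D: "0 < s \<Longrightarrow> norm (D s) \<le> 1 + M"
  using R_norm[of s] M_ge_1
  by (intro norm_blinfun_bound) (auto simp: D_apply algebra_simps intro!: norm_triangle_le_diff)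

text \<open>
  That is, \<open>D(s) = (1 - K)/(1 - \<rho> K)\<close> for \<open>K = \<sigma> R(\<sigma>)\<close> and \<open>\<rho> = 1 - s/\<sigma>\<close>.
\<close>

lemma D_step:
  assumes s: "0 \<le> s" and \<sigma>: "0 < \<sigma>"
  shows "D s z - (1 - s / \<sigma>) *\<^sub>R (\<sigma> *\<^sub>R R \<sigma>) (D s z) = z - (\<sigma> *\<^sub>R R \<sigma>) z"
proof (cases "s = 0")
  case False
  then have "s > 0" using s by simp
  have e: "R \<sigma> z = R s z - (\<sigma> - s) *\<^sub>R R \<sigma> (R s z)"
    using R_resolvent[OF \<sigma> \<open>s > 0\<close>, of z] by (simp add: algebra_simps)
  have "(1 - s / \<sigma>) *\<^sub>R (\<sigma> *\<^sub>R R \<sigma>) (D s z) = (\<sigma> - s) *\<^sub>R R \<sigma> (D s z)"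
    using \<sigma> by (simp add: blinfun.scaleR_left left_diff_distrib)
  also have "\<dots> = (\<sigma> - s) *\<^sub>R R \<sigma> z - s *\<^sub>R (\<sigma> - s) *\<^sub>R R \<sigma> (R s z)"
    by (simp add: D_apply blinfun.diff_right blinfun.scaleR_right scaleR_diff_right mult.commute)
  also have "(\<sigma> - s) *\<^sub>R R \<sigma> (R s z) = R s z - R \<sigma> z"
    using e by (simp add: algebra_simps)
  finally show ?thesis by (simp add: D_apply blinfun.scaleR_left algebra_simps)
qed (simp add: D_apply)

text \<open>
  The inequality \<open>f(\<tau>) \<parallel>D(\<tau>) z\<parallel> \<le> 2 M \<parallel>f(A) z\<parallel>\<close> for \<open>f(\<lambda>) = \<Sum> m\<^sub>s \<lambda>/(s + \<lambda>)\<close>. The parameter \<open>\<sigma>\<close> of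
  \<open>K = \<sigma> R(\<sigma>)\<close> only has to exceed \<open>\<tau>\<close> and all \<open>s\<close>; the estimate does not depend on it.
\<close>

lemma finite_sum_estimate:
  assumes J: "finite J" "\<And>s. s \<in> J \<Longrightarrow> 0 \<le> s" "\<And>s. s \<in> J \<Longrightarrow> 0 \<le> m s" and \<tau>: "0 < \<tau>"
  shows "(\<Sum>s\<in>J. m s * (\<tau> / (\<tau> + s))) * norm (D \<tau> z) \<le> 2 * M * norm (\<Sum>s\<in>J. m s *\<^sub>R D s z)"
proof (cases "0 < (\<Sum>s\<in>J. m s)")
  case False
  then have "\<forall>s\<in>J. m s = 0"
    using J sum_nonneg_eq_0_iff[of J m] sum_nonneg[of J m] by fastforce
  then show ?thesis by simp
next
  case True
  define \<sigma> where "\<sigma> = 1 + \<tau> + Max (insert 0 J)"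
  have mx: "s \<le> Max (insert 0 J)" if "s \<in> insert 0 J" for s using J that by (intro Max_ge) auto
  have \<sigma>: "\<sigma> > 0" "\<tau> < \<sigma>" "\<And>s. s \<in> J \<Longrightarrow> s < \<sigma>"
    using mx \<tau> unfolding \<sigma>_def by (fastforce simp: add_pos_nonneg)+
  define \<rho> where "\<rho> = (\<lambda>s. 1 - s / \<sigma>)"
  interpret power_bounded "\<sigma> *\<^sub>R R \<sigma>" M by (rule R_power_bounded[OF \<sigma>(1)])
  have "(\<Sum>s\<in>J. m s * ((1 - \<rho> \<tau>) / (1 - \<rho> \<tau> * \<rho> s))) * norm (D \<tau> z) \<le> 2 * M * norm (\<Sum>s\<in>J. m s *\<^sub>R D s z)"
  proof (rule kaluza_quotient_estimate)
    show "D s z - \<rho> s *\<^sub>R (\<sigma> *\<^sub>R R \<sigma>) (D s z) = z - (\<sigma> *\<^sub>R R \<sigma>) z" if "s \<in> J" for s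
      unfolding \<rho>_def using J that \<sigma> by (intro D_step) auto
    show "D \<tau> z - \<rho> \<tau> *\<^sub>R (\<sigma> *\<^sub>R R \<sigma>) (D \<tau> z) = z - (\<sigma> *\<^sub>R R \<sigma>) z"
      unfolding \<rho>_def using \<tau> \<sigma> by (intro D_step) auto
    show "D s z = z" if "\<rho> s = 1" for s
      using that \<sigma> by (simp add: \<rho>_def D_0)
  qed (use J True \<sigma> \<tau> in \<open>auto simp: \<rho>_def field_simps\<close>)
  moreover have "(\<Sum>s\<in>J. m s * (\<tau> / (\<tau> + s))) \<le> (\<Sum>s\<in>J. m s * ((1 - \<rho> \<tau>) / (1 - \<rho> \<tau> * \<rho> s)))"
  proof (intro sum_mono mult_left_mono)
    fix s assume s: "s \<in> J"
    have e: "1 - \<rho> \<tau> * \<rho> s = (\<tau> + s * (1 - \<tau> / \<sigma>)) / \<sigma>"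
      using \<sigma>(1) by (simp add: \<rho>_def field_simps)
    have pos: "0 < \<tau> + s * (1 - \<tau> / \<sigma>)"
      using J(2)[OF s] \<tau> \<sigma> by (intro add_pos_nonneg mult_nonneg_nonneg) auto
    have "(1 - \<rho> \<tau>) / (1 - \<rho> \<tau> * \<rho> s) = \<tau> / (\<tau> + s * (1 - \<tau> / \<sigma>))"
      unfolding e using \<sigma>(1) by (simp add: \<rho>_def)
    also have "\<dots> \<ge> \<tau> / (\<tau> + s)"
    proof (rule divide_left_mono)
      show "\<tau> + s * (1 - \<tau> / \<sigma>) \<le> \<tau> + s"
        using mult_left_mono[of "1 - \<tau> / \<sigma>" 1 s] J(2)[OF s] \<tau> \<sigma>(1) by simp
      show "0 < (\<tau> + s) * (\<tau> + s * (1 - \<tau> / \<sigma>))"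
        using pos \<tau> J(2)[OF s] by (intro mult_pos_pos) auto
    qed (use \<tau> in simp)
    finally show "\<tau> / (\<tau> + s) \<le> (1 - \<rho> \<tau>) / (1 - \<rho> \<tau> * \<rho> s)" .
  qed (use J in auto)
  then have "(\<Sum>s\<in>J. m s * (\<tau> / (\<tau> + s))) * norm (D \<tau> z) \<le> (\<Sum>s\<in>J. m s * ((1 - \<rho> \<tau>) / (1 - \<rho> \<tau> * \<rho> s))) * norm (D \<tau> z)"
    by (rule mult_right_mono) simp
  ultimately show ?thesis by linarith
qed

text \<open>
  The closed convex cone generated by the pairs \<open>(D(s) z, \<tau>/(\<tau> + s))\<close> with \<open>s \<ge> 0\<close>, written with explicit
  sums in order to apply the estimate for finite sums. The set of all pairs satisfying that estimate is
  closed but not convex, so it would not suffice to verify it on generators. For a complete Bernstein function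
  \<open>f\<close> the pair \<open>(f(A) z, f(\<tau>))\<close> lies in the cone because integrals of its elements do.
\<close>

definition resolvent_cone :: "real \<Rightarrow> 'a \<Rightarrow> ('a \<times> real) set"
  where "resolvent_cone \<tau> z = closure {((\<Sum>s\<in>J. m s *\<^sub>R D s z), (\<Sum>s\<in>J. m s * (\<tau> / (\<tau> + s)))) | J m.
    finite J \<and> J \<subseteq> {0..} \<and> (\<forall>s. 0 \<le> m s)}"

lemma cone_estimate:
  assumes "(v, w) \<in> resolvent_cone \<tau> z" and \<tau>: "0 < \<tau>"
  shows "w * norm (D \<tau> z) \<le> 2 * M * norm v"
proof -
  have "resolvent_cone \<tau> z \<subseteq> {q. snd q * norm (D \<tau> z) \<le> 2 * M * norm (fst q)}"
    unfolding resolvent_cone_def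
  proof (rule closure_minimal)
    show "closed {q. snd q * norm (D \<tau> z) \<le> 2 * M * norm (fst q)}"
      by (intro closed_Collect_le continuous_intros)
    show "{((\<Sum>s\<in>J. m s *\<^sub>R D s z), (\<Sum>s\<in>J. m s * (\<tau> / (\<tau> + s)))) | J m. finite J \<and> J \<subseteq> {0..} \<and> (\<forall>s. 0 \<le> m s)}
      \<subseteq> {q. snd q * norm (D \<tau> z) \<le> 2 * M * norm (fst q)}"
    proof
      fix q assume "q \<in> {((\<Sum>s\<in>J. m s *\<^sub>R D s z), (\<Sum>s\<in>J. m s * (\<tau> / (\<tau> + s)))) | J m. finite J \<and> J \<subseteq> {0..} \<and> (\<forall>s. 0 \<le> m s)}"
      then obtain J m where q: "q = ((\<Sum>s\<in>J. m s *\<^sub>R D s z), (\<Sum>s\<in>J. m s * (\<tau> / (\<tau> + s))))"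
        and J: "finite J" "J \<subseteq> {0..}" "\<forall>s. 0 \<le> m s" by blast
      have "(\<Sum>s\<in>J. m s * (\<tau> / (\<tau> + s))) * norm (D \<tau> z) \<le> 2 * M * norm (\<Sum>s\<in>J. m s *\<^sub>R D s z)"
        by (rule finite_sum_estimate[OF J(1) _ _ \<tau>]) (use J in auto)
      then show "q \<in> {q. snd q * norm (D \<tau> z) \<le> 2 * M * norm (fst q)}"
        by (simp only: q mem_Collect_eq fst_conv snd_conv)
    qed
  qed
  from subsetD[OF this assms(1)] show ?thesis by simp
qed

lemma closed_cone: "closed (resolvent_cone \<tau> z)" by (simp add: resolvent_cone_def)

lemma convex_cone_cone: "convex_cone (resolvent_cone \<tau> z)"
proof -
  define G where "G = {((\<Sum>s\<in>J. m s *\<^sub>R D s z), (\<Sum>s\<in>J. m s * (\<tau> / (\<tau> + s)))) | J m. finite J \<and> J \<subseteq> {0..} \<and> (\<forall>s. 0 \<le> m s)}"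
  have add: "x + y \<in> G" if "x \<in> G" "y \<in> G" for x y
  proof -
    from that[unfolded G_def] obtain J m J' m' where x: "x = ((\<Sum>s\<in>J. m s *\<^sub>R D s z), (\<Sum>s\<in>J. m s * (\<tau> / (\<tau> + s))))"
      and y: "y = ((\<Sum>s\<in>J'. m' s *\<^sub>R D s z), (\<Sum>s\<in>J'. m' s * (\<tau> / (\<tau> + s))))"
      and f: "finite J" "finite J'" "J \<subseteq> {0..}" "J' \<subseteq> {0..}" "\<forall>s. 0 \<le> m s" "\<forall>s. 0 \<le> m' s" by blast
    let ?m = "\<lambda>s. (if s \<in> J then m s else 0) + (if s \<in> J' then m' s else 0)"
    have ext: "(\<Sum>s\<in>J. m s *\<^sub>R g s) = (\<Sum>s\<in>J\<union>J'. (if s \<in> J then m s else 0) *\<^sub>R g s)"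
      "(\<Sum>s\<in>J'. m' s *\<^sub>R g s) = (\<Sum>s\<in>J\<union>J'. (if s \<in> J' then m' s else 0) *\<^sub>R g s)" for g :: "real \<Rightarrow> 'x::real_vector"
      using f by (auto intro!: sum.mono_neutral_cong_left)
    have "x + y = ((\<Sum>s\<in>J\<union>J'. ?m s *\<^sub>R D s z), (\<Sum>s\<in>J\<union>J'. ?m s *\<^sub>R (\<tau> / (\<tau> + s))))"
      unfolding x y real_scaleR_def[symmetric] ext by (simp only: add_Pair sum.distrib scaleR_add_left)
    then have "x + y = ((\<Sum>s\<in>J\<union>J'. ?m s *\<^sub>R D s z), (\<Sum>s\<in>J\<union>J'. ?m s * (\<tau> / (\<tau> + s))))"
      by (simp only: real_scaleR_def)
    then show ?thesis using f unfolding G_def by (intro CollectI exI[of _ "J\<union>J'"] exI[of _ ?m]) auto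
  qed
  have sc: "c *\<^sub>R x \<in> G" if "0 \<le> c" "x \<in> G" for c x
  proof -
    from that(2)[unfolded G_def] obtain J m where "x = ((\<Sum>s\<in>J. m s *\<^sub>R D s z), (\<Sum>s\<in>J. m s * (\<tau> / (\<tau> + s))))"
      and f: "finite J" "J \<subseteq> {0..}" "\<forall>s. 0 \<le> m s" by blast
    then have "c *\<^sub>R x = ((\<Sum>s\<in>J. (c * m s) *\<^sub>R D s z), (\<Sum>s\<in>J. (c * m s) * (\<tau> / (\<tau> + s))))"
      by (simp add: scaleR_sum_right sum_distrib_left mult.assoc)
    then show ?thesis using f that unfolding G_def by (intro CollectI exI[of _ J] exI[of _ "\<lambda>s. c * m s"]) auto
  qed
  have G: "0 \<in> G" unfolding G_def by (intro CollectI exI[of _ "{}"] exI[of _ "\<lambda>_. 0"]) (auto simp: zero_prod_def)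
  show ?thesis
    unfolding convex_cone_iff resolvent_cone_def G_def[symmetric]
  proof (intro conjI ballI allI impI)
    show "0 \<in> closure G" by (rule closure_subset[THEN subsetD, OF G])
    fix x assume x: "x \<in> closure G"
    then obtain f :: "nat \<Rightarrow> _" where f: "\<And>n. f n \<in> G" "f \<longlonglongrightarrow> x" unfolding closure_sequential by blast
    show "c *\<^sub>R x \<in> closure G" if "0 \<le> c" for c
      unfolding closure_sequential using sc[OF that f(1)] tendsto_scaleR[OF tendsto_const f(2)]
      by (intro exI[of _ "\<lambda>n. c *\<^sub>R f n"]) blast
    fix y assume "y \<in> closure G"
    then obtain g :: "nat \<Rightarrow> _" where g: "\<And>n. g n \<in> G" "g \<longlonglongrightarrow> y" unfolding closure_sequential by blast
    show "x + y \<in> closure G"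
      unfolding closure_sequential using add[OF f(1) g(1)] tendsto_add[OF f(2) g(2)]
      by (intro exI[of _ "\<lambda>n. f n + g n"]) blast
  qed
qed

lemma cone_generator: "0 \<le> s \<Longrightarrow> (D s z, \<tau> / (\<tau> + s)) \<in> resolvent_cone \<tau> z"
  unfolding resolvent_cone_def
  by (intro closure_subset[THEN subsetD] CollectI exI[of _ "{s}"] exI[of _ "\<lambda>_. 1"]) simp

text \<open>
  The term \<open>b A z\<close> of \<open>f(A) z\<close>: \<open>N D(N) z = N R(N) A z\<close> tends to \<open>A z\<close>.
\<close>

lemma cone_A:
  assumes A: "(z, y) \<in> A" and \<tau>: "0 < \<tau>"
  shows "(y, \<tau>) \<in> resolvent_cone \<tau> z"
proof (rule Lim_in_closed_set[OF closed_cone])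
  show "\<forall>\<^sub>F N in at_top. (N *\<^sub>R R N y, N * (\<tau> / (\<tau> + N))) \<in> resolvent_cone \<tau> z"
    using eventually_gt_at_top[of 0]
  proof eventually_elim
    case (elim N)
    then have "N *\<^sub>R (D N z, \<tau> / (\<tau> + N)) \<in> resolvent_cone \<tau> z"
      by (intro convex_cone_scaleR[OF convex_cone_cone] cone_generator) auto
    then show ?case using D_A[OF elim A] by simp
  qed
  have "((\<lambda>N. N * (\<tau> / (\<tau> + N))) \<longlongrightarrow> \<tau>) at_top"
  proof (rule Lim_transform_eventually)
    have "((\<lambda>N. \<tau> - \<tau> * \<tau> / (\<tau> + N)) \<longlongrightarrow> \<tau> - 0) at_top"
      by (intro tendsto_diff tendsto_const tendsto_divide_0[OF tendsto_const] filterlim_at_top_imp_at_infinity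
        filterlim_tendsto_add_at_top[OF tendsto_const] filterlim_ident)
    then show "((\<lambda>N. \<tau> - \<tau> * \<tau> / (\<tau> + N)) \<longlongrightarrow> \<tau>) at_top" by simp
    show "\<forall>\<^sub>F N in at_top. \<tau> - \<tau> * \<tau> / (\<tau> + N) = N * (\<tau> / (\<tau> + N))"
      using eventually_gt_at_top[of 0] by eventually_elim (use \<tau> in \<open>simp add: field_simps\<close>)
  qed
  then show "((\<lambda>N. (N *\<^sub>R R N y, N * (\<tau> / (\<tau> + N)))) \<longlongrightarrow> (y, \<tau>)) at_top"
    by (intro tendsto_Pair R_approx)
qed simp

end

section \<open>Strong integrals with values in a Banach space\<close>

abbreviation (input) sb_integrable where "sb_integrable \<equiv> Bochner_Integration.simple_bochner_integrable"
abbreviation (input) sb_integral where "sb_integral \<equiv> Bochner_Integration.simple_bochner_integral"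

lemma ennreal_tendsto_0_le:
  fixes f g :: "nat \<Rightarrow> ennreal"
  assumes "g \<longlonglongrightarrow> 0" and "\<And>i. f i \<le> g i"
  shows "f \<longlonglongrightarrow> 0"
proof (rule tendsto_sandwich[of "\<lambda>_. 0" f sequentially g 0])
  show "\<forall>\<^sub>F i in sequentially. f i \<le> g i" using assms(2) by (rule always_eventually[OF allI])
qed (simp_all add: assms(1))

text \<open>
  In a space that is not second countable, differences of Borel functions need not be Borel; here the
  second function takes finitely many values.
\<close>

lemma simple_measurable_norm_diff:
  fixes f s :: "'b \<Rightarrow> 'a::real_normed_vector"
  assumes f[measurable]: "f \<in> borel_measurable M" and s: "sb_integrable M s"
  shows "(\<lambda>x. ennreal (norm (f x - s x))) \<in> borel_measurable M"
proof -
  have sf: "simple_function M s"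
    using s by (auto elim: simple_bochner_integrable.cases)
  have fin: "finite (s ` space M)" and ms[measurable]: "s \<in> measurable M (count_space UNIV)"
    using sf by (auto simp: simple_function_def intro: measurable_simple_function)
  have "(\<lambda>x. \<Sum>y\<in>s ` space M. ennreal (norm (f x - y)) * indicator (s -` {y} \<inter> space M) x) \<in> borel_measurable M"
  proof (intro borel_measurable_sum borel_measurable_times_ennreal)
    fix y
    have "(\<lambda>z::'a. norm (z - y)) \<in> borel_measurable borel"
      by (intro borel_measurable_continuous_onI continuous_intros)
    then have "(\<lambda>z. ennreal (norm (z - y))) \<in> borel_measurable borel"
      by measurable
    then show "(\<lambda>x. ennreal (norm (f x - y))) \<in> borel_measurable M"
      using measurable_compose[OF f] by blast
    have "s -` {y} \<inter> space M \<in> sets M"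
      by (rule measurable_sets[OF ms]) simp
    then show "(indicator (s -` {y} \<inter> space M) :: 'b \<Rightarrow> ennreal) \<in> borel_measurable M"
      by (rule borel_measurable_indicator)
  qed
  also have "?this \<longleftrightarrow> ?thesis"
  proof (rule measurable_cong)
    fix x assume x: "x \<in> space M"
    have "(\<Sum>y\<in>s ` space M. ennreal (norm (f x - y)) * indicator (s -` {y} \<inter> space M) x)
        = (\<Sum>y\<in>{s x}. ennreal (norm (f x - y)) * indicator (s -` {y} \<inter> space M) x)"
      using fin x by (intro sum.mono_neutral_right) auto
    then show "(\<Sum>y\<in>s ` space M. ennreal (norm (f x - y)) * indicator (s -` {y} \<inter> space M) x) = ennreal (norm (f x - s x))"
      using x by simp
  qed
  finally show ?thesis .
qed

lemma norm_simple_integral_le: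
  assumes s: "sb_integrable M s"
  shows "ennreal (norm (sb_integral M s)) \<le> (\<integral>\<^sup>+ x. ennreal (norm (s x)) \<partial>M)"
proof -
  have n: "sb_integrable M (\<lambda>x. norm (s x))"
    using simple_bochner_integrable_compose2[of "\<lambda>x y. norm x" M s s] s by simp
  have "ennreal (norm (sb_integral M s)) \<le> ennreal (sb_integral M (\<lambda>x. norm (s x)))"
    by (intro ennreal_leI simple_bochner_integral_norm_bound s)
  then show ?thesis by (simp add: simple_bochner_integral_eq_nn_integral[OF n])
qed

lemma simple_integral_diff_bound:
  assumes f: "f \<in> borel_measurable M" and s: "sb_integrable M s" and t: "sb_integrable M t"
  shows "ennreal (norm (sb_integral M s - sb_integral M t)) \<le>
    (\<integral>\<^sup>+ x. ennreal (norm (f x - s x)) \<partial>M) + (\<integral>\<^sup>+ x. ennreal (norm (f x - t x)) \<partial>M)"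
proof -
  have "sb_integrable M (\<lambda>x. s x - t x)"
    by (rule simple_bochner_integrable_compose2) (use s t in auto)
  from norm_simple_integral_le[OF this]
  have "ennreal (norm (sb_integral M s - sb_integral M t)) \<le> (\<integral>\<^sup>+ x. ennreal (norm (s x - t x)) \<partial>M)"
    by (simp add: simple_bochner_integral_diff s t)
  also have "\<dots> \<le> (\<integral>\<^sup>+ x. ennreal (norm (f x - s x)) + ennreal (norm (f x - t x)) \<partial>M)"
  proof (rule nn_integral_mono)
    fix x
    have "norm (s x - t x) \<le> norm (f x - s x) + norm (f x - t x)"
      using norm_triangle_ineq4[of "f x - t x" "f x - s x"] by simp
    then show "ennreal (norm (s x - t x)) \<le> ennreal (norm (f x - s x)) + ennreal (norm (f x - t x))"
      by (metis ennreal_leI ennreal_plus norm_ge_zero)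
  qed
  also have "\<dots> = (\<integral>\<^sup>+ x. ennreal (norm (f x - s x)) \<partial>M) + (\<integral>\<^sup>+ x. ennreal (norm (f x - t x)) \<partial>M)"
    by (rule nn_integral_add) (rule simple_measurable_norm_diff[OF f s] simple_measurable_norm_diff[OF f t])+
  finally show ?thesis .
qed

lemma has_strong_integral_cong:
  assumes "\<And>x. x \<in> space M \<Longrightarrow> f x = g x"
  shows "has_strong_integral M f v \<longleftrightarrow> has_strong_integral M g v"
proof -
  have 1: "f \<in> borel_measurable M \<longleftrightarrow> g \<in> borel_measurable M"
    by (rule measurable_cong) (rule assms)
  have 2: "(\<integral>\<^sup>+ t. ennreal (norm (f t - s i t)) \<partial>M) = (\<integral>\<^sup>+ t. ennreal (norm (g t - s i t)) \<partial>M)"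
    for s and i::nat
    by (rule nn_integral_cong) (simp add: assms)
  show ?thesis unfolding has_strong_integral_def 1 2 ..
qed

lemma has_strong_integral_norm_bound:
  fixes f :: "'a \<Rightarrow> 'b::real_normed_vector"
  assumes v: "has_strong_integral M f v" and B: "(\<integral>\<^sup>+ t. ennreal (norm (f t)) \<partial>M) \<le> ennreal B" "0 \<le> B"
  shows "norm v \<le> B"
proof -
  obtain s where f: "f \<in> borel_measurable M"
    and s: "\<And>i::nat. sb_integrable M (s i)"
    and l: "(\<lambda>i::nat. \<integral>\<^sup>+ t. ennreal (norm (f t - s i t)) \<partial>M) \<longlonglongrightarrow> 0"
    and c: "(\<lambda>i. sb_integral M (s i)) \<longlonglongrightarrow> v"
    using v unfolding has_strong_integral_def by blast
  have z: "sb_integrable M (\<lambda>_. 0)"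
    by (auto intro!: simple_bochner_integrable.intros)
  have "ennreal (norm (sb_integral M (s i))) \<le>
      (\<integral>\<^sup>+ t. ennreal (norm (f t - s i t)) \<partial>M) + ennreal B" for i
  proof -
    have "sb_integral M (\<lambda>_. 0) = (0::'b)"
      by (auto simp: simple_bochner_integral_def intro!: sum.neutral)
    with simple_integral_diff_bound[OF f s z, of i]
    have "ennreal (norm (sb_integral M (s i))) \<le>
        (\<integral>\<^sup>+ t. ennreal (norm (f t - s i t)) \<partial>M) + (\<integral>\<^sup>+ t. ennreal (norm (f t)) \<partial>M)"
      by simp
    also have "\<dots> \<le> (\<integral>\<^sup>+ t. ennreal (norm (f t - s i t)) \<partial>M) + ennreal B"
      by (rule add_left_mono[OF B(1)])
    finally show ?thesis .
  qed
  moreover have l1: "(\<lambda>i. ennreal (norm (sb_integral M (s i)))) \<longlonglongrightarrow> ennreal (norm v)"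
    by (intro tendsto_ennrealI tendsto_norm c)
  moreover have l2: "(\<lambda>i. (\<integral>\<^sup>+ t. ennreal (norm (f t - s i t)) \<partial>M) + ennreal B) \<longlonglongrightarrow> 0 + ennreal B"
    by (intro tendsto_add l tendsto_const)
  ultimately have "ennreal (norm v) \<le> 0 + ennreal B"
    by (intro LIMSEQ_le[OF l1 l2]) auto
  then show ?thesis using B by (simp add: ennreal_le_iff)
qed

text \<open>
  Sums of Borel functions with values in a space that is not second countable need not be Borel.
\<close>

lemma has_strong_integral_add:
  assumes f: "has_strong_integral M f u" and g: "has_strong_integral M g v"
    and m: "(\<lambda>x. f x + g x) \<in> borel_measurable M"
  shows "has_strong_integral M (\<lambda>x. f x + g x) (u + v)"
proof -
  obtain s where fm: "f \<in> borel_measurable M"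
    and s: "\<And>i::nat. sb_integrable M (s i)"
    and sl: "(\<lambda>i::nat. \<integral>\<^sup>+ t. ennreal (norm (f t - s i t)) \<partial>M) \<longlonglongrightarrow> 0"
    and sc: "(\<lambda>i. sb_integral M (s i)) \<longlonglongrightarrow> u"
    using f unfolding has_strong_integral_def by blast
  obtain t where gm: "g \<in> borel_measurable M"
    and t: "\<And>i::nat. sb_integrable M (t i)"
    and tl: "(\<lambda>i::nat. \<integral>\<^sup>+ x. ennreal (norm (g x - t i x)) \<partial>M) \<longlonglongrightarrow> 0"
    and tc: "(\<lambda>i. sb_integral M (t i)) \<longlonglongrightarrow> v"
    using g unfolding has_strong_integral_def by blast
  show ?thesis unfolding has_strong_integral_def
  proof (intro conjI m exI[of _ "\<lambda>i x. s i x + t i x"] allI)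
    show "sb_integrable M (\<lambda>x. s i x + t i x)" for i
      by (rule simple_bochner_integrable_compose2) (use s t in auto)
    show "(\<lambda>i. sb_integral M (\<lambda>x. s i x + t i x)) \<longlonglongrightarrow> u + v"
      using s t by (simp add: simple_bochner_integral_add tendsto_add sc tc)
    have le: "(\<integral>\<^sup>+ x. ennreal (norm (f x + g x - (s i x + t i x))) \<partial>M) \<le>
      (\<integral>\<^sup>+ x. ennreal (norm (f x - s i x)) \<partial>M) + (\<integral>\<^sup>+ x. ennreal (norm (g x - t i x)) \<partial>M)" for i
      apply (subst nn_integral_add[symmetric])
      apply (rule simple_measurable_norm_diff[OF fm s])
      apply (rule simple_measurable_norm_diff[OF gm t])
      apply (rule nn_integral_mono)
      by (metis ennreal_leI ennreal_plus norm_diff_triangle_ineq norm_ge_zero)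
    show "(\<lambda>i. \<integral>\<^sup>+ x. ennreal (norm (f x + g x - (s i x + t i x))) \<partial>M) \<longlonglongrightarrow> 0"
      using tendsto_add[OF sl tl] by (intro ennreal_tendsto_0_le[OF _ le]) simp
  qed
qed

lemma has_strong_integral_bounded_linear:
  assumes f: "has_strong_integral M f u" and h: "bounded_linear h"
  shows "has_strong_integral M (\<lambda>x. h (f x)) (h u)"
proof -
  interpret h: bounded_linear h by (rule h)
  obtain s where fm: "f \<in> borel_measurable M"
    and s: "\<And>i::nat. sb_integrable M (s i)"
    and sl: "(\<lambda>i::nat. \<integral>\<^sup>+ t. ennreal (norm (f t - s i t)) \<partial>M) \<longlonglongrightarrow> 0"
    and sc: "(\<lambda>i. sb_integral M (s i)) \<longlonglongrightarrow> u"
    using f unfolding has_strong_integral_def by blast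
  obtain K where K: "K > 0" "\<And>x. norm (h x) \<le> norm x * K"
    using h.pos_bounded by blast
  show ?thesis unfolding has_strong_integral_def
  proof (intro conjI exI[of _ "\<lambda>i x. h (s i x)"] allI)
    have "h \<in> borel_measurable borel"
      by (intro borel_measurable_continuous_onI h.continuous_on continuous_on_id)
    then show "(\<lambda>x. h (f x)) \<in> borel_measurable M"
      using measurable_compose[OF fm] by blast
    show "sb_integrable M (\<lambda>x. h (s i x))" for i
      using simple_bochner_integrable_compose2[of "\<lambda>x y. h x" M "s i" "s i"] s by (simp add: h.zero)
    show "(\<lambda>i. sb_integral M (\<lambda>x. h (s i x))) \<longlonglongrightarrow> h u"
      using s by (simp add: simple_bochner_integral_linear[OF h.linear_axioms] h.tendsto sc)
    have le: "(\<integral>\<^sup>+ x. ennreal (norm (h (f x) - h (s i x))) \<partial>M) \<le>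
        ennreal K * (\<integral>\<^sup>+ x. ennreal (norm (f x - s i x)) \<partial>M)" for i
      apply (subst nn_integral_cmult[symmetric])
      apply (rule simple_measurable_norm_diff[OF fm s])
      apply (rule nn_integral_mono)
      apply (subst ennreal_mult[symmetric])
      using K by (auto simp: mult.commute simp flip: h.diff intro!: ennreal_leI)
    have "(\<lambda>i. ennreal K * (\<integral>\<^sup>+ x. ennreal (norm (f x - s i x)) \<partial>M)) \<longlonglongrightarrow> ennreal K * 0"
      by (intro tendsto_mult_ennreal tendsto_const sl) auto
    then show "(\<lambda>i. \<integral>\<^sup>+ x. ennreal (norm (h (f x) - h (s i x))) \<partial>M) \<longlonglongrightarrow> 0"
      by (intro ennreal_tendsto_0_le[OF _ le]) simp
  qed
qed

lemma has_strong_integral_diff: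
  assumes f: "has_strong_integral M f u" and g: "has_strong_integral M g v"
    and m: "(\<lambda>x. f x - g x) \<in> borel_measurable M"
  shows "has_strong_integral M (\<lambda>x. f x - g x) (u - v)"
proof -
  have "has_strong_integral M (\<lambda>x. - g x) (- v)"
    by (rule has_strong_integral_bounded_linear[OF g bounded_linear_minus[OF bounded_linear_ident]])
  moreover have "(\<lambda>x. f x + - g x) \<in> borel_measurable M" using m by simp
  ultimately have "has_strong_integral M (\<lambda>x. f x + - g x) (u + - v)"
    by (rule has_strong_integral_add[OF f])
  then show ?thesis by simp
qed

lemma has_strong_integral_unique:
  assumes f: "has_strong_integral M f u" and g: "has_strong_integral M f v"
  shows "u = v"
proof -
  have "has_strong_integral M (\<lambda>x. f x - f x) (u - v)"
    using f g by (rule has_strong_integral_diff) simp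
  from has_strong_integral_norm_bound[OF this, of 0] show ?thesis by simp
qed

text \<open>
  Completeness turns approximability in mean into integrability.
\<close>

lemma has_strong_integral_Cauchy:
  fixes f :: "'b \<Rightarrow> 'a::banach"
  assumes f: "f \<in> borel_measurable M"
    and s: "\<And>i::nat. sb_integrable M (s i)"
    and l: "(\<lambda>i::nat. \<integral>\<^sup>+ t. ennreal (norm (f t - s i t)) \<partial>M) \<longlonglongrightarrow> 0"
  obtains v where "(\<lambda>i. sb_integral M (s i)) \<longlonglongrightarrow> v" "has_strong_integral M f v"
proof -
  have "Cauchy (\<lambda>i. sb_integral M (s i))"
  proof (rule metric_CauchyI)
    fix e :: real assume e: "e > 0"
    have "\<forall>\<^sub>F i in sequentially. (\<integral>\<^sup>+ t. ennreal (norm (f t - s i t)) \<partial>M) < ennreal (e/2)"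
      by (rule order_tendstoD[OF l]) (use e in auto)
    then obtain N where N: "\<And>i. i \<ge> N \<Longrightarrow> (\<integral>\<^sup>+ t. ennreal (norm (f t - s i t)) \<partial>M) < ennreal (e/2)"
      unfolding eventually_sequentially by blast
    show "\<exists>N. \<forall>m\<ge>N. \<forall>n\<ge>N. dist (sb_integral M (s m)) (sb_integral M (s n)) < e"
    proof (intro exI[of _ N] allI impI)
      fix m n assume "N \<le> m" "N \<le> n"
      then have "(\<integral>\<^sup>+ t. ennreal (norm (f t - s m t)) \<partial>M) + (\<integral>\<^sup>+ t. ennreal (norm (f t - s n t)) \<partial>M) < ennreal (e/2) + ennreal (e/2)"
        by (intro add_strict_mono N)
      also have "\<dots> = ennreal e" using e by (simp flip: ennreal_plus)
      finally show "dist (sb_integral M (s m)) (sb_integral M (s n)) < e"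
        unfolding dist_norm
        using le_less_trans[OF simple_integral_diff_bound[OF f s s, of m n]] ennreal_less_iff[OF norm_ge_zero] by blast
    qed
  qed
  then obtain v where v: "(\<lambda>i. sb_integral M (s i)) \<longlonglongrightarrow> v"
    using Cauchy_convergent convergent_def by blast
  then have "has_strong_integral M f v"
    using f s l unfolding has_strong_integral_def by blast
  with v that show ?thesis by blast
qed

lemma has_strong_integral_restrict:
  fixes f :: "'b \<Rightarrow> 'a::banach"
  assumes f: "has_strong_integral M f u" and E[measurable]: "E \<in> sets M"
  shows "\<exists>v. has_strong_integral M (\<lambda>x. if x \<in> E then f x else 0) v"
proof -
  obtain s where fm[measurable]: "f \<in> borel_measurable M"
    and s: "\<And>i::nat. sb_integrable M (s i)"
    and sl: "(\<lambda>i::nat. \<integral>\<^sup>+ t. ennreal (norm (f t - s i t)) \<partial>M) \<longlonglongrightarrow> 0"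
    using f unfolding has_strong_integral_def by blast
  have s': "sb_integrable M (\<lambda>x. if x \<in> E then s i x else 0)" for i
  proof
    have sf: "simple_function M (s i)" using s[of i] by (auto elim: simple_bochner_integrable.cases)
    show "simple_function M (\<lambda>x. if x \<in> E then s i x else 0)"
      by (rule simple_function_If_set) (use sf in auto)
    have "emeasure M {y \<in> space M. (if y \<in> E then s i y else 0) \<noteq> 0} \<le> emeasure M {y \<in> space M. s i y \<noteq> 0}"
    proof (intro emeasure_mono)
      have [measurable]: "s i \<in> measurable M (count_space UNIV)"
        using sf by (rule measurable_simple_function)
      show "{y \<in> space M. s i y \<noteq> 0} \<in> sets M" by measurable
    qed auto
    also have "\<dots> < \<infinity>" using s[of i] by (auto elim!: simple_bochner_integrable.cases simp: less_top)
    finally show "emeasure M {y \<in> space M. (if y \<in> E then s i y else 0) \<noteq> 0} \<noteq> \<infinity>" by simp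
  qed
  have le: "(\<integral>\<^sup>+ x. ennreal (norm ((if x \<in> E then f x else 0) - (if x \<in> E then s i x else 0))) \<partial>M)
    \<le> (\<integral>\<^sup>+ x. ennreal (norm (f x - s i x)) \<partial>M)" for i
    by (rule nn_integral_mono) auto
  have "(\<lambda>i. \<integral>\<^sup>+ x. ennreal (norm ((if x \<in> E then f x else 0) - (if x \<in> E then s i x else 0))) \<partial>M) \<longlonglongrightarrow> 0"
    by (rule ennreal_tendsto_0_le[OF sl le])
  moreover have "(\<lambda>x. if x \<in> E then f x else 0) \<in> borel_measurable M"
    by measurable
  ultimately obtain v where "has_strong_integral M (\<lambda>x. if x \<in> E then f x else 0) v"
    using has_strong_integral_Cauchy[where s="\<lambda>i x. if x \<in> E then s i x else 0", OF _ s'] by blast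
  then show ?thesis ..
qed

lemma has_strong_integral_const_on:
  assumes [measurable]: "E \<in> sets M" and "emeasure M E < \<infinity>"
  shows "has_strong_integral M (\<lambda>x. if x \<in> E then c else 0) (measure M E *\<^sub>R c)"
proof -
  have "has_strong_integral M (indicator E :: _ \<Rightarrow> real) (measure M E)"
    unfolding has_strong_integral_eq_has_bochner_integral
    by (rule has_bochner_integral_real_indicator) (use assms in auto)
  from has_strong_integral_bounded_linear[OF this bounded_linear_scaleR_left[of c]]
  show ?thesis
    by (rule has_strong_integral_cong[THEN iffD1, rotated]) (auto simp: indicator_def)
qed

text \<open>
  The approximating simple functions are constant on the cells of a grid in \<open>[1/(n+1), n+1]\<close> and take
  values of \<open>g\<close> itself there. This is why the integral lies in every closed convex cone that contains
  the values of \<open>g\<close>, a fact for which one would otherwise use the Hahn--Banach theorem.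
\<close>

lemma has_strong_integral_continuous:
  fixes g :: "real \<Rightarrow> 'a::banach"
  assumes sets: "sets M = sets (restrict_space borel {0<..})"
    and fin: "\<And>K. compact K \<Longrightarrow> K \<subseteq> {0<..} \<Longrightarrow> emeasure M K < \<infinity>"
    and cont: "continuous_on {0<..} g"
    and dom: "(\<integral>\<^sup>+ s. ennreal (norm (g s)) \<partial>M) < \<infinity>"
  obtains v where "has_strong_integral M g v"
    "\<And>C. closed C \<Longrightarrow> convex_cone C \<Longrightarrow> g ` {0<..} \<subseteq> C \<Longrightarrow> v \<in> C"
proof -
  have sp: "space M = {0<..}"
    using sets_eq_imp_space_eq[OF sets] by (simp add: space_restrict_space)
  have gm[measurable]: "g \<in> borel_measurable M"
    using borel_measurable_continuous_on_restrict[OF cont] measurable_cong_sets[OF sets refl] by blast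
  define a b where "a = (\<lambda>n. 1 / (real n + 1))" and "b = (\<lambda>n. real n + 1)"
  define K where "K = (\<lambda>n. {a n..b n})"
  have a0: "a n > 0" for n by (simp add: a_def)
  have Kc: "compact (K n)" "K n \<subseteq> {0<..}" for n
    using a0[of n] by (auto simp: K_def)
  have Km[measurable]: "K n \<in> sets M" for n
    unfolding sets using Kc(2)[of n] by (auto simp: sets_restrict_space K_def image_iff intro!: bexI[of _ "{a n..b n}"])
  \<comment> \<open>with this error on \<open>K n\<close> the integral of the error there is at most \<open>1/(n+1)\<close>\<close>
  define e where "e = (\<lambda>n. 1 / ((real n + 1) * (1 + measure M (K n))))"
  have e0: "e n > 0" for n by (simp add: e_def add_pos_nonneg)
  have "\<exists>d>0. \<forall>x\<in>K n. \<forall>y\<in>K n. dist y x < d \<longrightarrow> dist (g y) (g x) < e n" for n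
    using compact_uniformly_continuous[OF continuous_on_subset[OF cont Kc(2)] Kc(1), of n] e0[of n]
    unfolding uniformly_continuous_on_def by blast
  then obtain d where d0: "\<And>n. d n > 0" and
    d: "\<And>n x y. x\<in>K n \<Longrightarrow> y\<in>K n \<Longrightarrow> dist y x < d n \<Longrightarrow> dist (g y) (g x) < e n"
    by metis
  define p where "p = (\<lambda>n x. max (a n) (d n / 2 * real_of_int \<lfloor>x / (d n / 2)\<rfloor>))"
  have pp: "p n x \<in> K n \<and> dist (p n x) x < d n" if "x \<in> K n" for n x
  proof -
    define \<delta> where "\<delta> = d n / 2"
    have \<delta>: "\<delta> > 0" using d0[of n] by (simp add: \<delta>_def)
    have f: "\<delta> * real_of_int \<lfloor>x / \<delta>\<rfloor> \<le> x" "x < \<delta> * real_of_int \<lfloor>x / \<delta>\<rfloor> + \<delta>"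
      using \<delta> floor_correct[of "x/\<delta>"] mult_left_mono[OF of_int_floor_le[of "x/\<delta>"], of \<delta>]
      by (simp_all add: pos_divide_less_eq algebra_simps)
    have "p n x = max (a n) (\<delta> * real_of_int \<lfloor>x / \<delta>\<rfloor>)" by (simp add: p_def \<delta>_def)
    then show ?thesis using f that \<delta>
      unfolding K_def dist_real_def \<delta>_def by (auto simp: max_def)
  qed
  define s where "s = (\<lambda>n x. if x \<in> K n then g (p n x) else 0)"
  have sf: "simple_function M (s n)" for n
  proof -
    \<comment> \<open>the cell number, with \<open>-1\<close> as a mark for the complement of \<open>K n\<close>, where cell numbers are nonnegative\<close>
    let ?h = "\<lambda>x. if x \<in> K n then \<lfloor>x / (d n / 2)\<rfloor> else -1"
    let ?F = "\<lambda>k. if k = -1 then 0 else g (max (a n) (d n / 2 * real_of_int k))"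
    have "?h ` space M \<subseteq> insert (-1) {\<lfloor>a n / (d n / 2)\<rfloor>..\<lfloor>b n / (d n / 2)\<rfloor>}"
      using d0[of n] by (auto simp: K_def simp del: divide_divide_eq_right intro!: floor_mono divide_right_mono)
    then have "finite (?h ` space M)"
      by (rule finite_subset) auto
    moreover have id: "(\<lambda>x. x) \<in> borel_measurable M"
      unfolding measurable_cong_sets[OF sets refl] by (rule measurable_restrict_space1) simp
    have "(\<lambda>x::real. \<lfloor>x / (d n / 2)\<rfloor>) \<in> measurable borel (count_space UNIV)"
      by measurable
    from measurable_compose[OF id this]
    have "?h \<in> measurable M (count_space UNIV)"
      by (rule measurable_If_set) (use Km sets.sets_into_space in \<open>auto simp: Int_absorb2\<close>)
    then have "?h -` {k} \<inter> space M \<in> sets M" for k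
      by (rule measurable_sets) simp
    ultimately have "simple_function M ?h"
      unfolding simple_function_def by blast
    then have "simple_function M (\<lambda>x. ?F (?h x))"
      by (rule simple_function_compose1)
    moreover have "(\<lambda>x. ?F (?h x)) = s n"
    proof
      fix x
      show "?F (?h x) = s n x"
      proof (cases "x \<in> K n")
        case True
        then have "0 \<le> x / (d n / 2)" using d0[of n] a0[of n] by (auto simp: K_def)
        then have "\<lfloor>x / (d n / 2)\<rfloor> \<noteq> -1" by linarith
        with True show ?thesis by (simp only: s_def p_def if_True if_False)
      qed (simp add: s_def)
    qed
    ultimately show ?thesis by (simp only:)
  qed
  have s: "sb_integrable M (s n)" for n
  proof
    have "emeasure M {y \<in> space M. s n y \<noteq> 0} \<le> emeasure M (K n)"
      by (intro emeasure_mono Km) (auto simp: s_def)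
    also have "\<dots> < \<infinity>" by (intro fin Kc)
    finally show "emeasure M {y \<in> space M. s n y \<noteq> 0} \<noteq> \<infinity>" by simp
  qed (rule sf)
  have l: "(\<lambda>n. \<integral>\<^sup>+ t. ennreal (norm (g t - s n t)) \<partial>M) \<longlonglongrightarrow> 0"
  proof -
    let ?T = "\<lambda>n t. if t \<in> K n then 0 else ennreal (norm (g t))"
    have "(\<lambda>n. \<integral>\<^sup>+ t. ?T n t \<partial>M) \<longlonglongrightarrow> (\<integral>\<^sup>+ t. 0 \<partial>M)"
    proof (rule nn_integral_dominated_convergence)
      show "AE t in M. (\<lambda>n. ?T n t) \<longlonglongrightarrow> 0"
      proof (rule AE_I2)
        fix t assume "t \<in> space M"
        then have t: "t > 0" by (simp add: sp)
        obtain N where N: "real N > max t (1/t)" using reals_Archimedean2 by blast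
        have "t \<in> K n" if "n \<ge> N" for n
        proof -
          have n: "real n > t" "real n > 1/t" using N that by (auto simp: order_less_le_trans)
          then have "1 / (real n + 1) \<le> t"
            using t by (simp add: field_simps)
          then show ?thesis using n by (simp add: K_def a_def b_def)
        qed
        then have "\<forall>\<^sub>F n in sequentially. ?T n t = 0"
          unfolding eventually_sequentially by auto
        then show "(\<lambda>n. ?T n t) \<longlonglongrightarrow> 0" by (rule tendsto_eventually)
      qed
    qed (use dom in auto)
    then have T: "(\<lambda>n. \<integral>\<^sup>+ t. ?T n t \<partial>M) \<longlonglongrightarrow> 0" by simp
    have le: "(\<integral>\<^sup>+ t. ennreal (norm (g t - s n t)) \<partial>M) \<le> ennreal (1 / (real n + 1)) + (\<integral>\<^sup>+ t. ?T n t \<partial>M)" for n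
    proof -
      have "(\<integral>\<^sup>+ t. ennreal (norm (g t - s n t)) \<partial>M) \<le> (\<integral>\<^sup>+ t. ennreal (e n) * indicator (K n) t + ?T n t \<partial>M)"
      proof (rule nn_integral_mono)
        fix t
        show "ennreal (norm (g t - s n t)) \<le> ennreal (e n) * indicator (K n) t + ?T n t"
          using d[of t n "p n t"] pp[of t n]
          by (auto simp: s_def dist_norm norm_minus_commute intro!: ennreal_leI)
      qed
      also have "\<dots> = ennreal (e n) * emeasure M (K n) + (\<integral>\<^sup>+ t. ?T n t \<partial>M)"
        by (subst nn_integral_add) (auto simp: nn_integral_cmult_indicator)
      also have "emeasure M (K n) = ennreal (measure M (K n))"
        using fin[OF Kc, of n] by (simp add: emeasure_eq_ennreal_measure)
      also have "ennreal (e n) * ennreal (measure M (K n)) = ennreal (e n * measure M (K n))"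
        using e0[of n] by (simp add: ennreal_mult)
      also have "e n * measure M (K n) \<le> 1 / (real n + 1)"
      proof -
        have "measure M (K n) / (1 + measure M (K n)) \<le> 1"
          by (subst divide_le_eq_1_pos) (auto simp: add_pos_nonneg)
        then have "1 / (real n + 1) * (measure M (K n) / (1 + measure M (K n))) \<le> 1 / (real n + 1) * 1"
          by (intro mult_left_mono) auto
        then show ?thesis by (simp add: e_def)
      qed
      finally show ?thesis by (simp add: ennreal_leI)
    qed
    have "(\<lambda>n. 1 / (real n + 1)) \<longlonglongrightarrow> 0"
      using LIMSEQ_inverse_real_of_nat by (simp add: inverse_eq_divide add.commute)
    then have "(\<lambda>n. ennreal (1 / (real n + 1))) \<longlonglongrightarrow> ennreal 0"
      by (rule tendsto_ennrealI)
    from tendsto_add[OF this T] show ?thesis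
      by (intro ennreal_tendsto_0_le[OF _ le]) simp
  qed
  obtain v where v: "(\<lambda>i. sb_integral M (s i)) \<longlonglongrightarrow> v" "has_strong_integral M g v"
    by (rule has_strong_integral_Cauchy[OF gm s l])
  show ?thesis
  proof (rule that[OF v(2)])
    fix C assume C: "closed C" "convex_cone C" "g ` {0<..} \<subseteq> C"
    have inC: "s n x \<in> C" for n x
      using C(3) pp[of x n] Kc(2)[of n] convex_cone_contains_0[OF C(2)] by (auto simp: s_def)
    have sumC: "(\<Sum>y\<in>Y. c y *\<^sub>R y) \<in> C" if "finite Y" "Y \<subseteq> C" "\<And>y. c y \<ge> 0" for Y and c :: "'a \<Rightarrow> real"
      using that by (induction Y rule: finite_induct)
        (auto intro: convex_cone_add convex_cone_scaleR convex_cone_contains_0 C)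
    have "sb_integral M (s n) \<in> C" for n
      unfolding simple_bochner_integral_def
      using sf[of n] inC by (intro sumC) (auto simp: simple_function_def)
    then show "v \<in> C" by (rule closed_sequentially[OF C(1) _ v(1)])
  qed
qed

section \<open>Bounded operators as graphs, and complete Bernstein functions\<close>

lemma blinfun_compose_assoc: "(P o\<^sub>L R) o\<^sub>L S = P o\<^sub>L (R o\<^sub>L S)"
  by (rule blinfun_eqI) simp

lemmas comp_scaleR = bounded_bilinear.scaleR_left[OF bounded_bilinear_blinfun_compose] bounded_bilinear.scaleR_right[OF bounded_bilinear_blinfun_compose]
lemmas comp_diff = bounded_bilinear.diff_left[OF bounded_bilinear_blinfun_compose] bounded_bilinear.diff_right[OF bounded_bilinear_blinfun_compose]
lemmas comp_add = bounded_bilinear.add_left[OF bounded_bilinear_blinfun_compose] bounded_bilinear.add_right[OF bounded_bilinear_blinfun_compose]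
lemmas comp_minus = bounded_bilinear.minus_left[OF bounded_bilinear_blinfun_compose] bounded_bilinear.minus_right[OF bounded_bilinear_blinfun_compose]
lemmas comp_linear_right = bounded_bilinear.bounded_linear_right[OF bounded_bilinear_blinfun_compose]
lemmas comp_tendsto = bounded_bilinear.tendsto[OF bounded_bilinear_blinfun_compose]
lemmas comp_continuous = bounded_bilinear.continuous_on[OF bounded_bilinear_blinfun_compose]
lemmas comp_linear_left = bounded_bilinear.bounded_linear_left[OF bounded_bilinear_blinfun_compose]

lemma has_strong_integral_commute:
  fixes g :: "real \<Rightarrow> 'a::real_normed_vector \<Rightarrow>\<^sub>L 'a"
  assumes v: "has_strong_integral M g v"
    and c: "\<And>s. s \<in> space M \<Longrightarrow> P o\<^sub>L g s = g s o\<^sub>L P"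
  shows "P o\<^sub>L v = v o\<^sub>L P"
proof (rule has_strong_integral_unique)
  show "has_strong_integral M (\<lambda>s. P o\<^sub>L g s) (P o\<^sub>L v)"
    by (rule has_strong_integral_bounded_linear[OF v comp_linear_right])
  have "has_strong_integral M (\<lambda>s. g s o\<^sub>L P) (v o\<^sub>L P)"
    by (rule has_strong_integral_bounded_linear[OF v comp_linear_left])
  then show "has_strong_integral M (\<lambda>s. P o\<^sub>L g s) (v o\<^sub>L P)"
    by (rule has_strong_integral_cong[THEN iffD1, rotated]) (simp add: c)
qed

lemma bop_mem: "(x, y) \<in> bop P \<longleftrightarrow> y = P x"
  by (auto simp: bop_def)

lemma bop_comp: "bop P \<odot> bop Q = bop (P o\<^sub>L Q)"
  by (auto simp: bop_mem)

lemma bop_id: "bop id_blinfun = Id"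
  by (auto simp: bop_mem)

lemma closed_bop: "closed (bop P)"
proof -
  have "bop P = {q. snd q = P (fst q)}" by (auto simp: bop_mem)
  also have "closed \<dots>" by (intro closed_Collect_eq continuous_intros)
  finally show ?thesis .
qed

lemma closed_converse_bop: "closed ((bop P)\<inverse>)"
proof -
  have "(bop P)\<inverse> = {q. fst q = P (snd q)}" by (auto simp: bop_mem)
  also have "closed \<dots>" by (intro closed_Collect_eq continuous_intros)
  finally show ?thesis .
qed

lemma closure_graph:
  fixes P :: "'a::real_normed_vector \<Rightarrow>\<^sub>L 'a"
  assumes X: "closure X = UNIV"
  shows "closure {(x, P x) | x. x \<in> X} = bop P"
proof
  show "closure {(x, P x) | x. x \<in> X} \<subseteq> bop P"
    by (intro closure_minimal closed_bop) (auto simp: bop_mem)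
  show "bop P \<subseteq> closure {(x, P x) | x. x \<in> X}"
  proof
    fix q assume "q \<in> bop P"
    then obtain x where q: "q = (x, P x)" by (auto simp: bop_def)
    have "x \<in> closure X" using X by simp
    then obtain f :: "nat \<Rightarrow> _" where f: "\<And>n. f n \<in> X" "f \<longlonglongrightarrow> x" unfolding closure_sequential by blast
    have "(\<lambda>n. (f n, P (f n))) \<longlonglongrightarrow> q"
      unfolding q by (intro tendsto_Pair f blinfun.tendsto tendsto_const)
    moreover have "(f n, P (f n)) \<in> {(x, P x) | x. x \<in> X}" for n using f by blast
    ultimately show "q \<in> closure {(x, P x) | x. x \<in> X}"
      unfolding closure_sequential by (intro exI[of _ "\<lambda>n. (f n, P (f n))"]) auto
  qed
qed

primrec blinfun_power :: "('a::real_normed_vector \<Rightarrow>\<^sub>L 'a) \<Rightarrow> nat \<Rightarrow> 'a \<Rightarrow>\<^sub>L 'a" where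
  "blinfun_power B 0 = id_blinfun"
| "blinfun_power B (Suc n) = B o\<^sub>L blinfun_power B n"

lemma blinfun_compose_id: "P o\<^sub>L id_blinfun = P" "id_blinfun o\<^sub>L P = P"
  by (auto intro: blinfun_eqI)

lemma bop_relpow: "bop B ^^ n = bop (blinfun_power B n)"
proof (induction n)
  case (Suc n)
  have "bop B ^^ Suc n = bop B \<odot> bop (blinfun_power B n)" by (simp add: Suc)
  then show ?case by (simp add: bop_comp)
qed (simp add: bop_id)

lemma blinfun_power_commute:
  assumes "Q o\<^sub>L B = B o\<^sub>L Q"
  shows "Q o\<^sub>L blinfun_power B n = blinfun_power B n o\<^sub>L Q"
proof (induction n)
  case (Suc n)
  have "Q o\<^sub>L (B o\<^sub>L blinfun_power B n) = (B o\<^sub>L Q) o\<^sub>L blinfun_power B n"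
    by (simp add: assms[symmetric] blinfun_compose_assoc)
  then show ?case by (simp add: blinfun_compose_assoc Suc)
qed (simp add: blinfun_compose_id)

lemma has_strong_integral_apply:
  assumes "has_strong_integral M g v"
  shows "has_strong_integral M (\<lambda>s. blinfun_apply (g s) x) (blinfun_apply v x)"
  by (rule has_strong_integral_bounded_linear[OF assms blinfun.bounded_linear_left])

lemma has_strong_integral_apply_iff:
  fixes v :: "'a::real_normed_vector \<Rightarrow>\<^sub>L 'b::real_normed_vector"
  assumes v: "has_strong_integral M g v" and h: "\<And>s. s \<in> space M \<Longrightarrow> h s = blinfun_apply (g s) x"
  shows "has_strong_integral M h z \<longleftrightarrow> z = blinfun_apply v x"
proof -
  have "has_strong_integral M h z \<longleftrightarrow> has_strong_integral M (\<lambda>s. blinfun_apply (g s) x) z"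
    by (rule has_strong_integral_cong) (rule h)
  then show ?thesis
    using has_strong_integral_apply[OF v, of x] has_strong_integral_unique[of M "\<lambda>s. blinfun_apply (g s) x"] by metis
qed

lemma shift_inv_bop:
  fixes Z B :: "'a::real_normed_vector \<Rightarrow>\<^sub>L 'a"
  assumes left: "\<And>x. Z (s *\<^sub>R x + blinfun_apply B x) = x" and right: "\<And>w. s *\<^sub>R blinfun_apply Z w + B (Z w) = w"
  shows "shift_inv s (bop B) = bop Z"
proof (intro equalityI subsetI)
  fix q assume "q \<in> shift_inv s (bop B)"
  then obtain x where "q = (s *\<^sub>R x + B x, x)" unfolding shift_inv_def by (auto simp: bop_mem)
  then show "q \<in> bop Z" by (simp only: bop_mem left)
next
  fix q assume "q \<in> bop Z"
  then obtain w where "q = (w, Z w)" unfolding bop_def by blast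
  then have "q = (s *\<^sub>R Z w + B (Z w), Z w)" by (simp only: right)
  then show "q \<in> shift_inv s (bop B)" unfolding shift_inv_def by (auto simp only: bop_mem)
qed

lemma continuous_borel:
  fixes h :: "real \<Rightarrow> real"
  assumes "sets M = sets (restrict_space borel {0<..})" "continuous_on {0<..} h"
  shows "h \<in> borel_measurable M"
  using borel_measurable_continuous_on_restrict[OF assms(2)] measurable_cong_sets[OF assms(1) refl] by blast

text \<open>
  Integrating the pair as one function with values in the product space keeps the approximations of
  both components synchronised.
\<close>

lemma strong_integral_pair_in_cone:
  fixes g :: "real \<Rightarrow> 'a::banach" and \<phi> :: "real \<Rightarrow> real"
  assumes sets: "sets M = sets (restrict_space borel {0<..})"
    and fin: "\<And>K. compact K \<Longrightarrow> K \<subseteq> {0<..} \<Longrightarrow> emeasure M K < \<infinity>"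
    and g: "continuous_on {0<..} g" "(\<integral>\<^sup>+ s. ennreal (norm (g s)) \<partial>M) < \<infinity>" "has_strong_integral M g v"
    and \<phi>: "continuous_on {0<..} \<phi>" "(\<integral>\<^sup>+ s. ennreal (norm (\<phi> s)) \<partial>M) < \<infinity>"
    and C: "closed C" "convex_cone C" "\<And>s. 0 < s \<Longrightarrow> (g s, \<phi> s) \<in> C"
  shows "(v, integral\<^sup>L M \<phi>) \<in> C"
proof -
  note meas = continuous_borel[OF sets]
  have "(\<integral>\<^sup>+ s. ennreal (norm (g s, \<phi> s)) \<partial>M) \<le> (\<integral>\<^sup>+ s. ennreal (norm (g s)) + ennreal (norm (\<phi> s)) \<partial>M)"
    by (intro nn_integral_mono) (metis ennreal_leI ennreal_plus norm_Pair_le norm_ge_zero)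
  also have "\<dots> = (\<integral>\<^sup>+ s. ennreal (norm (g s)) \<partial>M) + (\<integral>\<^sup>+ s. ennreal (norm (\<phi> s)) \<partial>M)"
    by (intro nn_integral_add measurable_compose[OF meas measurable_ennreal] continuous_intros g \<phi>)
  also have "\<dots> < \<infinity>" using g \<phi> by simp
  finally have f: "(\<integral>\<^sup>+ s. ennreal (norm (g s, \<phi> s)) \<partial>M) < \<infinity>" .
  have c: "continuous_on {0<..} (\<lambda>s. (g s, \<phi> s))" by (intro continuous_intros g \<phi>)
  show ?thesis
  proof (rule has_strong_integral_continuous[OF sets fin c f])
    fix q assume q: "has_strong_integral M (\<lambda>s. (g s, \<phi> s)) q"
      and qC: "\<And>C. closed C \<Longrightarrow> convex_cone C \<Longrightarrow> (\<lambda>s. (g s, \<phi> s)) ` {0<..} \<subseteq> C \<Longrightarrow> q \<in> C"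
    have "has_strong_integral M g (fst q)"
      using has_strong_integral_bounded_linear[OF q bounded_linear_fst] by simp
    then have 1: "fst q = v" using g(3) by (rule has_strong_integral_unique)
    have "has_strong_integral M \<phi> (snd q)"
      using has_strong_integral_bounded_linear[OF q bounded_linear_snd] by simp
    then have 2: "snd q = integral\<^sup>L M \<phi>"
      unfolding has_strong_integral_eq_has_bochner_integral by (rule has_bochner_integral_integral_eq[symmetric])
    have "q \<in> C" by (rule qC[OF C(1,2)]) (use C(3) in auto)
    then show "(v, integral\<^sup>L M \<phi>) \<in> C" using 1 2 by (metis prod.collapse)
  qed
qed

lemma cbf_tripleD:
  assumes "cbf_triple f (a, b, \<mu>)"
  shows "0 \<le> a" and "0 \<le> b" and "sets \<mu> = sets (restrict_space borel {0<..})"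
    and "compact K \<Longrightarrow> K \<subseteq> {0<..} \<Longrightarrow> emeasure \<mu> K < \<infinity>"
    and "(\<integral>\<^sup>+ s. ennreal (1 / (s + 1)) \<partial>\<mu>) < \<infinity>"
    and "0 < x \<Longrightarrow> f x = a + b * x + (\<integral> s. x / (s + x) \<partial>\<mu>)"
    and "space \<mu> = {0<..}"
proof -
  note ct = assms[unfolded cbf_triple_def prod.case]
  show "0 \<le> a" "0 \<le> b" "(\<integral>\<^sup>+ s. ennreal (1 / (s + 1)) \<partial>\<mu>) < \<infinity>"
    and sets: "sets \<mu> = sets (restrict_space borel {0<..})"
    using ct by blast+
  show "compact K \<Longrightarrow> K \<subseteq> {0<..} \<Longrightarrow> emeasure \<mu> K < \<infinity>"
    "0 < x \<Longrightarrow> f x = a + b * x + (\<integral> s. x / (s + x) \<partial>\<mu>)"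
    using ct by blast+
  show "space \<mu> = {0<..}"
    using sets_eq_imp_space_eq[OF sets] by (simp add: space_restrict_space)
qed

lemma cbf_dominated:
  fixes g :: "real \<Rightarrow> 'b::real_normed_vector"
  assumes ct: "cbf_triple f (a, b, \<mu>)" and b: "\<And>s. 0 < s \<Longrightarrow> norm (g s) \<le> C / (s + 1)" and C: "0 \<le> C"
  shows "(\<integral>\<^sup>+ s. ennreal (norm (g s)) \<partial>\<mu>) < \<infinity>"
proof -
  note ct = cbf_tripleD[OF ct]
  have m: "(\<lambda>s. 1 / (s + 1)) \<in> borel_measurable \<mu>"
    by (rule continuous_borel[OF ct(3)]) (auto intro!: continuous_intros)
  have "(\<integral>\<^sup>+ s. ennreal (norm (g s)) \<partial>\<mu>) \<le> (\<integral>\<^sup>+ s. ennreal C * ennreal (1 / (s + 1)) \<partial>\<mu>)"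
  proof (rule nn_integral_mono)
    fix s assume "s \<in> space \<mu>"
    then have s: "0 < s" using ct(7) by simp
    have "ennreal (norm (g s)) \<le> ennreal (C * (1 / (s + 1)))" using b[OF s] by (intro ennreal_leI) simp
    also have "\<dots> = ennreal C * ennreal (1 / (s + 1))" using C by (rule ennreal_mult')
    finally show "ennreal (norm (g s)) \<le> ennreal C * ennreal (1 / (s + 1))" .
  qed
  also have "\<dots> = ennreal C * (\<integral>\<^sup>+ s. ennreal (1 / (s + 1)) \<partial>\<mu>)"
    by (rule nn_integral_cmult) (rule measurable_compose[OF m measurable_ennreal])
  also have "\<dots> < \<infinity>" using ct(5) by (simp add: ennreal_mult_less_top)
  finally show ?thesis .
qed

lemma cbf_finite_dominated:
  fixes g :: "real \<Rightarrow> 'b::real_normed_vector"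
  assumes ct: "cbf_triple f (a, b, \<mu>)" and fin: "emeasure \<mu> (space \<mu>) < \<infinity>"
    and C: "\<And>s. 0 < s \<Longrightarrow> norm (g s) \<le> C"
  shows "(\<integral>\<^sup>+ s. ennreal (norm (g s)) \<partial>\<mu>) < \<infinity>"
proof -
  have "(\<integral>\<^sup>+ s. ennreal (norm (g s)) \<partial>\<mu>) \<le> (\<integral>\<^sup>+ s. ennreal C \<partial>\<mu>)"
    using C cbf_tripleD(7)[OF ct] by (intro nn_integral_mono ennreal_leI) auto
  also have "\<dots> < \<infinity>" using fin by (simp add: ennreal_mult_less_top)
  finally show ?thesis .
qed

lemma stieltjes_kernel_bound:
  assumes "0 < \<tau>" "0 < s"
  shows "1 / (s + \<tau>) \<le> max 1 (1 / \<tau>) / (s + (1::real))"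
proof -
  have "s + 1 \<le> max 1 (1 / \<tau>) * (s + \<tau>)"
  proof -
    have "1 * s \<le> max 1 (1 / \<tau>) * s" using assms by (intro mult_right_mono) auto
    moreover have "(1 / \<tau>) * \<tau> \<le> max 1 (1 / \<tau>) * \<tau>" using assms by (intro mult_right_mono) auto
    moreover have "(1 / \<tau>) * \<tau> = 1" using assms by simp
    ultimately show ?thesis unfolding distrib_left by linarith
  qed
  then show ?thesis using assms by (simp add: field_simps)
qed

lemma cbf_nonneg:
  assumes "cbf_triple f (a, b, \<mu>)" "0 < x"
  shows "0 \<le> f x" "b * x \<le> f x" "(\<integral> s. x / (s + x) \<partial>\<mu>) \<le> f x"
proof -
  note ct = cbf_tripleD[OF assms(1)]
  have "0 \<le> (\<integral> s. x / (s + x) \<partial>\<mu>)"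
    using assms ct(7) by (intro Bochner_Integration.integral_nonneg_AE AE_I2) auto
  then show "0 \<le> f x" "b * x \<le> f x" "(\<integral> s. x / (s + x) \<partial>\<mu>) \<le> f x"
    using ct(1,2) ct(6)[OF assms(2)] assms(2) by auto
qed

text \<open>
  As \<open>x \<rightarrow> \<infinity>\<close>, the terms \<open>b x\<close> and \<open>\<integral> x/(s + x) d\<mu>(s)\<close> stay below the bound of \<open>f\<close>; the integrand is at
  least \<open>1/2\<close> for \<open>s \<le> x\<close>.
\<close>

lemma cbf_bounded:
  assumes ct: "cbf_triple f (a, b, \<mu>)" and bd: "bounded (f ` {0<..})"
  shows "b = 0" and "emeasure \<mu> (space \<mu>) < \<infinity>"
proof -
  note ct' = cbf_tripleD[OF ct]
  obtain B where B: "\<And>x. 0 < x \<Longrightarrow> \<bar>f x\<bar> \<le> B"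
    using bd unfolding bounded_iff by auto
  have B0: "0 \<le> B" using B[of 1] by linarith
  show "b = 0"
  proof (rule ccontr)
    assume "b \<noteq> 0"
    then have b: "0 < b" using ct'(2) by simp
    have "0 < (B + 1) / b" using b B0 by simp
    from cbf_nonneg(2)[OF ct this] B[OF this] show False using b by simp
  qed
  let ?E = "\<lambda>n. {0<..real n}"
  have E: "?E n \<in> sets \<mu>" for n
    unfolding ct'(3) by (auto simp: sets_restrict_space image_iff intro!: bexI[of _ "{0<..real n}"])
  have le: "emeasure \<mu> (?E n) \<le> ennreal (2 * B)" for n
  proof (cases "n = 0")
    case False
    let ?x = "real n"
    have x: "0 < ?x" using False by simp
    have m: "(\<lambda>s. ?x / (s + ?x)) \<in> borel_measurable \<mu>"
      by (rule continuous_borel[OF ct'(3)]) (auto intro!: continuous_intros)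
    have "(\<integral>\<^sup>+ s. ennreal (norm (?x / (s + ?x))) \<partial>\<mu>) < \<infinity>"
    proof (rule cbf_dominated[OF ct, where C="?x * max 1 (1 / ?x)"])
      fix s :: real assume s: "0 < s"
      show "norm (?x / (s + ?x)) \<le> ?x * max 1 (1 / ?x) / (s + 1)"
        using mult_left_mono[OF stieltjes_kernel_bound[OF x s], of ?x] x s by simp
    qed (use x in simp)
    with m have int: "integrable \<mu> (\<lambda>s. ?x / (s + ?x))" by (simp add: integrable_iff_bounded)
    have "emeasure \<mu> (?E n) = (\<integral>\<^sup>+ s. indicator (?E n) s \<partial>\<mu>)" using E by simp
    also have "\<dots> \<le> (\<integral>\<^sup>+ s. ennreal (2 * (?x / (s + ?x))) \<partial>\<mu>)"
    proof (rule nn_integral_mono)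
      fix s
      show "indicator (?E n) s \<le> ennreal (2 * (?x / (s + ?x)))"
        using x by (cases "s \<in> ?E n") (auto simp: field_simps intro!: order_trans[OF _ ennreal_leI[of 1]])
    qed
    also have "\<dots> = ennreal (\<integral> s. 2 * (?x / (s + ?x)) \<partial>\<mu>)"
    proof (rule nn_integral_eq_integral)
      show "integrable \<mu> (\<lambda>s. 2 * (?x / (s + ?x)))" using int by (rule integrable_mult_right)
      show "AE s in \<mu>. 0 \<le> 2 * (?x / (s + ?x))"
        by (rule AE_I2) (use ct'(7) x in simp)
    qed
    also have "\<dots> \<le> ennreal (2 * B)"
    proof (rule ennreal_leI)
      have "(\<integral> s. 2 * (?x / (s + ?x)) \<partial>\<mu>) = 2 * (\<integral> s. ?x / (s + ?x) \<partial>\<mu>)"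
        by (rule Bochner_Integration.integral_mult_right_zero)
      then show "(\<integral> s. 2 * (?x / (s + ?x)) \<partial>\<mu>) \<le> 2 * B"
        using cbf_nonneg(3)[OF ct x] B[OF x] by linarith
    qed
    finally show ?thesis .
  qed simp
  have "space \<mu> = (\<Union>n. ?E n)"
    unfolding ct'(7)
  proof (intro equalityI subsetI)
    fix s :: real assume s: "s \<in> {0<..}"
    obtain n where "s \<le> real n" using real_arch_simple by blast
    with s show "s \<in> (\<Union>n. ?E n)" by auto
  qed auto
  then have "emeasure \<mu> (space \<mu>) = (SUP n. emeasure \<mu> (?E n))"
    using E by (subst SUP_emeasure_incseq) (auto simp: incseq_def range_subsetD)
  also have "\<dots> \<le> ennreal (2 * B)" by (rule SUP_least) (rule le)
  finally show "emeasure \<mu> (space \<mu>) < \<infinity>" by (simp add: le_less_trans)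
qed

lemma rearrange_bound:
  fixes c :: real
  assumes "0 < c" "0 < \<tau>" "y * n \<le> c * \<tau> * p"
  shows "1 / c * (n / \<tau>) * y \<le> p"
proof -
  have "1 / c * (n / \<tau>) * y = (y * n) / (c * \<tau>)" by simp
  also have "\<dots> \<le> p" using assms by (subst pos_divide_le_eq) (auto simp: mult_ac)
  finally show ?thesis .
qed

context bounded_semigroup begin

lemma A_single_valued: "(x, y) \<in> A \<Longrightarrow> (x, y') \<in> A \<Longrightarrow> y = y'"
  unfolding A_iff by (drule (1) tendsto_unique[OF trivial_limit_at_right_real]) simp

lemma A_shift_inv: "0 < s \<Longrightarrow> A \<odot> shift_inv s A = bop (D s)"
proof (intro equalityI subrelI)
  fix x y assume s: "0 < s"
  show "(x, y) \<in> bop (D s)" if "(x, y) \<in> A \<odot> shift_inv s A"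
    using that A_single_valued[OF A_R[OF s, of x], of y] by (auto simp: shift_inv_A[OF s] bop_mem)
  show "(x, y) \<in> A \<odot> shift_inv s A" if "(x, y) \<in> bop (D s)"
    using that A_R[OF s, of x] by (auto simp: shift_inv_A[OF s] bop_mem)
qed

lemma B_op_A: "B_op A = bop (D 1)"
  by (simp add: B_op_def A_shift_inv)

lemma R_cont: "continuous_on {0<..} R"
proof (rule continuous_on_eq_continuous_at[THEN iffD2, rule_format])
  fix t :: real assume "t \<in> {0<..}"
  then have t: "0 < t" by simp
  have "(R \<longlongrightarrow> R t) (at t)"
  proof (rule LIM_zero_cancel, rule Lim_null_comparison)
    have "\<forall>\<^sub>F s in at t. s \<in> {0<..}" using t by (intro eventually_at_in_open') auto
    then show "\<forall>\<^sub>F s in at t. norm (R s - R t) \<le> \<bar>t - s\<bar> * ((M / s) * (M / t))"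
    proof eventually_elim
      case (elim s)
      then have s: "0 < s" by simp
      have "R s - R t = (t - s) *\<^sub>R (R s o\<^sub>L R t)"
        by (rule blinfun_eqI) (simp add: blinfun.diff_left blinfun.scaleR_left R_resolvent[OF s t])
      moreover have "norm (R s o\<^sub>L R t) \<le> (M / s) * (M / t)"
        using s t M_ge_1 by (intro order_trans[OF norm_blinfun_compose] mult_mono norm_R) auto
      ultimately show ?case by (simp only: norm_scaleR real_norm_def mult_left_mono abs_ge_zero)
    qed
    have "((\<lambda>s. \<bar>t - s\<bar> * ((M / s) * (M / t))) \<longlongrightarrow> \<bar>t - t\<bar> * ((M / t) * (M / t))) (at t)"
      using t by (intro tendsto_intros) auto
    then show "((\<lambda>s. \<bar>t - s\<bar> * ((M / s) * (M / t))) \<longlongrightarrow> 0) (at t)" by simp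
  qed
  then show "isCont R t" by (simp add: isCont_def)
qed simp

lemma D_cont: "continuous_on {0<..} D"
  unfolding D_def by (intro continuous_intros R_cont)

lemma D_commute:
  assumes "Q o\<^sub>L R s = R s o\<^sub>L Q"
  shows "Q o\<^sub>L D s = D s o\<^sub>L Q"
  unfolding D_def by (simp add: comp_diff comp_scaleR blinfun_compose_id assms)

text \<open>
  The operators that commute with all resolvents are recorded because \<open>f(A)\<close> has to be exchanged with
  the semigroup and with fractional powers. In the estimate, \<open>D(0) = I\<close> contributes the term \<open>a z\<close>.
\<close>

lemma cbf_op_bounded:
  assumes f: "complete_bernstein f" and bd: "bounded (f ` {0<..})"
  shows "\<exists>F. cbf_op f A = bop F \<and> (\<forall>\<tau> z. 0 < \<tau> \<longrightarrow> f \<tau> * norm (D \<tau> z) \<le> 2 * M * norm (F z)) \<and>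
    (\<forall>Q. (\<forall>s>0. Q o\<^sub>L R s = R s o\<^sub>L Q) \<longrightarrow> Q o\<^sub>L F = F o\<^sub>L Q)"
proof -
  obtain a b \<mu> where p: "(SOME p. cbf_triple f p) = (a, b, \<mu>)" by (metis prod_cases3)
  have ct: "cbf_triple f (a, b, \<mu>)"
    using someI_ex[OF f[unfolded complete_bernstein_def]] by (simp add: p)
  note ct' = cbf_tripleD[OF ct] and bd' = cbf_bounded[OF ct bd]
  note nD = cbf_finite_dominated[OF ct bd'(2)]
  have "\<exists>F1. has_strong_integral \<mu> D F1"
    by (rule has_strong_integral_continuous[OF ct'(3,4) D_cont nD[OF norm_D]]) (auto intro: exI)
  then obtain F1 where F1: "has_strong_integral \<mu> D F1" by (elim exE)
  define F where "F = a *\<^sub>R id_blinfun + F1"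
  have app: "has_strong_integral \<mu> (\<lambda>s. app (A \<odot> shift_inv s A) x) z \<longleftrightarrow> z = F1 x" for x z
    by (rule has_strong_integral_apply_iff[OF F1]) (simp add: ct'(7) A_shift_inv app_bop)
  have "cbf_op f A = closure {(x, F x) | x. x \<in> Domain A}"
    unfolding cbf_op_def p prod.case app bd'(1)
    by (rule arg_cong[where f=closure]) (auto simp: F_def blinfun.add_left blinfun.scaleR_left)
  also have "\<dots> = bop F" by (rule closure_graph[OF A_dense])
  finally have 1: "cbf_op f A = bop F" .
  have 2: "f \<tau> * norm (D \<tau> z) \<le> 2 * M * norm (F z)" if \<tau>: "0 < \<tau>" for \<tau> z
  proof (rule cone_estimate[OF _ \<tau>])
    have "(F1 z, (\<integral> s. \<tau> / (\<tau> + s) \<partial>\<mu>)) \<in> resolvent_cone \<tau> z"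
    proof (rule strong_integral_pair_in_cone[OF ct'(3,4) _ _ has_strong_integral_apply[OF F1] _ _ closed_cone convex_cone_cone])
      show "continuous_on {0<..} (\<lambda>s. D s z)"
        by (intro continuous_intros D_cont)
      show "(\<integral>\<^sup>+ s. ennreal (norm (D s z)) \<partial>\<mu>) < \<infinity>"
        by (rule nD[where C="(1 + M) * norm z"]) (rule order_trans[OF norm_blinfun mult_right_mono[OF norm_D norm_ge_zero]])
      show "continuous_on {0<..} (\<lambda>s. \<tau> / (\<tau> + s))" using \<tau> by (auto intro!: continuous_intros)
      show "(\<integral>\<^sup>+ s. ennreal (norm (\<tau> / (\<tau> + s))) \<partial>\<mu>) < \<infinity>"
        by (rule nD[where C=1]) (use \<tau> in simp)
      show "(D s z, \<tau> / (\<tau> + s)) \<in> resolvent_cone \<tau> z" if "0 < s" for s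
        using that by (intro cone_generator) simp
    qed
    moreover have "a *\<^sub>R (z, 1) \<in> resolvent_cone \<tau> z"
      using convex_cone_scaleR[OF convex_cone_cone ct'(1) cone_generator[of 0 z \<tau>]] \<tau> by (simp add: D_0)
    ultimately have "a *\<^sub>R (z, 1) + (F1 z, (\<integral> s. \<tau> / (\<tau> + s) \<partial>\<mu>)) \<in> resolvent_cone \<tau> z"
      by (intro convex_cone_add[OF convex_cone_cone])
    then show "(F z, f \<tau>) \<in> resolvent_cone \<tau> z"
      using ct'(6)[OF \<tau>] bd'(1) by (simp add: F_def blinfun.add_left blinfun.scaleR_left add.commute[of \<tau>])
  qed
  have 3: "Q o\<^sub>L F = F o\<^sub>L Q" if Q: "\<forall>s>0. Q o\<^sub>L R s = R s o\<^sub>L Q" for Q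
  proof -
    have "Q o\<^sub>L F1 = F1 o\<^sub>L Q"
      by (rule has_strong_integral_commute[OF F1]) (use Q ct'(7) in \<open>auto intro: D_commute\<close>)
    then show ?thesis by (simp add: F_def comp_add comp_scaleR blinfun_compose_id)
  qed
  show ?thesis using 1 2 3 by blast
qed

end

section \<open>Strong integrals over the half-line\<close>

abbreviation half_line :: "real measure" where "half_line \<equiv> restrict_space lborel {0<..}"

lemma sets_half_line: "sets half_line = sets (restrict_space borel {0<..})"
  by (simp add: sets_restrict_space)

lemma space_half_line: "space half_line = {0<..}"
  by (simp add: space_restrict_space)

lemma emeasure_half_line: "E \<subseteq> {0<..} \<Longrightarrow> emeasure half_line E = emeasure lborel E"
  by (rule emeasure_restrict_space) auto

lemma emeasure_half_line_compact: "compact K \<Longrightarrow> K \<subseteq> {0<..} \<Longrightarrow> emeasure half_line K < \<infinity>"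
  using emeasure_bounded_finite[OF compact_imp_bounded, of K] by (simp add: emeasure_half_line)

lemma half_line_sets: "E \<in> sets borel \<Longrightarrow> E \<subseteq> {0<..} \<Longrightarrow> E \<in> sets half_line"
  by (auto simp: sets_restrict_space image_iff)

lemma half_line_integral_exists:
  fixes g :: "real \<Rightarrow> 'b::banach"
  assumes "continuous_on {0<..} g" and "(\<integral>\<^sup>+ s. ennreal (norm (g s)) \<partial>half_line) < \<infinity>"
  shows "\<exists>v. has_strong_integral half_line g v"
  by (rule has_strong_integral_continuous[OF sets_half_line emeasure_half_line_compact assms]) (auto intro: exI)

lemma nn_integral_powr_exp:
  fixes a c :: real
  assumes a: "0 < a" and c: "0 < c"
  shows "(\<integral>\<^sup>+ t. ennreal (indicator {0<..} t * t powr (a - 1) * exp (- c * t)) \<partial>lborel) = ennreal (Gamma a * c powr (- a))"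
proof -
  have G: "ennreal (Gamma a) = (\<integral>\<^sup>+ t. ennreal (indicator {0..} t * t powr (a - 1) / exp t) \<partial>lborel)"
    by (rule Gamma_conv_nn_integral_real[OF a])
  also have "\<dots> = \<bar>c\<bar> * (\<integral>\<^sup>+ t. ennreal (indicator {0..} (0 + c * t) * (0 + c * t) powr (a - 1) / exp (0 + c * t)) \<partial>lborel)"
    using c by (intro nn_integral_real_affine) auto
  also have "(\<integral>\<^sup>+ t. ennreal (indicator {0..} (0 + c * t) * (0 + c * t) powr (a - 1) / exp (0 + c * t)) \<partial>lborel)
     = (\<integral>\<^sup>+ t. ennreal (c powr (a - 1)) * ennreal (indicator {0<..} t * t powr (a - 1) * exp (- c * t)) \<partial>lborel)"
    using c by (intro nn_integral_cong)
      (auto simp: indicator_def powr_mult exp_minus field_simps zero_le_mult_iff simp flip: ennreal_mult')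
  also have "\<dots> = ennreal (c powr (a - 1)) * (\<integral>\<^sup>+ t. ennreal (indicator {0<..} t * t powr (a - 1) * exp (- c * t)) \<partial>lborel)"
    by (rule nn_integral_cmult) simp
  finally have "ennreal (Gamma a) = ennreal (c powr a) * (\<integral>\<^sup>+ t. ennreal (indicator {0<..} t * t powr (a - 1) * exp (- c * t)) \<partial>lborel)"
    using c by (simp add: mult.assoc[symmetric] ennreal_mult'[symmetric] powr_diff)
  then have "ennreal (c powr (-a)) * ennreal (Gamma a) = ennreal (c powr (-a)) * ennreal (c powr a) * (\<integral>\<^sup>+ t. ennreal (indicator {0<..} t * t powr (a - 1) * exp (- c * t)) \<partial>lborel)"
    by (simp add: mult.assoc)
  also have "ennreal (c powr (-a)) * ennreal (c powr a) = 1"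
    using c by (simp add: ennreal_mult'[symmetric] powr_add[symmetric])
  finally show ?thesis
    using c Gamma_real_pos[OF a] by (simp add: ennreal_mult' mult.commute)
qed

lemma Gamma_reflection_real:
  assumes "0 < r" "r < (1::real)"
  shows "Gamma r * Gamma (1 - r) = pi / sin (pi * r)"
proof -
  have "complex_of_real (Gamma r * Gamma (1 - r)) = Gamma (of_real r) * Gamma (1 - of_real r)"
    by (simp add: Gamma_complex_of_real[symmetric])
  also have "\<dots> = of_real (pi / sin (pi * r))"
    using Gamma_reflection_complex[of "of_real r"]
    by (simp add: sin_of_real of_real_mult[symmetric] del: of_real_mult)
  finally show ?thesis by (simp only: of_real_eq_iff)
qed

text \<open>
  Write \<open>1/(s + t)\<close> as the Laplace integral \<open>\<integral> e\<^sup>-\<^sup>u\<^sup>(\<^sup>s\<^sup>+\<^sup>t\<^sup>) du\<close> and integrate in \<open>s\<close> first; this leaves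
  \<open>\<Gamma>(r) \<Gamma>(1 - r) t\<^sup>r\<^sup>-\<^sup>1\<close>.
\<close>

lemma nn_integral_stieltjes:
  assumes r: "0 < r" "r < 1" and t: "0 < t"
  shows "(\<integral>\<^sup>+ s. ennreal (s powr (r - 1) / (s + t)) \<partial>half_line) = ennreal (pi / sin (pi * r) * t powr (r - 1))"
proof -
  let ?I = "indicator {0<..} :: real \<Rightarrow> real"
  have "(\<integral>\<^sup>+ s. ennreal (s powr (r - 1) / (s + t)) \<partial>half_line) = (\<integral>\<^sup>+ s. ennreal (s powr (r - 1) / (s + t)) * indicator {0<..} s \<partial>lborel)"
    by (rule nn_integral_restrict_space) simp
  also have "\<dots> = (\<integral>\<^sup>+ s. \<integral>\<^sup>+ u. ennreal (?I s * ?I u * s powr (r - 1) * exp (- u * (s + t))) \<partial>lborel \<partial>lborel)"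
  proof (rule nn_integral_cong)
    fix s :: real
    show "ennreal (s powr (r - 1) / (s + t)) * indicator {0<..} s = (\<integral>\<^sup>+ u. ennreal (?I s * ?I u * s powr (r - 1) * exp (- u * (s + t))) \<partial>lborel)"
    proof (cases "0 < s")
      case True
      have "(\<integral>\<^sup>+ u. ennreal (?I s * ?I u * s powr (r - 1) * exp (- u * (s + t))) \<partial>lborel)
         = (\<integral>\<^sup>+ u. ennreal (s powr (r - 1)) * ennreal (?I u * u powr (1 - 1) * exp (- (s + t) * u)) \<partial>lborel)"
        using True by (intro nn_integral_cong) (auto simp: indicator_def algebra_simps simp flip: ennreal_mult')
      also have "\<dots> = ennreal (s powr (r - 1)) * ennreal (Gamma 1 * (s + t) powr (- 1))"
        using True t by (subst nn_integral_cmult, simp, subst nn_integral_powr_exp) auto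
      also have "\<dots> = ennreal (s powr (r - 1) / (s + t))"
        using True t by (simp add: ennreal_mult'[symmetric] powr_minus divide_inverse)
      finally show ?thesis using True by simp
    qed simp
  qed
  also have "\<dots> = (\<integral>\<^sup>+ u. \<integral>\<^sup>+ s. ennreal (?I s * ?I u * s powr (r - 1) * exp (- u * (s + t))) \<partial>lborel \<partial>lborel)"
    by (rule lborel_pair.Fubini') (simp add: case_prod_unfold)
  also have "\<dots> = (\<integral>\<^sup>+ u. ennreal (Gamma r) * ennreal (?I u * u powr ((1 - r) - 1) * exp (- t * u)) \<partial>lborel)"
  proof (rule nn_integral_cong)
    fix u :: real
    show "(\<integral>\<^sup>+ s. ennreal (?I s * ?I u * s powr (r - 1) * exp (- u * (s + t))) \<partial>lborel) = ennreal (Gamma r) * ennreal (?I u * u powr ((1 - r) - 1) * exp (- t * u))"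
    proof (cases "0 < u")
      case True
      have "(\<integral>\<^sup>+ s. ennreal (?I s * ?I u * s powr (r - 1) * exp (- u * (s + t))) \<partial>lborel)
         = (\<integral>\<^sup>+ s. ennreal (exp (- t * u)) * ennreal (?I s * s powr (r - 1) * exp (- u * s)) \<partial>lborel)"
        using True by (intro nn_integral_cong) (auto simp: indicator_def algebra_simps mult_exp_exp simp flip: ennreal_mult')
      also have "\<dots> = ennreal (exp (- t * u)) * ennreal (Gamma r * u powr (- r))"
        using True r by (subst nn_integral_cmult, simp, subst nn_integral_powr_exp) auto
      finally show ?thesis using True r Gamma_real_pos[of r] by (simp add: ennreal_mult'[symmetric] mult_ac)
    qed simp
  qed
  also have "\<dots> = ennreal (Gamma r) * ennreal (Gamma (1 - r) * t powr (- (1 - r)))"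
    using r t by (subst nn_integral_cmult) (auto simp only: nn_integral_powr_exp borel_measurable_count_space, simp)
  also have "\<dots> = ennreal (pi / sin (pi * r) * t powr (r - 1))"
    using Gamma_reflection_real[OF r] Gamma_real_pos[of r] r
    by (simp add: ennreal_mult'[symmetric] mult.assoc[symmetric])
  finally show ?thesis .
qed

lemma has_strong_integral_norm_le:
  assumes v: "has_strong_integral M f v"
  shows "ennreal (norm v) \<le> (\<integral>\<^sup>+ t. ennreal (norm (f t)) \<partial>M)"
proof (cases "(\<integral>\<^sup>+ t. ennreal (norm (f t)) \<partial>M) = \<infinity>")
  case False
  then have e: "(\<integral>\<^sup>+ t. ennreal (norm (f t)) \<partial>M) = ennreal (enn2real (\<integral>\<^sup>+ t. ennreal (norm (f t)) \<partial>M))"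
    by (simp add: ennreal_enn2real top.not_eq_extremum)
  show ?thesis
    by (subst e) (rule ennreal_leI, rule has_strong_integral_norm_bound[OF v], use e in auto)
qed simp

lemma sin_pi_pos: "0 < r \<Longrightarrow> r < 1 \<Longrightarrow> 0 < sin (pi * r)"
  by (intro sin_gt_zero) auto

text \<open>
  The weight is that of Balakrishnan's formula, normalised such that its integral against
  \<open>1/(s + t)\<close> is \<open>t\<^sup>r\<^sup>-\<^sup>1\<close>.
\<close>

lemma stieltjes_dominated:
  fixes g :: "real \<Rightarrow> 'b::banach"
  assumes r: "0 < r" "r < 1" and t: "0 < t" and C: "0 \<le> C"
    and b: "\<And>s. 0 < s \<Longrightarrow> norm (g s) \<le> C * (sin (pi * r) / pi * s powr (r - 1) / (s + t))"
  shows "(\<integral>\<^sup>+ s. ennreal (norm (g s)) \<partial>half_line) \<le> ennreal (C * t powr (r - 1))"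
proof -
  have "(\<integral>\<^sup>+ s. ennreal (norm (g s)) \<partial>half_line) \<le> (\<integral>\<^sup>+ s. ennreal (C * (sin (pi * r) / pi)) * ennreal (s powr (r - 1) / (s + t)) \<partial>half_line)"
  proof (rule nn_integral_mono)
    fix s assume "s \<in> space half_line"
    then have s: "0 < s" by (simp add: space_half_line)
    have "ennreal (norm (g s)) \<le> ennreal (C * (sin (pi * r) / pi) * (s powr (r - 1) / (s + t)))"
      using b[OF s] by (intro ennreal_leI) (simp add: mult.assoc)
    then show "ennreal (norm (g s)) \<le> ennreal (C * (sin (pi * r) / pi)) * ennreal (s powr (r - 1) / (s + t))"
      using s t C sin_pi_pos[OF r] by (simp add: ennreal_mult'[symmetric])
  qed
  also have "\<dots> = ennreal (C * (sin (pi * r) / pi)) * ennreal (pi / sin (pi * r) * t powr (r - 1))"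
    by (subst nn_integral_cmult) (auto simp: nn_integral_stieltjes[OF r t] intro!: measurable_restrict_space1)
  also have "\<dots> = ennreal (C * t powr (r - 1))"
    using sin_pi_pos[OF r] C by (simp add: ennreal_mult'[symmetric])
  finally show ?thesis .
qed

lemma stieltjes_integral_exists:
  fixes g :: "real \<Rightarrow> 'b::banach"
  assumes "0 < r" "r < 1" "0 < t" "0 \<le> C" "continuous_on {0<..} g"
    and "\<And>s. 0 < s \<Longrightarrow> norm (g s) \<le> C * (sin (pi * r) / pi * s powr (r - 1) / (s + t))"
  shows "\<exists>v. has_strong_integral half_line g v"
proof -
  have "(\<integral>\<^sup>+ s. ennreal (norm (g s)) \<partial>half_line) < \<infinity>"
    using stieltjes_dominated[OF assms(1-4,6)] by (simp add: le_less_trans)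
  with assms(5) show ?thesis by (rule half_line_integral_exists)
qed

lemma stieltjes_integral_bound:
  fixes g :: "real \<Rightarrow> 'b::banach"
  assumes "0 < r" "r < 1" "0 < t" "0 \<le> C"
    and "\<And>s. 0 < s \<Longrightarrow> norm (g s) \<le> C * (sin (pi * r) / pi * s powr (r - 1) / (s + t))"
    and "has_strong_integral half_line g v"
  shows "norm v \<le> C * t powr (r - 1)"
  using has_strong_integral_norm_bound[OF assms(6) stieltjes_dominated[OF assms(1-5)]] assms(4) by simp

lemma has_vector_derivativeI_quotient:
  fixes f :: "real \<Rightarrow> 'b::real_normed_vector"
  assumes "((\<lambda>y. (1 / (y - x)) *\<^sub>R (f y - f x)) \<longlongrightarrow> D) (at x within S)"
  shows "(f has_vector_derivative D) (at x within S)"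
  unfolding has_vector_derivative_def has_derivative_within
proof (intro conjI bounded_linear_scaleR_left)
  have "((\<lambda>y. norm ((1 / (y - x)) *\<^sub>R (f y - f x) - D)) \<longlongrightarrow> 0) (at x within S)"
    using tendsto_norm_zero[OF LIM_zero[OF assms]] .
  then have "((\<lambda>y. norm ((1 / norm (y - x)) *\<^sub>R (f y - (f x + (y - x) *\<^sub>R D)))) \<longlongrightarrow> 0) (at x within S)"
  proof (rule Lim_transform_eventually)
    have "\<forall>\<^sub>F y in at x within S. y \<noteq> x" by (simp add: eventually_at_filter)
    then show "\<forall>\<^sub>F y in at x within S. norm ((1 / (y - x)) *\<^sub>R (f y - f x) - D) = norm ((1 / norm (y - x)) *\<^sub>R (f y - (f x + (y - x) *\<^sub>R D)))"
    proof eventually_elim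
      case (elim y)
      then have "(1 / (y - x)) *\<^sub>R (f y - f x) - D = (1 / (y - x)) *\<^sub>R (f y - (f x + (y - x) *\<^sub>R D))"
        by (simp add: scaleR_diff_right scaleR_add_right)
      then show ?case by simp
    qed
  qed
  then show "((\<lambda>y. (1 / norm (y - x)) *\<^sub>R (f y - (f x + (y - x) *\<^sub>R D))) \<longlongrightarrow> 0) (at x within S)"
    by (rule tendsto_norm_zero_cancel)
qed

lemma continuous_borel_half_line: "continuous_on {0<..} g \<Longrightarrow> g \<in> borel_measurable half_line"
  using borel_measurable_continuous_on_restrict[of "{0<..}" g] measurable_cong_sets[OF sets_half_line refl] by blast

abbreviation cut :: "real set \<Rightarrow> (real \<Rightarrow> 'b::zero) \<Rightarrow> real \<Rightarrow> 'b"
  where "cut E g \<equiv> \<lambda>s. if s \<in> E then g s else 0"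

lemma cut_measurable:
  assumes g: "continuous_on {0<..} g" and E: "E \<in> sets borel" "E \<subseteq> {0<..}"
  shows "cut E g \<in> borel_measurable half_line"
proof (rule measurable_If_set)
  have "E \<inter> space half_line = E" using E(2) by (auto simp: space_half_line)
  then show "E \<inter> space half_line \<in> sets half_line" using half_line_sets[OF E] by simp
qed (use continuous_borel_half_line[OF g] in auto)

lemma has_strong_integral_diff_eq:
  assumes "has_strong_integral M f u" "has_strong_integral M g v" "h \<in> borel_measurable M"
    and h: "\<And>s. s \<in> space M \<Longrightarrow> f s - g s = h s"
  shows "has_strong_integral M h (u - v)"
proof -
  have "(\<lambda>s. f s - g s) \<in> borel_measurable M"
    using assms(3) by (rule measurable_cong[THEN iffD2, rotated]) (rule h)
  from has_strong_integral_diff[OF assms(1,2) this] show ?thesis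
    by (rule has_strong_integral_cong[THEN iffD1, rotated]) (rule h)
qed

lemma cut_integral_tendsto_0:
  fixes g :: "real \<Rightarrow> 'b::banach"
  assumes g: "continuous_on {0<..} g" and fin: "(\<integral>\<^sup>+ s. ennreal (norm (g s)) \<partial>half_line) < \<infinity>"
    and E: "\<And>n. E n \<in> sets borel" "\<And>n. E n \<subseteq> {0<..}" "\<And>s. 0 < s \<Longrightarrow> \<forall>\<^sub>F n in sequentially. s \<notin> E n"
    and w: "\<And>n. has_strong_integral half_line (cut (E n) g) (w n)"
  shows "w \<longlonglongrightarrow> 0"
proof -
  have nm: "(\<lambda>s. ennreal (norm (h s))) \<in> borel_measurable half_line" if "h \<in> borel_measurable half_line" for h :: "real \<Rightarrow> 'b"
    using measurable_compose[OF that borel_measurable_continuous_onI[OF continuous_on_norm[OF continuous_on_id]]] by simp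
  have "(\<lambda>n. \<integral>\<^sup>+ s. ennreal (norm (cut (E n) g s)) \<partial>half_line) \<longlonglongrightarrow> (\<integral>\<^sup>+ s. 0 \<partial>half_line)"
  proof (rule nn_integral_dominated_convergence[where w="\<lambda>s. ennreal (norm (g s))"])
    show "AE s in half_line. (\<lambda>n. ennreal (norm (cut (E n) g s))) \<longlonglongrightarrow> 0"
    proof (rule AE_I2)
      fix s assume "s \<in> space half_line"
      then have "\<forall>\<^sub>F n in sequentially. s \<notin> E n" using E(3) by (simp add: space_half_line)
      then have "\<forall>\<^sub>F n in sequentially. ennreal (norm (cut (E n) g s)) = 0"
        by eventually_elim simp
      then show "(\<lambda>n. ennreal (norm (cut (E n) g s))) \<longlonglongrightarrow> 0" by (rule tendsto_eventually)
    qed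
    show "(\<lambda>s. ennreal (norm (cut (E n) g s))) \<in> borel_measurable half_line" for n
      by (intro nm cut_measurable g E)
  qed (use fin nm[OF continuous_borel_half_line[OF g]] in auto)
  then have l: "(\<lambda>n. \<integral>\<^sup>+ s. ennreal (norm (cut (E n) g s)) \<partial>half_line) \<longlonglongrightarrow> 0" by simp
  from ennreal_tendsto_0_le[OF l has_strong_integral_norm_le[OF w]]
  have "(\<lambda>n. ennreal (norm (w n))) \<longlonglongrightarrow> ennreal 0" by simp
  then have "(\<lambda>n. norm (w n)) \<longlonglongrightarrow> 0"
    by (subst (asm) tendsto_ennreal_iff) auto
  then show ?thesis by (rule tendsto_norm_zero_cancel)
qed

text \<open>
  The integral \<open>\<Phi>(x)\<close> over \<open>(0, x]\<close> is differentiable with derivative \<open>g\<close>, so that \<open>\<Phi> - G\<close> is constant;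
  its limits at \<open>0\<close> and at infinity give the value.
\<close>

lemma strong_FTC:
  fixes G g :: "real \<Rightarrow> 'b::banach"
  assumes G: "\<And>s. 0 < s \<Longrightarrow> (G has_vector_derivative g s) (at s)"
    and g: "continuous_on {0<..} g"
    and fin: "(\<integral>\<^sup>+ s. ennreal (norm (g s)) \<partial>half_line) < \<infinity>"
    and L0: "(\<lambda>n. G (1 / (real n + 1))) \<longlonglongrightarrow> L0" and L1: "(\<lambda>n. G (real n + 1)) \<longlonglongrightarrow> L1"
  shows "has_strong_integral half_line g (L1 - L0)"
proof -
  obtain v where v: "has_strong_integral half_line g v"
    using half_line_integral_exists[OF g fin] by (elim exE)
  have "\<exists>w. has_strong_integral half_line (cut {0<..x} g) w" for x
    by (rule has_strong_integral_restrict[OF v half_line_sets]) auto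
  then obtain \<Phi> where \<Phi>: "\<And>x. has_strong_integral half_line (cut {0<..x} g) (\<Phi> x)"
    by metis
  have diff: "has_strong_integral half_line (cut {x<..y} (\<lambda>s. g s - c)) (\<Phi> y - \<Phi> x - (y - x) *\<^sub>R c)"
    if "0 < x" "x \<le> y" for x y c
  proof -
    have E: "{x<..y} \<subseteq> {0<..}" using that by auto
    have em: "emeasure half_line {x<..y} = ennreal (y - x)" using that by (simp add: emeasure_half_line[OF E])
    have "has_strong_integral half_line (cut {x<..y} (\<lambda>_. c)) (measure half_line {x<..y} *\<^sub>R c)"
      by (rule has_strong_integral_const_on) (simp_all add: em half_line_sets[OF _ E])
    then have 1: "has_strong_integral half_line (cut {x<..y} (\<lambda>_. c)) ((y - x) *\<^sub>R c)"
      using that by (simp add: measure_def em)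
    have 2: "has_strong_integral half_line (cut {x<..y} g) (\<Phi> y - \<Phi> x)"
      by (rule has_strong_integral_diff_eq[OF \<Phi> \<Phi> cut_measurable[OF g _ E]]) (use that in auto)
    show ?thesis
      by (rule has_strong_integral_diff_eq[OF 2 1 cut_measurable[OF _ _ E]]) (auto intro!: continuous_intros g)
  qed
  have d\<Phi>: "(\<Phi> has_vector_derivative g x) (at x)" if x: "0 < x" for x
  proof (rule has_vector_derivativeI_quotient, rule tendstoI)
    fix e :: real assume e: "e > 0"
    have "isCont g x" using g x by (simp add: continuous_on_eq_continuous_at)
    then obtain d where d: "d > 0" "\<And>s. dist s x < d \<Longrightarrow> dist (g s) (g x) < e / 2"
      unfolding continuous_at_eps_delta using e by (metis half_gt_zero)
    have est: "norm (\<Phi> hi - \<Phi> lo - (hi - lo) *\<^sub>R g x) \<le> e / 2 * (hi - lo)"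
      if "0 < lo" "lo \<le> hi" "x - d < lo" "hi < x + d" for lo hi
    proof (rule has_strong_integral_norm_bound[OF diff[OF that(1,2)]])
      have "(\<integral>\<^sup>+ s. ennreal (norm (cut {lo<..hi} (\<lambda>s. g s - g x) s)) \<partial>half_line)
        \<le> (\<integral>\<^sup>+ s. ennreal (e / 2) * indicator {lo<..hi} s \<partial>half_line)"
      proof (rule nn_integral_mono)
        fix s
        show "ennreal (norm (cut {lo<..hi} (\<lambda>s. g s - g x) s)) \<le> ennreal (e / 2) * indicator {lo<..hi} s"
        proof (cases "s \<in> {lo<..hi}")
          case True
          then have "dist s x < d" using that by (auto simp: dist_real_def)
          then have "norm (g s - g x) \<le> e / 2" using d(2)[of s] by (simp add: dist_norm)
          then show ?thesis using True by (simp add: ennreal_leI)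
        qed auto
      qed
      also have "\<dots> = ennreal (e / 2) * emeasure half_line {lo<..hi}"
        using that by (intro nn_integral_cmult_indicator half_line_sets) auto
      also have "\<dots> = ennreal (e / 2 * (hi - lo))"
        using that e by (simp add: emeasure_half_line subset_eq ennreal_mult'[symmetric])
      finally show "(\<integral>\<^sup>+ s. ennreal (norm (cut {lo<..hi} (\<lambda>s. g s - g x) s)) \<partial>half_line) \<le> ennreal (e / 2 * (hi - lo))" .
    qed (use that e in simp)
    have "\<forall>\<^sub>F y in at x. dist y x < min d x \<and> y \<noteq> x"
      using d(1) x by (auto simp: eventually_at intro!: exI[of _ "min d x"])
    then show "\<forall>\<^sub>F y in at x. dist ((1 / (y - x)) *\<^sub>R (\<Phi> y - \<Phi> x)) (g x) < e"
    proof eventually_elim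
      case (elim y)
      then have y: "y \<noteq> x" "0 < y" "x - d < y" "y < x + d" by (auto simp: dist_real_def)
      have "norm (\<Phi> y - \<Phi> x - (y - x) *\<^sub>R g x) \<le> e / 2 * \<bar>y - x\<bar>"
      proof (cases "x \<le> y")
        case True
        then show ?thesis using est[of x y] y x d(1) by simp
      next
        case False
        have "\<Phi> y - \<Phi> x - (y - x) *\<^sub>R g x = - (\<Phi> x - \<Phi> y - (x - y) *\<^sub>R g x)"
          by (simp add: algebra_simps)
        then show ?thesis using est[of y x] y x d(1) False by (simp only: norm_minus_cancel) simp
      qed
      moreover have "(1 / (y - x)) *\<^sub>R (\<Phi> y - \<Phi> x) - g x = (1 / (y - x)) *\<^sub>R (\<Phi> y - \<Phi> x - (y - x) *\<^sub>R g x)"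
        using y by (simp add: scaleR_diff_right)
      then have "norm ((1 / (y - x)) *\<^sub>R (\<Phi> y - \<Phi> x) - g x) = norm (\<Phi> y - \<Phi> x - (y - x) *\<^sub>R g x) / \<bar>y - x\<bar>"
        by (simp only: norm_scaleR abs_divide abs_one) simp
      ultimately have "norm ((1 / (y - x)) *\<^sub>R (\<Phi> y - \<Phi> x) - g x) \<le> e / 2"
        using y(1) by (simp add: pos_divide_le_eq)
      then show ?case using e by (simp add: dist_norm)
    qed
  qed
  have "\<exists>\<kappa>. \<forall>x\<in>{0<..}. \<Phi> x - G x = \<kappa>"
  proof -
    have "((\<lambda>x. \<Phi> x - G x) has_vector_derivative 0) (at x within {0<..})" if "x \<in> {0<..}" for x
      using has_vector_derivative_diff[OF d\<Phi> G, of x] that has_vector_derivative_at_within by fastforce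
    from has_vector_derivative_zero_constant[OF _ this] show ?thesis by (metis convex_real_interval(3))
  qed
  then obtain \<kappa> where \<kappa>: "\<And>x. 0 < x \<Longrightarrow> \<Phi> x = \<kappa> + G x"
    by (auto simp: algebra_simps)
  have "(\<lambda>n. \<Phi> (1 / (real n + 1))) \<longlonglongrightarrow> 0"
  proof (rule cut_integral_tendsto_0[OF g fin _ _ _ \<Phi>])
    fix s :: real assume s: "0 < s"
    obtain N where N: "1 / s < real N" using reals_Archimedean2 by blast
    show "\<forall>\<^sub>F n in sequentially. s \<notin> {0<..1 / (real n + 1)}"
    proof (rule eventually_sequentiallyI[of N])
      fix n assume "N \<le> n"
      then have "1 / s < real n + 1" using N by linarith
      then have "1 / (real n + 1) < s" using s by (simp add: field_simps)
      then show "s \<notin> {0<..1 / (real n + 1)}" by simp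
    qed
  qed auto
  moreover have "(\<lambda>n. \<Phi> (1 / (real n + 1))) \<longlonglongrightarrow> \<kappa> + L0"
    using tendsto_add[OF tendsto_const L0] by (subst \<kappa>) (auto simp: add_pos_nonneg)
  ultimately have k0: "0 = \<kappa> + L0" by (rule LIMSEQ_unique)
  have "(\<lambda>n. v - \<Phi> (real n + 1)) \<longlonglongrightarrow> 0"
  proof (rule cut_integral_tendsto_0[OF g fin])
    show "has_strong_integral half_line (cut {real n + 1<..} g) (v - \<Phi> (real n + 1))" for n
      by (rule has_strong_integral_diff_eq[OF v \<Phi> cut_measurable[OF g]]) (auto simp: space_half_line)
    fix s :: real
    obtain N where "s < real N" using reals_Archimedean2 by blast
    then show "\<forall>\<^sub>F n in sequentially. s \<notin> {real n + 1<..}"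
      by (intro eventually_sequentiallyI[of N]) auto
  qed auto
  moreover have "(\<lambda>n. v - \<Phi> (real n + 1)) \<longlonglongrightarrow> v - (\<kappa> + L1)"
    by (subst \<kappa>) (auto intro!: tendsto_intros L1 simp: add_pos_nonneg)
  ultimately have "0 = v - (\<kappa> + L1)" by (rule LIMSEQ_unique)
  then have "v = \<kappa> + L1" by simp
  moreover have "\<kappa> = - L0" using k0 by (simp add: eq_neg_iff_add_eq_0)
  ultimately have "v = L1 - L0" by simp
  then show ?thesis using v by simp
qed

section \<open>Pseudo-resolvents and the law of exponents\<close>

text \<open>
  The density in Balakrishnan's formula.
\<close>

definition weight :: "real \<Rightarrow> real \<Rightarrow> real"
  where "weight r s = sin (pi * r) / pi * s powr (r - 1)"

lemma weight_nonneg: "0 < r \<Longrightarrow> r < 1 \<Longrightarrow> 0 \<le> weight r s"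
  using sin_pi_pos[of r] by (simp add: weight_def)

lemma weight_cont: "continuous_on {0<..} (weight r)"
  unfolding weight_def by (auto intro!: continuous_intros)

text \<open>
  Stated in the form required by \<open>stieltjes_integral_exists\<close>.
\<close>

lemma weight_norm:
  fixes P :: "'b::real_normed_vector"
  assumes "0 < r" "r < 1" "norm P \<le> C / (s + t)"
  shows "norm (weight r s *\<^sub>R P) \<le> C * (sin (pi * r) / pi * s powr (r - 1) / (s + t))"
proof -
  have "norm (weight r s *\<^sub>R P) \<le> weight r s * (C / (s + t))"
    unfolding norm_scaleR real_norm_def abs_of_nonneg[OF weight_nonneg[OF assms(1,2)]]
    by (intro mult_left_mono weight_nonneg assms)
  then show ?thesis by (simp add: weight_def mult.commute)
qed

text \<open>
  The model is \<open>Q(s) = (s + A)\<inverse>\<close> for an invertible sectorial operator \<open>A\<close>, where \<open>Q(0) = A\<inverse>\<close>. Only the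
  resolvent equation and the decay are used, so \<open>A\<close> itself does not appear.
\<close>

locale pseudo_resolvent =
  fixes Q :: "real \<Rightarrow> 'a::banach \<Rightarrow>\<^sub>L 'a" and K :: real
  assumes resolvent: "0 \<le> s \<Longrightarrow> 0 \<le> t \<Longrightarrow> (t - s) *\<^sub>R (Q s o\<^sub>L Q t) = Q s - Q t"
    and bound: "0 \<le> s \<Longrightarrow> norm (Q s) \<le> K / (1 + s)"
begin

lemma K_nonneg: "0 \<le> K"
  using order_trans[OF norm_ge_zero bound[of 0]] by simp

lemma norm_Q_le:
  assumes "0 \<le> s"
  shows "norm (Q s) \<le> K"
proof -
  have "K / (1 + s) \<le> K / 1" using assms K_nonneg by (intro divide_left_mono) auto
  then show ?thesis using bound[OF assms] by simp
qed

lemma commute: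
  assumes "0 \<le> s" "0 \<le> t"
  shows "Q s o\<^sub>L Q t = Q t o\<^sub>L Q s"
proof (cases "s = t")
  case False
  have "(t - s) *\<^sub>R (Q t o\<^sub>L Q s) = - ((s - t) *\<^sub>R (Q t o\<^sub>L Q s))"
    by (simp add: algebra_simps)
  also have "\<dots> = (t - s) *\<^sub>R (Q s o\<^sub>L Q t)"
    unfolding resolvent[OF assms] resolvent[OF assms(2,1)] by simp
  finally show ?thesis using False by simp
qed simp

lemma norm_comp: "norm P \<le> p \<Longrightarrow> norm R \<le> r \<Longrightarrow> norm (P o\<^sub>L R) \<le> p * r"
  for P R :: "'a \<Rightarrow>\<^sub>L 'a"
  by (rule order_trans[OF norm_blinfun_compose mult_mono]) (auto intro: order_trans[OF norm_ge_zero])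

lemma Q_diff: "0 \<le> s \<Longrightarrow> 0 \<le> t \<Longrightarrow> norm (Q s - Q t) \<le> \<bar>t - s\<bar> * (K * K)"
  unfolding resolvent[symmetric] norm_scaleR real_norm_def
  by (intro mult_left_mono norm_comp norm_Q_le) auto

lemma Q_cont: "continuous_on {0..} Q"
proof (rule continuous_onI)
  fix t e :: real assume t: "t \<in> {0..}" and e: "0 < e"
  have k: "K * K + 1 > 0" using K_nonneg by (simp add: add_nonneg_pos)
  show "\<exists>d>0. \<forall>s\<in>{0..}. dist s t < d \<longrightarrow> dist (Q s) (Q t) \<le> e"
  proof (intro exI[of _ "e / (K * K + 1)"] conjI ballI impI)
    fix s :: real assume s: "s \<in> {0..}" "dist s t < e / (K * K + 1)"
    have "norm (Q s - Q t) \<le> \<bar>t - s\<bar> * (K * K)" using s t by (intro Q_diff) auto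
    also have "\<dots> \<le> (e / (K * K + 1)) * (K * K + 1)"
      using s(2) k by (intro mult_mono) (auto simp: dist_real_def)
    finally show "dist (Q s) (Q t) \<le> e" using k by (simp add: dist_norm)
  qed (use e k in simp)
qed

lemma Q_cont_shift: "0 \<le> t \<Longrightarrow> continuous_on {0<..} (\<lambda>s. Q (s + t))"
  by (rule continuous_on_compose2[OF Q_cont]) (auto intro!: continuous_intros)

lemma Q_deriv:
  assumes t: "0 \<le> t"
  shows "(Q has_vector_derivative - (Q t o\<^sub>L Q t)) (at t within {0..})"
proof (rule has_vector_derivativeI_quotient)
  have c: "(Q \<longlongrightarrow> Q t) (at t within {0..})" using Q_cont t by (simp add: continuous_on_def)
  have "((\<lambda>s. - (Q s o\<^sub>L Q t)) \<longlongrightarrow> - (Q t o\<^sub>L Q t)) (at t within {0..})"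
    by (intro tendsto_minus bounded_bilinear.tendsto[OF bounded_bilinear_blinfun_compose] c tendsto_const)
  then show "((\<lambda>s. (1 / (s - t)) *\<^sub>R (Q s - Q t)) \<longlongrightarrow> - (Q t o\<^sub>L Q t)) (at t within {0..})"
  proof (rule Lim_transform_eventually)
    have "\<forall>\<^sub>F s in at t within {0..}. s \<in> {0..} \<and> s \<noteq> t" by (simp add: eventually_at_filter)
    then show "\<forall>\<^sub>F s in at t within {0..}. - (Q s o\<^sub>L Q t) = (1 / (s - t)) *\<^sub>R (Q s - Q t)"
    proof eventually_elim
      case (elim s)
      then have "(1 / (s - t)) *\<^sub>R (Q s - Q t) = (1 / (s - t)) *\<^sub>R ((t - s) *\<^sub>R (Q s o\<^sub>L Q t))"
        using t by (simp add: resolvent)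
      also have "\<dots> = ((t - s) / (s - t)) *\<^sub>R (Q s o\<^sub>L Q t)" by simp
      also have "(t - s) / (s - t) = -1" using elim by (simp add: field_simps)
      finally show ?case by simp
    qed
  qed
qed

lemma shift_bound: "0 \<le> t \<Longrightarrow> 0 < s \<Longrightarrow> norm (Q (s + t)) \<le> K / (s + 1)"
proof -
  assume a: "0 \<le> t" "0 < s"
  have "norm (Q (s + t)) \<le> K / (1 + (s + t))" using a by (intro bound) auto
  also have "\<dots> \<le> K / (s + 1)" using a K_nonneg by (intro divide_left_mono mult_pos_pos) auto
  finally show ?thesis .
qed

text \<open>
  The fractional power \<open>(t + A)\<^sup>r\<^sup>-\<^sup>1\<close>.
\<close>

definition W :: "real \<Rightarrow> real \<Rightarrow> 'a \<Rightarrow>\<^sub>L 'a"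
  where "W r t = (SOME V. has_strong_integral half_line (\<lambda>s. weight r s *\<^sub>R Q (s + t)) V)"

lemma W_integral:
  assumes r: "0 < r" "r < 1" and t: "0 \<le> t"
  shows "has_strong_integral half_line (\<lambda>s. weight r s *\<^sub>R Q (s + t)) (W r t)"
  unfolding W_def
proof (rule someI_ex, rule stieltjes_integral_exists[OF r, where t=1 and C=K])
  show "continuous_on {0<..} (\<lambda>s. weight r s *\<^sub>R Q (s + t))"
    by (intro continuous_intros weight_cont Q_cont_shift t)
  show "norm (weight r s *\<^sub>R Q (s + t)) \<le> K * (sin (pi * r) / pi * s powr (r - 1) / (s + 1))" if "0 < s" for s
    by (rule weight_norm[OF r shift_bound[OF t that]])
qed (use K_nonneg in auto)

lemma W_commute:
  assumes r: "0 < r" "r < 1" and t: "0 \<le> t" and c: "\<And>s. 0 < s \<Longrightarrow> P o\<^sub>L Q s = Q s o\<^sub>L P"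
  shows "P o\<^sub>L W r t = W r t o\<^sub>L P"
proof (rule has_strong_integral_commute[OF W_integral[OF r t]])
  fix s assume "s \<in> space half_line"
  then have "P o\<^sub>L Q (s + t) = Q (s + t) o\<^sub>L P" using t by (intro c) (simp add: space_half_line)
  then show "P o\<^sub>L (weight r s *\<^sub>R Q (s + t)) = (weight r s *\<^sub>R Q (s + t)) o\<^sub>L P"
    by (simp add: comp_scaleR)
qed

text \<open>
  Integration by parts: the difference of the two sides is the integral of the derivative of
  \<open>s\<^sup>r Q(t) Q(s + t)\<close>, up to the constant \<open>sin (\<pi> r)/\<pi>\<close>, and this function vanishes at \<open>0\<close> and at
  infinity. The derivative is simplified with \<open>s Q(t) Q(s + t) = Q(t) - Q(s + t)\<close>.
\<close>

lemma square_integral: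
  assumes r: "0 < r" "r < 1" and t: "0 \<le> t"
  shows "has_strong_integral half_line (\<lambda>s. weight r s *\<^sub>R (Q (s + t) o\<^sub>L Q (s + t))) ((1 - r) *\<^sub>R (Q t o\<^sub>L W r t))"
proof -
  define c where "c = sin (pi * r) / pi"
  define G where "G = (\<lambda>s. (c * s powr r) *\<^sub>R (Q t o\<^sub>L Q (s + t)))"
  define g where "g = (\<lambda>s. weight r s *\<^sub>R (Q (s + t) o\<^sub>L Q (s + t)) - (1 - r) *\<^sub>R (Q t o\<^sub>L (weight r s *\<^sub>R Q (s + t))))"
  have c: "0 \<le> c" using sin_pi_pos[OF r] by (simp add: c_def)
  have dG: "(G has_vector_derivative g s) (at s)" if s: "0 < s" for s
  proof -
    have "((Q \<circ> (\<lambda>s. s + t)) has_vector_derivative 1 *\<^sub>R - (Q (s + t) o\<^sub>L Q (s + t))) (at s within {0<..})"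
    proof (rule vector_diff_chain_within)
      show "((\<lambda>s. s + t) has_vector_derivative 1) (at s within {0<..})" by (auto intro!: derivative_eq_intros)
      show "(Q has_vector_derivative - (Q (s + t) o\<^sub>L Q (s + t))) (at (s + t) within (\<lambda>s. s + t) ` {0<..})"
        using s t by (intro has_vector_derivative_within_subset[OF Q_deriv]) auto
    qed
    then have "((\<lambda>s. Q (s + t)) has_vector_derivative - (Q (s + t) o\<^sub>L Q (s + t))) (at s)"
      using s by (simp add: o_def at_within_open[of s "{0<..}"])
    then have "((\<lambda>s. Q t o\<^sub>L Q (s + t)) has_vector_derivative Q t o\<^sub>L - (Q (s + t) o\<^sub>L Q (s + t))) (at s)"
      by (rule bounded_linear.has_vector_derivative[OF comp_linear_right])
    moreover have "((\<lambda>s. c * s powr r) has_field_derivative c * (r * s powr (r - 1))) (at s)"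
      using s by (auto intro!: derivative_eq_intros simp: powr_diff)
    ultimately have "(G has_vector_derivative (c * s powr r) *\<^sub>R (Q t o\<^sub>L - (Q (s + t) o\<^sub>L Q (s + t))) + (c * (r * s powr (r - 1))) *\<^sub>R (Q t o\<^sub>L Q (s + t))) (at s)"
      unfolding G_def by (intro has_vector_derivative_scaleR)
    also have "(c * s powr r) *\<^sub>R (Q t o\<^sub>L - (Q (s + t) o\<^sub>L Q (s + t))) + (c * (r * s powr (r - 1))) *\<^sub>R (Q t o\<^sub>L Q (s + t)) = g s"
    proof -
      have e: "s *\<^sub>R (Q t o\<^sub>L Q (s + t)) = Q t - Q (s + t)"
        using resolvent[of t "s + t"] s t by simp
      have "(c * s powr r) *\<^sub>R (Q t o\<^sub>L - (Q (s + t) o\<^sub>L Q (s + t))) = - ((c * s powr (r - 1)) *\<^sub>R ((s *\<^sub>R (Q t o\<^sub>L Q (s + t))) o\<^sub>L Q (s + t)))"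
        using s by (simp add: powr_diff comp_minus comp_scaleR blinfun_compose_assoc)
      also have "\<dots> = (c * s powr (r - 1)) *\<^sub>R (Q (s + t) o\<^sub>L Q (s + t)) - (c * s powr (r - 1)) *\<^sub>R (Q t o\<^sub>L Q (s + t))"
        unfolding e by (simp add: comp_diff scaleR_diff_right)
      finally show ?thesis
        by (simp add: g_def weight_def c_def[symmetric] comp_scaleR scaleR_left_diff_distrib algebra_simps)
    qed
    finally show ?thesis .
  qed
  have cg: "continuous_on {0<..} g"
    unfolding g_def by (intro continuous_intros weight_cont comp_continuous Q_cont_shift t)
  have ng: "norm (g s) \<le> (2 * (K * K)) * (sin (pi * r) / pi * s powr (r - 1) / (s + 1))" if s: "0 < s" for s
  proof -
    let ?X = "(Q (s + t) - (1 - r) *\<^sub>R Q t) o\<^sub>L Q (s + t)"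
    have "norm ((1 - r) *\<^sub>R Q t) \<le> 1 * K"
      unfolding norm_scaleR using r norm_Q_le[OF t] by (intro mult_mono) auto
    then have "norm (Q (s + t) - (1 - r) *\<^sub>R Q t) \<le> 2 * K"
      using norm_triangle_ineq4[of "Q (s + t)" "(1 - r) *\<^sub>R Q t"] norm_Q_le[of "s + t"] s t by linarith
    then have "norm ?X \<le> 2 * K * (K / (s + 1))"
      by (intro norm_comp shift_bound t s)
    then have "norm ?X \<le> 2 * (K * K) / (s + 1)" by simp
    from weight_norm[OF r this]
    show ?thesis by (simp add: g_def comp_diff comp_scaleR scaleR_diff_right mult.commute)
  qed
  have fin: "(\<integral>\<^sup>+ s. ennreal (norm (g s)) \<partial>half_line) < \<infinity>"
    using stieltjes_dominated[OF r, where t=1 and C="2 * (K * K)", OF _ _ ng] K_nonneg by (simp add: le_less_trans)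
  have nG: "norm (G s) \<le> c * s powr r * (K * (K / (s + 1)))" if "0 < s" for s
    unfolding G_def norm_scaleR using that c
    by (intro mult_mono norm_comp norm_Q_le shift_bound t) auto
  have pow: "(\<lambda>n. C * (real n + 1) powr (- q)) \<longlonglongrightarrow> 0" if "0 < q" for C q
  proof -
    have "filterlim (\<lambda>n. real n + 1) at_top sequentially"
      using filterlim_compose[OF filterlim_real_sequentially filterlim_Suc] by (simp add: add.commute)
    then show ?thesis using that by (intro tendsto_mult_right_zero tendsto_neg_powr) auto
  qed
  have L0: "(\<lambda>n. G (1 / (real n + 1))) \<longlonglongrightarrow> 0"
  proof (rule Lim_null_comparison)
    show "\<forall>\<^sub>F n in sequentially. norm (G (1 / (real n + 1))) \<le> c * (K * K) * (real n + 1) powr (- r)"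
    proof (intro always_eventually allI)
      fix n
      have "norm (G (1 / (real n + 1))) \<le> c * (1 / (real n + 1)) powr r * (K * (K / (1 / (real n + 1) + 1)))"
        by (rule nG) simp
      also have "\<dots> \<le> c * (1 / (real n + 1)) powr r * (K * (K / 1))"
        using c K_nonneg by (intro mult_left_mono divide_left_mono) (auto simp: add_pos_nonneg add_nonneg_pos)
      finally show "norm (G (1 / (real n + 1))) \<le> c * (K * K) * (real n + 1) powr (- r)"
        by (simp add: powr_divide powr_minus_divide mult.commute)
    qed
    show "(\<lambda>n. c * (K * K) * (real n + 1) powr (- r)) \<longlonglongrightarrow> 0" by (rule pow) (rule r)
  qed
  have L1: "(\<lambda>n. G (real n + 1)) \<longlonglongrightarrow> 0"
  proof (rule Lim_null_comparison)
    show "\<forall>\<^sub>F n in sequentially. norm (G (real n + 1)) \<le> c * (K * K) * (real n + 1) powr (- (1 - r))"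
    proof (intro always_eventually allI)
      fix n
      have "norm (G (real n + 1)) \<le> c * (real n + 1) powr r * (K * (K / (real n + 1 + 1)))"
        by (rule nG) simp
      also have "\<dots> \<le> c * (real n + 1) powr r * (K * (K / (real n + 1)))"
        using c K_nonneg by (intro mult_left_mono divide_left_mono) auto
      finally show "norm (G (real n + 1)) \<le> c * (K * K) * (real n + 1) powr (- (1 - r))"
        by (simp add: powr_diff mult_ac)
    qed
    show "(\<lambda>n. c * (K * K) * (real n + 1) powr (- (1 - r))) \<longlonglongrightarrow> 0" by (rule pow) (use r in simp)
  qed
  have i1: "has_strong_integral half_line g (0 - 0)"
    by (rule strong_FTC[OF dG cg fin L0 L1])
  have i2: "has_strong_integral half_line (\<lambda>s. (1 - r) *\<^sub>R (Q t o\<^sub>L (weight r s *\<^sub>R Q (s + t)))) ((1 - r) *\<^sub>R (Q t o\<^sub>L W r t))"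
    by (intro has_strong_integral_bounded_linear[OF has_strong_integral_bounded_linear[OF W_integral[OF r t] comp_linear_right]] bounded_linear_scaleR_right)
  have e: "(\<lambda>s. g s + (1 - r) *\<^sub>R (Q t o\<^sub>L (weight r s *\<^sub>R Q (s + t)))) = (\<lambda>s. weight r s *\<^sub>R (Q (s + t) o\<^sub>L Q (s + t)))"
    by (simp add: g_def)
  have "(\<lambda>s. weight r s *\<^sub>R (Q (s + t) o\<^sub>L Q (s + t))) \<in> borel_measurable half_line"
    by (intro continuous_borel_half_line continuous_intros weight_cont comp_continuous Q_cont_shift t)
  then show ?thesis
    using has_strong_integral_add[OF i1 i2] by (simp add: e)
qed

text \<open>
  Formally \<open>d/dt (t + A)\<^sup>r\<^sup>-\<^sup>1 = -(1 - r) (t + A)\<inverse> (t + A)\<^sup>r\<^sup>-\<^sup>1\<close>. The difference quotient of \<open>Q\<close> differs from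
  \<open>-Q\<^sup>2\<close> by \<open>(u - t)\<close> times a product of three resolvents, which is integrable against the weight.
\<close>

lemma W_deriv:
  assumes r: "0 < r" "r < 1" and t: "0 \<le> t"
  shows "(W r has_vector_derivative - ((1 - r) *\<^sub>R (Q t o\<^sub>L W r t))) (at t within {0..})"
proof (rule has_vector_derivativeI_quotient, rule LIM_zero_cancel, rule Lim_null_comparison)
  let ?V = "(1 - r) *\<^sub>R (Q t o\<^sub>L W r t)"
  have "\<forall>\<^sub>F u in at t within {0..}. u \<in> {0..} \<and> u \<noteq> t" by (simp add: eventually_at_filter)
  then show "\<forall>\<^sub>F u in at t within {0..}. norm ((1 / (u - t)) *\<^sub>R (W r u - W r t) - - ?V) \<le> \<bar>u - t\<bar> * (K * K * K)"
  proof eventually_elim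
    case (elim u)
    let ?h = "\<lambda>s. (1 / (u - t)) *\<^sub>R (weight r s *\<^sub>R Q (s + u) - weight r s *\<^sub>R Q (s + t)) + weight r s *\<^sub>R (Q (s + t) o\<^sub>L Q (s + t))"
    have u: "0 \<le> u" using elim by simp
    have cts: "continuous_on {0<..} (\<lambda>s. weight r s *\<^sub>R Q (s + u) - weight r s *\<^sub>R Q (s + t))"
      by (intro continuous_intros weight_cont Q_cont_shift t u)
    have "has_strong_integral half_line ?h ((1 / (u - t)) *\<^sub>R (W r u - W r t) + ?V)"
    proof (rule has_strong_integral_add[OF has_strong_integral_bounded_linear[OF _ bounded_linear_scaleR_right] square_integral[OF r t]])
      show "has_strong_integral half_line (\<lambda>s. weight r s *\<^sub>R Q (s + u) - weight r s *\<^sub>R Q (s + t)) (W r u - W r t)"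
        by (intro has_strong_integral_diff W_integral r t u continuous_borel_half_line cts)
      show "?h \<in> borel_measurable half_line"
        by (intro continuous_borel_half_line continuous_intros cts weight_cont comp_continuous Q_cont_shift t)
    qed
    moreover have "norm (?h s) \<le> (\<bar>u - t\<bar> * (K * K * K)) * (sin (pi * r) / pi * s powr (r - 1) / (s + 1))" if s: "0 < s" for s
    proof -
      let ?Y = "(u - t) *\<^sub>R ((Q (s + t) o\<^sub>L Q (s + u)) o\<^sub>L Q (s + t))"
      have 1: "(1 / (u - t)) *\<^sub>R (Q (s + u) - Q (s + t)) = - (Q (s + u) o\<^sub>L Q (s + t))"
      proof -
        have "Q (s + u) - Q (s + t) = (t - u) *\<^sub>R (Q (s + u) o\<^sub>L Q (s + t))"
          using resolvent[of "s + u" "s + t"] s t u by simp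
        then have "(1 / (u - t)) *\<^sub>R (Q (s + u) - Q (s + t)) = ((t - u) / (u - t)) *\<^sub>R (Q (s + u) o\<^sub>L Q (s + t))" by simp
        also have "(t - u) / (u - t) = -1" using elim by (simp add: field_simps)
        finally show ?thesis by simp
      qed
      have 2: "Q (s + t) - Q (s + u) = (u - t) *\<^sub>R (Q (s + t) o\<^sub>L Q (s + u))"
        using resolvent[of "s + t" "s + u"] s t u by simp
      have "?h s = weight r s *\<^sub>R ((1 / (u - t)) *\<^sub>R (Q (s + u) - Q (s + t)) + (Q (s + t) o\<^sub>L Q (s + t)))"
        by (simp add: scaleR_add_right scaleR_diff_right mult.commute)
      also have "(1 / (u - t)) *\<^sub>R (Q (s + u) - Q (s + t)) + (Q (s + t) o\<^sub>L Q (s + t)) = (Q (s + t) - Q (s + u)) o\<^sub>L Q (s + t)"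
        unfolding 1 by (simp add: comp_diff)
      also have "\<dots> = ?Y" unfolding 2 by (simp add: comp_scaleR)
      finally have h: "?h s = weight r s *\<^sub>R ?Y" .
      have "norm ?Y \<le> \<bar>u - t\<bar> * (K * K * (K / (s + 1)))"
        unfolding norm_scaleR real_norm_def using s t u
        by (intro mult_left_mono norm_comp norm_Q_le shift_bound) auto
      then have "norm ?Y \<le> \<bar>u - t\<bar> * (K * K * K) / (s + 1)" by simp
      from weight_norm[OF r this] show ?thesis unfolding h .
    qed
    ultimately have "norm ((1 / (u - t)) *\<^sub>R (W r u - W r t) + ?V) \<le> (\<bar>u - t\<bar> * (K * K * K)) * 1 powr (r - 1)"
      using K_nonneg by (intro stieltjes_integral_bound[OF r]) auto
    then show ?case by simp
  qed
  have "((\<lambda>u. \<bar>u - t\<bar> * (K * K * K)) \<longlongrightarrow> \<bar>t - t\<bar> * (K * K * K)) (at t within {0..})"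
    by (intro tendsto_intros)
  then show "((\<lambda>u. \<bar>u - t\<bar> * (K * K * K)) \<longlongrightarrow> 0) (at t within {0..})" by simp
qed

text \<open>
  Since \<open>Q(0) Q(s + t) = (Q(0) - Q(s + t))/(s + t)\<close>, the main part of \<open>Q(0) W\<^sub>r(t)\<close> is \<open>Q(0)\<close> times the
  scalar integral with value \<open>t\<^sup>r\<^sup>-\<^sup>1\<close>.
\<close>

lemma W_asymp:
  assumes r: "0 < r" "r < 1" and t: "0 < t"
  shows "norm (t powr (1 - r) *\<^sub>R (Q 0 o\<^sub>L W r t) - Q 0) \<le> K / (1 + t)"
proof -
  have wr: "has_bochner_integral half_line (\<lambda>s. weight r s / (s + t)) (t powr (r - 1))"
  proof -
    have "(\<integral>\<^sup>+ s. ennreal (weight r s / (s + t)) \<partial>half_line) = (\<integral>\<^sup>+ s. ennreal (sin (pi * r) / pi) * ennreal (s powr (r - 1) / (s + t)) \<partial>half_line)"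
      using sin_pi_pos[OF r] t by (intro nn_integral_cong) (auto simp: weight_def space_half_line simp flip: ennreal_mult')
    also have "\<dots> = ennreal (sin (pi * r) / pi) * ennreal (pi / sin (pi * r) * t powr (r - 1))"
      by (subst nn_integral_cmult) (auto simp: nn_integral_stieltjes[OF r t] intro!: measurable_restrict_space1)
    also have "\<dots> = ennreal (t powr (r - 1))"
      using sin_pi_pos[OF r] by (simp add: ennreal_mult'[symmetric])
    finally have "(\<integral>\<^sup>+ s. ennreal (weight r s / (s + t)) \<partial>half_line) = ennreal (t powr (r - 1))" .
    then show ?thesis
      using weight_nonneg[OF r] t
      by (intro has_bochner_integral_nn_integral)
        (auto intro!: AE_I2 divide_nonneg_pos continuous_borel_half_line continuous_intros weight_cont simp: space_half_line)
  qed
  have 1: "has_strong_integral half_line (\<lambda>s. (weight r s / (s + t)) *\<^sub>R Q 0) (t powr (r - 1) *\<^sub>R Q 0)"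
    by (rule has_strong_integral_bounded_linear[OF _ bounded_linear_scaleR_left]) (simp add: has_strong_integral_eq_has_bochner_integral wr)
  have 2: "has_strong_integral half_line (\<lambda>s. Q 0 o\<^sub>L (weight r s *\<^sub>R Q (s + t))) (Q 0 o\<^sub>L W r t)"
    using t by (intro has_strong_integral_bounded_linear[OF W_integral[OF r] comp_linear_right]) simp
  have m: "(\<lambda>s. (Q 0 o\<^sub>L (weight r s *\<^sub>R Q (s + t))) - (weight r s / (s + t)) *\<^sub>R Q 0) \<in> borel_measurable half_line"
    using t by (intro continuous_borel_half_line continuous_intros weight_cont comp_continuous Q_cont_shift) auto
  have n: "norm ((Q 0 o\<^sub>L (weight r s *\<^sub>R Q (s + t))) - (weight r s / (s + t)) *\<^sub>R Q 0) \<le> (K / (1 + t)) * (sin (pi * r) / pi * s powr (r - 1) / (s + t))" if s: "0 < s" for s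
  proof -
    have "Q 0 o\<^sub>L Q (s + t) = (1 / (s + t)) *\<^sub>R (Q 0 - Q (s + t))"
      using resolvent[of 0 "s + t", symmetric] s t by simp
    then have "(Q 0 o\<^sub>L (weight r s *\<^sub>R Q (s + t))) - (weight r s / (s + t)) *\<^sub>R Q 0 = weight r s *\<^sub>R (- ((1 / (s + t)) *\<^sub>R Q (s + t)))"
      by (simp add: comp_scaleR scaleR_diff_right)
    moreover have "norm (- ((1 / (s + t)) *\<^sub>R Q (s + t))) \<le> (K / (1 + t)) / (s + t)"
    proof -
      have "norm (Q (s + t)) \<le> K / (1 + (s + t))" using s t by (intro bound) auto
      also have "\<dots> \<le> K / (1 + t)" using s t K_nonneg by (intro divide_left_mono mult_pos_pos) auto
      finally have "norm (Q (s + t)) / (s + t) \<le> (K / (1 + t)) / (s + t)"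
        using s t by (intro divide_right_mono) auto
      then show ?thesis using s t by simp
    qed
    ultimately show ?thesis by (simp only: weight_norm[OF r])
  qed
  have "norm ((Q 0 o\<^sub>L W r t) - t powr (r - 1) *\<^sub>R Q 0) \<le> K / (1 + t) * t powr (r - 1)"
    using t K_nonneg by (intro stieltjes_integral_bound[OF r t _ n has_strong_integral_diff[OF 2 1 m]]) auto
  then have "t powr (1 - r) * norm ((Q 0 o\<^sub>L W r t) - t powr (r - 1) *\<^sub>R Q 0) \<le> t powr (1 - r) * (K / (1 + t) * t powr (r - 1))"
    by (rule mult_left_mono) simp
  also have "\<dots> = K / (1 + t)" using t by (simp add: powr_add[symmetric] mult.commute mult.left_commute)
  also have "t powr (1 - r) * norm ((Q 0 o\<^sub>L W r t) - t powr (r - 1) *\<^sub>R Q 0) = norm (t powr (1 - r) *\<^sub>R ((Q 0 o\<^sub>L W r t) - t powr (r - 1) *\<^sub>R Q 0))"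
    by simp
  also have "t powr (1 - r) *\<^sub>R ((Q 0 o\<^sub>L W r t) - t powr (r - 1) *\<^sub>R Q 0) = t powr (1 - r) *\<^sub>R (Q 0 o\<^sub>L W r t) - Q 0"
    using t by (simp add: scaleR_diff_right powr_add[symmetric])
  finally show ?thesis .
qed

lemma W_asymp_tendsto:
  assumes r: "0 < r" "r < 1"
  shows "((\<lambda>t. t powr (1 - r) *\<^sub>R (Q 0 o\<^sub>L W r t)) \<longlongrightarrow> Q 0) at_top"
proof (rule LIM_zero_cancel, rule Lim_null_comparison)
  show "\<forall>\<^sub>F t in at_top. norm (t powr (1 - r) *\<^sub>R (Q 0 o\<^sub>L W r t) - Q 0) \<le> K / (1 + t)"
    using eventually_gt_at_top[of 0] by eventually_elim (rule W_asymp[OF r])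
  show "((\<lambda>t. K / (1 + t)) \<longlongrightarrow> 0) at_top"
    by (intro tendsto_divide_0[OF tendsto_const] filterlim_at_top_imp_at_infinity
        filterlim_tendsto_add_at_top[OF tendsto_const] filterlim_ident)
qed

text \<open>
  Let \<open>P(t) = W\<^sub>r(t) W\<^sub>1\<^sub>-\<^sub>r(t)\<close>. Then \<open>P' = -Q(t) P\<close>, so \<open>X(t) = P(t) + t Q(0) P(t)\<close> is constant because
  \<open>Q(0) - Q(t) - t Q(0) Q(t) = 0\<close>. The asymptotics of \<open>W\<close> hold only after multiplication with \<open>Q(0)\<close>,
  which is the origin of the two additional factors \<open>Q(0)\<close> in the statement; they cancel
  when \<open>Q(0)\<close> is injective.
\<close>

lemma W_law:
  assumes r: "0 < r" "r < 1"
  shows "Q 0 o\<^sub>L (Q 0 o\<^sub>L (W r 0 o\<^sub>L W (1 - r) 0)) = Q 0 o\<^sub>L (Q 0 o\<^sub>L Q 0)"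
proof -
  have r': "0 < 1 - r" "1 - r < 1" using r by auto
  define P where "P = (\<lambda>t. W r t o\<^sub>L W (1 - r) t)"
  define X where "X = (\<lambda>t. P t + t *\<^sub>R (Q 0 o\<^sub>L P t))"
  have QW: "Q u o\<^sub>L W q t = W q t o\<^sub>L Q u" if "0 < q" "q < 1" "0 \<le> t" "0 \<le> u" for q t u
    using that by (intro W_commute commute) auto
  have dP: "(P has_vector_derivative - (Q t o\<^sub>L P t)) (at t within {0..})" if t: "0 \<le> t" for t
  proof -
    have "(P has_vector_derivative (W r t o\<^sub>L - ((1 - (1 - r)) *\<^sub>R (Q t o\<^sub>L W (1 - r) t))) + (- ((1 - r) *\<^sub>R (Q t o\<^sub>L W r t)) o\<^sub>L W (1 - r) t)) (at t within {0..})"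
      unfolding P_def by (rule bounded_bilinear.has_vector_derivative[OF bounded_bilinear_blinfun_compose W_deriv[OF r t] W_deriv[OF r' t]])
    also have "(W r t o\<^sub>L - ((1 - (1 - r)) *\<^sub>R (Q t o\<^sub>L W (1 - r) t))) + (- ((1 - r) *\<^sub>R (Q t o\<^sub>L W r t)) o\<^sub>L W (1 - r) t)
       = - (r *\<^sub>R ((W r t o\<^sub>L Q t) o\<^sub>L W (1 - r) t) + (1 - r) *\<^sub>R ((Q t o\<^sub>L W r t) o\<^sub>L W (1 - r) t))"
      by (simp add: comp_minus comp_scaleR blinfun_compose_assoc)
    also have "\<dots> = - (Q t o\<^sub>L P t)"
      using QW[OF r t t] by (simp add: P_def blinfun_compose_assoc[symmetric] scaleR_left_distrib[symmetric])
    finally show ?thesis .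
  qed
  have dX: "(X has_vector_derivative 0) (at t within {0..})" if t: "t \<in> {0..}" for t
  proof -
    have t0: "0 \<le> t" using t by simp
    have "(X has_vector_derivative - (Q t o\<^sub>L P t) + (t *\<^sub>R (Q 0 o\<^sub>L - (Q t o\<^sub>L P t)) + 1 *\<^sub>R (Q 0 o\<^sub>L P t))) (at t within {0..})"
      unfolding X_def
      by (intro has_vector_derivative_add dP[OF t0] has_vector_derivative_scaleR DERIV_ident bounded_linear.has_vector_derivative[OF comp_linear_right])
    also have "- (Q t o\<^sub>L P t) + (t *\<^sub>R (Q 0 o\<^sub>L - (Q t o\<^sub>L P t)) + 1 *\<^sub>R (Q 0 o\<^sub>L P t)) = (Q 0 - Q t - t *\<^sub>R (Q 0 o\<^sub>L Q t)) o\<^sub>L P t"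
      by (simp add: comp_diff comp_scaleR comp_minus blinfun_compose_assoc)
    also have "Q 0 - Q t - t *\<^sub>R (Q 0 o\<^sub>L Q t) = 0" using resolvent[of 0 t] t0 by simp
    finally show ?thesis by (simp add: bounded_bilinear.zero_left[OF bounded_bilinear_blinfun_compose])
  qed
  obtain C where C: "\<And>t. 0 \<le> t \<Longrightarrow> X t = C"
    using has_vector_derivative_zero_constant[OF _ dX] by (auto simp: convex_real_interval)
  then have X: "X t = P 0" if "0 \<le> t" for t using that C[of 0] by (simp add: X_def)
  let ?a = "\<lambda>t. t powr (1 - r) *\<^sub>R (Q 0 o\<^sub>L W r t)" and ?b = "\<lambda>t. t powr (1 - (1 - r)) *\<^sub>R (Q 0 o\<^sub>L W (1 - r) t)"
  have lim: "((\<lambda>t. ?a t o\<^sub>L ?b t) \<longlongrightarrow> Q 0 o\<^sub>L Q 0) at_top"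
    by (intro comp_tendsto W_asymp_tendsto r r')
  have ab: "?a t o\<^sub>L ?b t = t *\<^sub>R (Q 0 o\<^sub>L (Q 0 o\<^sub>L P t))" if t: "0 < t" for t
  proof -
    have "?a t o\<^sub>L ?b t = (t powr (1 - r) * t powr r) *\<^sub>R ((Q 0 o\<^sub>L W r t) o\<^sub>L (Q 0 o\<^sub>L W (1 - r) t))"
      by (simp add: comp_scaleR mult.commute)
    also have "t powr (1 - r) * t powr r = t" using t by (simp add: powr_add[symmetric])
    also have "(Q 0 o\<^sub>L W r t) o\<^sub>L (Q 0 o\<^sub>L W (1 - r) t) = Q 0 o\<^sub>L ((W r t o\<^sub>L Q 0) o\<^sub>L W (1 - r) t)"
      by (simp add: blinfun_compose_assoc)
    also have "\<dots> = Q 0 o\<^sub>L (Q 0 o\<^sub>L P t)"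
      using QW[OF r, of t 0] t by (simp add: P_def blinfun_compose_assoc[symmetric])
    finally show ?thesis .
  qed
  have "((\<lambda>t. (1 / t) *\<^sub>R (?a t o\<^sub>L ?b t) + (Q 0 o\<^sub>L (?a t o\<^sub>L ?b t))) \<longlongrightarrow> 0 *\<^sub>R (Q 0 o\<^sub>L Q 0) + (Q 0 o\<^sub>L (Q 0 o\<^sub>L Q 0))) at_top"
    by (intro tendsto_add tendsto_scaleR lim comp_tendsto[OF tendsto_const lim] tendsto_divide_0[OF tendsto_const]
        filterlim_at_top_imp_at_infinity filterlim_ident)
  moreover have "\<forall>\<^sub>F t in at_top. (1 / t) *\<^sub>R (?a t o\<^sub>L ?b t) + (Q 0 o\<^sub>L (?a t o\<^sub>L ?b t)) = Q 0 o\<^sub>L (Q 0 o\<^sub>L P 0)"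
    using eventually_gt_at_top[of 0]
  proof eventually_elim
    case (elim t)
    have "(1 / t) *\<^sub>R (?a t o\<^sub>L ?b t) + (Q 0 o\<^sub>L (?a t o\<^sub>L ?b t)) = Q 0 o\<^sub>L (Q 0 o\<^sub>L X t)"
      unfolding ab[OF elim] X_def using elim by (simp add: comp_add comp_scaleR)
    then show ?case using X[of t] elim by simp
  qed
  ultimately have "((\<lambda>t::real. Q 0 o\<^sub>L (Q 0 o\<^sub>L P 0)) \<longlongrightarrow> 0 *\<^sub>R (Q 0 o\<^sub>L Q 0) + (Q 0 o\<^sub>L (Q 0 o\<^sub>L Q 0))) at_top"
    by (rule Lim_transform_eventually)
  note tendsto_unique[OF trivial_limit_at_top_linorder tendsto_const this]
  then have "Q 0 o\<^sub>L (Q 0 o\<^sub>L P 0) = 0 *\<^sub>R (Q 0 o\<^sub>L Q 0) + (Q 0 o\<^sub>L (Q 0 o\<^sub>L Q 0))"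
    by simp
  then show ?thesis by (simp add: P_def)
qed

end

section \<open>The lower bound for bounded complete Bernstein functions\<close>

context bounded_semigroup begin

text \<open>
  The resolvent \<open>(s + B(A))\<inverse>\<close>, expressed by that of \<open>A\<close> at \<open>s/(s + 1)\<close>.
\<close>

definition B_res :: "real \<Rightarrow> 'a \<Rightarrow>\<^sub>L 'a"
  where "B_res s = (1 / (s + 1)) *\<^sub>R (id_blinfun + (1 / (s + 1)) *\<^sub>R R (s / (s + 1)))"

lemma shift_inv_B:
  assumes s: "0 < s"
  shows "shift_inv s (bop (D 1)) = bop (B_res s)"
    and "B_res s o\<^sub>L D 1 = (1 / (s + 1)) *\<^sub>R D (s / (s + 1))"
proof -
  define \<sigma> where "\<sigma> = s / (s + 1)"
  have \<sigma>: "0 < \<sigma>" "1 - \<sigma> = 1 / (s + 1)"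
  proof -
    show "0 < \<sigma>" using s by (simp add: \<sigma>_def)
    have "1 - \<sigma> = ((s + 1) - s) / (s + 1)" unfolding diff_divide_distrib using s by (simp add: \<sigma>_def)
    then show "1 - \<sigma> = 1 / (s + 1)" by simp
  qed
  have res: "(1 / (s + 1)) *\<^sub>R R \<sigma> (R 1 w) = R \<sigma> w - R 1 w" for w
    using R_resolvent[OF \<sigma>(1), of 1 w] by (simp add: \<sigma>)
  have com: "R 1 (R \<sigma> w) = R \<sigma> (R 1 w)" for w
    by (rule R_commute) (use \<sigma> in auto)
  have Z: "B_res s w = (1 / (s + 1)) *\<^sub>R (w + (1 / (s + 1)) *\<^sub>R R \<sigma> w)" for w
    by (simp add: B_res_def \<sigma>_def blinfun.add_left blinfun.scaleR_left)
  have ZD: "B_res s (D 1 w) = (1 / (s + 1)) *\<^sub>R D \<sigma> w" for w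
  proof -
    have "(1 / (s + 1)) *\<^sub>R R \<sigma> (D 1 w) = (1 / (s + 1)) *\<^sub>R R \<sigma> w - (R \<sigma> w - R 1 w)"
      by (simp add: D_apply blinfun.diff_right scaleR_diff_right res)
    then have "D 1 w + (1 / (s + 1)) *\<^sub>R R \<sigma> (D 1 w) = w - (1 - 1 / (s + 1)) *\<^sub>R R \<sigma> w"
      by (simp add: D_apply algebra_simps)
    also have "1 - 1 / (s + 1) = \<sigma>" using \<sigma> by simp
    finally show ?thesis unfolding Z by (simp add: D_apply)
  qed
  show "B_res s o\<^sub>L D 1 = (1 / (s + 1)) *\<^sub>R D (s / (s + 1))"
    by (rule blinfun_eqI) (simp only: blinfun_apply_blinfun_compose ZD \<sigma>_def[symmetric] blinfun.scaleR_left)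
  have left: "B_res s (s *\<^sub>R x + D 1 x) = x" for x
  proof -
    have "B_res s (s *\<^sub>R x + D 1 x) = s *\<^sub>R B_res s x + B_res s (D 1 x)"
      by (simp only: blinfun.add_right blinfun.scaleR_right)
    also have "\<dots> = (1 / (s + 1)) *\<^sub>R (s *\<^sub>R x + (s / (s + 1)) *\<^sub>R R \<sigma> x + D \<sigma> x)"
      unfolding ZD unfolding Z by (simp add: scaleR_add_right mult.commute)
    also have "s *\<^sub>R x + (s / (s + 1)) *\<^sub>R R \<sigma> x + D \<sigma> x = (s + 1) *\<^sub>R x"
      unfolding \<sigma>_def[symmetric] by (simp add: D_apply algebra_simps)
    finally show ?thesis using s by simp
  qed
  have right: "s *\<^sub>R B_res s w + D 1 (B_res s w) = w" for w
  proof -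
    have "D 1 (B_res s w) = B_res s (D 1 w)"
      unfolding Z by (simp add: D_apply blinfun.diff_right blinfun.add_right blinfun.scaleR_right com)
    then have "s *\<^sub>R B_res s w + D 1 (B_res s w) = B_res s (s *\<^sub>R w + D 1 w)"
      by (simp only: blinfun.add_right blinfun.scaleR_right)
    then show ?thesis by (simp only: left)
  qed
  show "shift_inv s (bop (D 1)) = bop (B_res s)"
    by (rule shift_inv_bop[OF left right])
qed

text \<open>
  For the bounded operator \<open>B(A)\<close> the integral converges on the whole space, so that the closure in the
  definition adds nothing.
\<close>

lemma balakrishnan_B:
  assumes r: "0 < r" "r < 1"
  shows "\<exists>J. balakrishnan (bop (D 1)) r = bop J \<and> (\<forall>Q. (\<forall>s>0. Q o\<^sub>L R s = R s o\<^sub>L Q) \<longrightarrow> Q o\<^sub>L J = J o\<^sub>L Q)"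
proof -
  define g where "g = (\<lambda>s. weight r s *\<^sub>R ((1 / (s + 1)) *\<^sub>R D (s / (s + 1))))"
  have "\<exists>J. has_strong_integral half_line g J"
  proof (rule stieltjes_integral_exists[OF r, where t=1 and C="1 + M"])
    have "continuous_on {0<..} (\<lambda>s. D (s / (s + 1)))"
      by (rule continuous_on_compose2[OF D_cont]) (auto intro!: continuous_intros divide_pos_pos simp: add_pos_pos)
    then show "continuous_on {0<..} g"
      unfolding g_def by (intro continuous_intros weight_cont) auto
    show "norm (g s) \<le> (1 + M) * (sin (pi * r) / pi * s powr (r - 1) / (s + 1))" if s: "0 < s" for s
      unfolding g_def
    proof (rule weight_norm[OF r])
      show "norm ((1 / (s + 1)) *\<^sub>R D (s / (s + 1))) \<le> (1 + M) / (s + 1)"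
        using norm_D[of "s / (s + 1)"] s by (simp add: divide_right_mono)
    qed
  qed (use M_ge_1 in auto)
  then obtain J where J: "has_strong_integral half_line g J" by (elim exE)
  have app: "has_strong_integral half_line (\<lambda>s. weight r s *\<^sub>R app (shift_inv s (bop (D 1))) (D 1 x)) z \<longleftrightarrow> z = J x" for x z
  proof (rule has_strong_integral_apply_iff[OF J])
    fix s assume "s \<in> space half_line"
    then have s: "0 < s" by (simp add: space_half_line)
    show "weight r s *\<^sub>R app (shift_inv s (bop (D 1))) (D 1 x) = g s x"
      using arg_cong[OF shift_inv_B(2)[OF s], of "\<lambda>P. blinfun_apply P x"]
      by (simp only: g_def shift_inv_B(1)[OF s] app_bop blinfun_apply_blinfun_compose blinfun.scaleR_left)
  qed
  have "balakrishnan (bop (D 1)) r = closure {(x, J x) | x. x \<in> UNIV}"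
    unfolding balakrishnan_def bop_mem weight_def[symmetric]
    by (rule arg_cong[where f=closure]) (auto simp: app)
  also have "\<dots> = bop J" by (rule closure_graph) simp
  finally have "balakrishnan (bop (D 1)) r = bop J" .
  moreover have "Q o\<^sub>L J = J o\<^sub>L Q" if Q: "\<forall>s>0. Q o\<^sub>L R s = R s o\<^sub>L Q" for Q
  proof (rule has_strong_integral_commute[OF J])
    fix s assume "s \<in> space half_line"
    then have "0 < s / (s + 1)" by (simp add: space_half_line)
    then show "Q o\<^sub>L g s = g s o\<^sub>L Q"
      using D_commute[of Q "s / (s + 1)"] Q by (simp add: g_def comp_scaleR)
  qed
  ultimately show ?thesis by blast
qed

text \<open>
  Passing from \<open>\<gamma>\<close> to \<open>\<gamma> + 1\<close> changes the integer part only.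
\<close>

lemma frac_pow_B:
  assumes \<gamma>: "0 < \<gamma>"
  shows "\<exists>P. frac_pow (B_op A) \<gamma> = bop P \<and> frac_pow (B_op A) (\<gamma> + 1) = bop (D 1 o\<^sub>L P) \<and>
    (\<forall>Q. (\<forall>s>0. Q o\<^sub>L R s = R s o\<^sub>L Q) \<longrightarrow> Q o\<^sub>L P = P o\<^sub>L Q)"
proof -
  define n where "n = nat \<lfloor>\<gamma>\<rfloor>"
  have "\<exists>J. (if frac \<gamma> = 0 then Id else balakrishnan (bop (D 1)) (frac \<gamma>)) = bop J \<and> (\<forall>Q. (\<forall>s>0. Q o\<^sub>L R s = R s o\<^sub>L Q) \<longrightarrow> Q o\<^sub>L J = J o\<^sub>L Q)"
  proof (cases "frac \<gamma> = 0")
    case True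
    then show ?thesis by (intro exI[of _ id_blinfun]) (simp add: bop_id blinfun_compose_id)
  next
    case False
    then have "0 < frac \<gamma>" "frac \<gamma> < 1" using frac_ge_0[of \<gamma>] frac_lt_1[of \<gamma>] by linarith+
    from balakrishnan_B[OF this] False show ?thesis by simp
  qed
  then obtain J where J: "(if frac \<gamma> = 0 then Id else balakrishnan (bop (D 1)) (frac \<gamma>)) = bop J"
    and Jc: "\<And>Q. \<forall>s>0. Q o\<^sub>L R s = R s o\<^sub>L Q \<Longrightarrow> Q o\<^sub>L J = J o\<^sub>L Q" by blast
  let ?P = "blinfun_power (D 1) n o\<^sub>L J"
  have "\<lfloor>\<gamma> + 1\<rfloor> = \<lfloor>\<gamma>\<rfloor> + 1" by simp
  then have "nat \<lfloor>\<gamma> + 1\<rfloor> = Suc n" using \<gamma> by (simp add: n_def nat_add_distrib)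
  moreover have "frac (\<gamma> + 1) = frac \<gamma>" by (simp add: frac_def)
  ultimately have "frac_pow (B_op A) (\<gamma> + 1) = bop (blinfun_power (D 1) (Suc n) o\<^sub>L J)"
    using \<gamma> by (simp only: frac_pow_def frac_pow_nonneg_def B_op_A J bop_relpow bop_comp) simp
  moreover have "frac_pow (B_op A) \<gamma> = bop ?P"
    using \<gamma> by (simp only: frac_pow_def frac_pow_nonneg_def B_op_A J bop_relpow bop_comp n_def) simp
  moreover have "Q o\<^sub>L ?P = ?P o\<^sub>L Q" if Q: "\<forall>s>0. Q o\<^sub>L R s = R s o\<^sub>L Q" for Q
  proof -
    have "Q o\<^sub>L D 1 = D 1 o\<^sub>L Q" using Q by (intro D_commute) simp
    then have "(Q o\<^sub>L blinfun_power (D 1) n) o\<^sub>L J = (blinfun_power (D 1) n o\<^sub>L Q) o\<^sub>L J"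
      by (simp add: blinfun_power_commute)
    then show ?thesis by (simp add: blinfun_compose_assoc Jc[OF Q])
  qed
  ultimately show ?thesis by (intro exI[of _ ?P]) (simp add: blinfun_compose_assoc)
qed

text \<open>
  If \<open>\<tau> = \<parallel>T(t\<^sub>2) B(A)\<parallel>\<close> vanishes, so does the right-hand side, by the convention for division by zero.
\<close>

lemma lower_bound_bounded:
  assumes f: "complete_bernstein f" and bd: "bounded (f ` {0<..})" and \<gamma>: "0 < \<gamma>"
    and t: "0 \<le> t1" "0 \<le> t2"
  shows "op_norm (bop (T t1) \<odot> frac_pow (B_op A) \<gamma> \<odot> cbf_op f A) \<ge>
    1 / (2 * M * (1 + M * M)) * (op_norm (bop (T (t1 + t2)) \<odot> frac_pow (B_op A) (\<gamma> + 1)) / op_norm (bop (T t2) \<odot> B_op A))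
       * f (op_norm (bop (T t2) \<odot> B_op A))"
proof -
  obtain F where F: "cbf_op f A = bop F" and Fb: "\<And>\<tau> z. 0 < \<tau> \<Longrightarrow> f \<tau> * norm (D \<tau> z) \<le> 2 * M * norm (F z)"
    and Fc: "\<And>Q. \<forall>s>0. Q o\<^sub>L R s = R s o\<^sub>L Q \<Longrightarrow> Q o\<^sub>L F = F o\<^sub>L Q"
    using cbf_op_bounded[OF f bd] by blast
  obtain P where P: "frac_pow (B_op A) \<gamma> = bop P" "frac_pow (B_op A) (\<gamma> + 1) = bop (D 1 o\<^sub>L P)"
    and Pc: "\<And>Q. \<forall>s>0. Q o\<^sub>L R s = R s o\<^sub>L Q \<Longrightarrow> Q o\<^sub>L P = P o\<^sub>L Q"
    using frac_pow_B[OF \<gamma>] by blast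
  define \<tau> where "\<tau> = norm (T t2 o\<^sub>L D 1)"
  have Tc: "\<forall>s>0. T t o\<^sub>L R s = R s o\<^sub>L T t" if "0 \<le> t" for t
    using that by (auto intro!: blinfun_eqI simp: R_T)
  have Rc: "\<forall>s>0. R s' o\<^sub>L R s = R s o\<^sub>L R s'" if "0 < s'" for s'
    using that by (auto intro!: blinfun_eqI simp: R_commute)
  have FP: "P o\<^sub>L F = F o\<^sub>L P"
    by (rule Fc) (use Pc[OF Rc] in auto)
  show ?thesis
  proof (cases "\<tau> = 0")
    case True
    then show ?thesis unfolding P F unfolding B_op_A bop_comp op_norm_bop \<tau>_def by simp
  next
    case False
    then have \<tau>: "0 < \<tau>" by (simp add: \<tau>_def)
    obtain p where "cbf_triple f p" using f by (auto simp: complete_bernstein_def)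
    then have f0: "0 \<le> f \<tau>" using cbf_nonneg(1)[OF _ \<tau>] by (cases p) auto
    have key: "norm (T t2 (D 1 z)) \<le> \<tau> * (1 + M * M) * norm (D \<tau> z)" for z
    proof -
      have res: "(\<tau> - 1) *\<^sub>R R 1 (R \<tau> z) = R 1 z - R \<tau> z" by (rule R_resolvent) (use \<tau> in auto)
      have "\<tau> *\<^sub>R R 1 (D \<tau> z) + D 1 (D \<tau> z) = z + (\<tau> - 1) *\<^sub>R R 1 z - \<tau> *\<^sub>R R \<tau> z - \<tau> *\<^sub>R ((\<tau> - 1) *\<^sub>R R 1 (R \<tau> z))"
        by (simp add: D_apply blinfun.diff_right blinfun.scaleR_right algebra_simps)
      also have "\<dots> = D 1 z" unfolding res by (simp add: D_apply algebra_simps)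
      finally have "T t2 (D 1 z) = \<tau> *\<^sub>R T t2 (R 1 (D \<tau> z)) + (T t2 o\<^sub>L D 1) (D \<tau> z)"
        by (simp flip: blinfun.scaleR_right blinfun.add_right)
      also have "norm \<dots> \<le> \<tau> * (M * (M * norm (D \<tau> z))) + \<tau> * norm (D \<tau> z)"
      proof (rule norm_triangle_le, rule add_mono)
        have "norm (T t2 (R 1 (D \<tau> z))) \<le> M * norm (R 1 (D \<tau> z))" by (rule T_norm[OF t(2)])
        also have "\<dots> \<le> M * (M * norm (D \<tau> z))" using R_norm[of 1 "D \<tau> z"] M_ge_1 by (intro mult_left_mono) auto
        finally show "norm (\<tau> *\<^sub>R T t2 (R 1 (D \<tau> z))) \<le> \<tau> * (M * (M * norm (D \<tau> z)))" using \<tau> by simp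
        show "norm ((T t2 o\<^sub>L D 1) (D \<tau> z)) \<le> \<tau> * norm (D \<tau> z)" unfolding \<tau>_def by (rule norm_blinfun)
      qed
      finally show ?thesis by (simp add: algebra_simps)
    qed
    have main: "f \<tau> * norm (T (t1 + t2) (D 1 (P x))) \<le> 2 * M * (1 + M * M) * \<tau> * norm (T t1 o\<^sub>L (P o\<^sub>L F)) * norm x" for x
    proof -
      let ?z = "T t1 (P x)"
      have "T (t1 + t2) (D 1 (P x)) = T t2 (T t1 (D 1 (P x)))"
        using t by (simp add: T_T add.commute)
      also have "T t1 (D 1 (P x)) = D 1 ?z"
        using R_T[of 1 t1 "P x"] t by (simp add: D_apply blinfun.diff_right)
      finally have "f \<tau> * norm (T (t1 + t2) (D 1 (P x))) = f \<tau> * norm (T t2 (D 1 ?z))" by simp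
      also have "\<dots> \<le> f \<tau> * (\<tau> * (1 + M * M) * norm (D \<tau> ?z))" by (rule mult_left_mono[OF key f0])
      also have "\<dots> = \<tau> * (1 + M * M) * (f \<tau> * norm (D \<tau> ?z))" by simp
      also have "\<dots> \<le> \<tau> * (1 + M * M) * (2 * M * norm (F ?z))"
        using \<tau> by (intro mult_left_mono Fb) auto
      also have "F ?z = (T t1 o\<^sub>L (P o\<^sub>L F)) x"
        using arg_cong[OF Fc[OF Tc[OF t(1)]], of "\<lambda>Q. blinfun_apply Q (P x)"] arg_cong[OF FP, of "\<lambda>Q. blinfun_apply Q x"] by simp
      also have "\<tau> * (1 + M * M) * (2 * M * norm ((T t1 o\<^sub>L (P o\<^sub>L F)) x)) \<le> \<tau> * (1 + M * M) * (2 * M * (norm (T t1 o\<^sub>L (P o\<^sub>L F)) * norm x))"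
        using \<tau> M_ge_1 by (intro mult_left_mono norm_blinfun) auto
      finally show ?thesis by (simp only: mult_ac)
    qed
    have "norm (f \<tau> *\<^sub>R (T (t1 + t2) o\<^sub>L (D 1 o\<^sub>L P))) \<le> 2 * M * (1 + M * M) * \<tau> * norm (T t1 o\<^sub>L (P o\<^sub>L F))"
      using main f0 \<tau> M_ge_1 by (intro norm_blinfun_bound) (auto simp: blinfun.scaleR_left)
    then have "f \<tau> * norm (T (t1 + t2) o\<^sub>L (D 1 o\<^sub>L P)) \<le> 2 * M * (1 + M * M) * \<tau> * norm (T t1 o\<^sub>L (P o\<^sub>L F))"
      using f0 by simp
    moreover have "0 < 2 * M * (1 + M * M)" using M_ge_1 by (simp add: add_pos_nonneg)
    ultimately have "1 / (2 * M * (1 + M * M)) * (norm (T (t1 + t2) o\<^sub>L (D 1 o\<^sub>L P)) / \<tau>) * f \<tau> \<le> norm (T t1 o\<^sub>L (P o\<^sub>L F))"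
      using \<tau> by (intro rearrange_bound)
    then show ?thesis unfolding P F unfolding B_op_A bop_comp op_norm_bop \<tau>_def .
  qed
qed

end

section \<open>The lower bound for invertible generators\<close>

lemma converse_relpow: "(R\<inverse>) ^^ n = (R ^^ n)\<inverse>" for R :: "('a \<times> 'a) set"
proof (induction n)
  case (Suc n)
  have "(R\<inverse>) ^^ Suc n = (R ^^ n)\<inverse> O R\<inverse>" by (simp add: Suc)
  also have "\<dots> = (R O R ^^ n)\<inverse>" by (simp add: converse_relcomp)
  also have "R O R ^^ n = R ^^ Suc n" by (simp add: relpow_commute)
  finally show ?case .
qed auto

locale invertible_bounded_semigroup = bounded_semigroup +
  fixes S :: "'a \<Rightarrow>\<^sub>L 'a"
  assumes A_inverse: "A\<inverse> = bop S"
begin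

lemma A_S: "(x, y) \<in> A \<longleftrightarrow> x = S y"
proof -
  have "(x, y) \<in> A \<longleftrightarrow> (y, x) \<in> A\<inverse>" by simp
  then show ?thesis by (simp add: A_inverse bop_mem)
qed

lemma A_eq: "A = (bop S)\<inverse>"
  using A_inverse by auto

lemma S_inj: "S x = S y \<Longrightarrow> x = y"
  using A_single_valued[of "S x" x y] by (simp add: A_S)

lemma S_D: "0 < s \<Longrightarrow> S (D s x) = R s x"
  using A_R[of s x] by (simp add: A_S)

lemma D_S: "0 < s \<Longrightarrow> D s (S x) = R s x"
  by (rule D_A) (simp_all add: A_S)

lemma R_S: "0 < s \<Longrightarrow> R s (S x) = S (R s x)"
proof -
  assume s: "0 < s"
  have "S x - S (s *\<^sub>R R s x) = S x - s *\<^sub>R R s (S x)"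
    using S_D[OF s, of x] D_S[OF s, of x] by (simp only: D_apply blinfun.diff_right)
  then have "S (s *\<^sub>R R s x) = s *\<^sub>R R s (S x)" by simp
  then show ?thesis using s by (simp add: blinfun.scaleR_right)
qed

lemma T_S: "0 \<le> t \<Longrightarrow> T t (S x) = S (T t x)"
  using A_T[of "S x" x t] by (simp add: A_S)

text \<open>
  The resolvents of \<open>A\<close> on the closed half-line.
\<close>

definition Q :: "real \<Rightarrow> 'a \<Rightarrow>\<^sub>L 'a" where "Q s = (if s = 0 then S else R s)"

lemma R_bound: "0 < s \<Longrightarrow> norm (R s) \<le> norm S * (1 + M)"
proof -
  assume s: "0 < s"
  have "R s = S o\<^sub>L D s" by (rule blinfun_eqI) (simp add: S_D[OF s])
  then show ?thesis
    using norm_D[OF s] by (simp add: order_trans[OF norm_blinfun_compose] mult_left_mono)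
qed

text \<open>
  The constant comes from \<open>(1 + s) \<parallel>R(s)\<parallel> \<le> \<parallel>R(s)\<parallel> + M\<close> and \<open>R(s) = A\<inverse> D(s)\<close>.
\<close>

sublocale Q: pseudo_resolvent Q "norm S * (1 + M) + M"
proof
  fix s :: real assume s: "0 \<le> s"
  show "norm (Q s) \<le> (norm S * (1 + M) + M) / (1 + s)"
  proof (cases "s = 0")
    case True
    have "norm S * 1 \<le> norm S * (1 + M)" using M_ge_1 by (intro mult_left_mono) auto
    then have "norm S \<le> norm S * (1 + M) + M" using M_ge_1 by linarith
    then show ?thesis using True by (simp add: Q_def)
  next
    case False
    with s have s: "0 < s" by simp
    have "s * norm (R s) \<le> M" using norm_R[OF s] s by (simp add: field_simps)
    then have "(1 + s) * norm (R s) \<le> norm S * (1 + M) + M"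
      unfolding distrib_right using R_bound[OF s] by linarith
    then show ?thesis using s by (simp add: Q_def pos_le_divide_eq mult.commute)
  qed
next
  fix s t :: real assume st: "0 \<le> s" "0 \<le> t"
  consider "s = t" | "s = 0" "0 < t" | "0 < s" "t = 0" | "0 < s" "0 < t"
    using st by linarith
  then show "(t - s) *\<^sub>R (Q s o\<^sub>L Q t) = Q s - Q t"
  proof cases
    case 2
    show ?thesis
    proof (rule blinfun_eqI)
      fix x
      have "t *\<^sub>R S (R t x) = S x - S (D t x)" by (simp add: D_apply blinfun.diff_right blinfun.scaleR_right)
      then show "((t - s) *\<^sub>R (Q s o\<^sub>L Q t)) x = (Q s - Q t) x"
        using 2 by (simp add: Q_def S_D blinfun.diff_left blinfun.scaleR_left)
    qed
  next
    case 3
    show ?thesis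
    proof (rule blinfun_eqI)
      fix x
      have "s *\<^sub>R R s (S x) = S x - D s (S x)" by (simp add: D_apply)
      then show "((t - s) *\<^sub>R (Q s o\<^sub>L Q t)) x = (Q s - Q t) x"
        using 3 by (simp add: Q_def D_S blinfun.diff_left blinfun.scaleR_left blinfun.minus_left)
    qed
  next
    case 4
    then show ?thesis
      by (intro blinfun_eqI) (simp add: Q_def R_resolvent blinfun.diff_left blinfun.scaleR_left)
  qed simp
qed

text \<open>
  The bounded operator \<open>A\<^sup>-\<^sup>r\<close>.
\<close>

abbreviation neg_pow :: "real \<Rightarrow> 'a \<Rightarrow>\<^sub>L 'a"
  where "neg_pow r \<equiv> Q.W (1 - r) 0"

lemma neg_pow_law:
  assumes r: "0 < r" "r < 1"
  shows "neg_pow (1 - r) (neg_pow r x) = S x"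
proof -
  have "Q 0 = S" by (simp add: Q_def)
  from arg_cong[OF Q.W_law[OF r, unfolded this], of "\<lambda>P. blinfun_apply P x"]
  have "S (S (Q.W r 0 (Q.W (1 - r) 0 x))) = S (S (S x))" by simp
  from S_inj[OF S_inj[OF this]] show ?thesis by simp
qed

lemma neg_pow_commute:
  assumes r: "0 < r" "r < 1" and P: "\<And>s. 0 < s \<Longrightarrow> P o\<^sub>L R s = R s o\<^sub>L P"
  shows "P o\<^sub>L neg_pow r = neg_pow r o\<^sub>L P"
  by (rule Q.W_commute) (use r P in \<open>auto simp: Q_def\<close>)

lemma S_neg_pow:
  assumes r: "0 < r" "r < 1"
  shows "S (neg_pow r x) = neg_pow r (S x)"
proof -
  have "S o\<^sub>L neg_pow r = neg_pow r o\<^sub>L S"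
    by (rule neg_pow_commute[OF r]) (auto intro!: blinfun_eqI simp: R_S)
  from arg_cong[OF this, of "\<lambda>P. blinfun_apply P x"] show ?thesis by simp
qed

text \<open>
  Balakrishnan's integral defines \<open>A\<^sup>r\<close> on \<open>dom A\<close> as \<open>A\<^sup>-\<^sup>(\<^sup>1\<^sup>-\<^sup>r\<^sup>) A\<close>. On this core it is inverted by the bounded
  operator \<open>A\<^sup>-\<^sup>r\<close>, according to the law of exponents. The closure is all of \<open>(A\<^sup>-\<^sup>r)\<inverse>\<close>, because
  \<open>(A\<^sup>-\<^sup>r y, y)\<close> belongs to the graph for \<open>y \<in> dom A\<close>, and \<open>dom A\<close> is dense.
\<close>

lemma balakrishnan_A:
  assumes r: "0 < r" "r < 1"
  shows "balakrishnan A r = (bop (neg_pow r))\<inverse>"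
proof -
  let ?J = "Q.W r 0"
  have W: "has_strong_integral half_line (\<lambda>s. weight r s *\<^sub>R R s) ?J"
  proof -
    have "has_strong_integral half_line (\<lambda>s. weight r s *\<^sub>R Q (s + 0)) ?J"
      by (rule Q.W_integral[OF r]) simp
    then show ?thesis
      by (rule has_strong_integral_cong[THEN iffD1, rotated]) (simp add: Q_def space_half_line)
  qed
  have app: "has_strong_integral half_line (\<lambda>s. weight r s *\<^sub>R app (shift_inv s A) y) z \<longleftrightarrow> z = ?J y" for y z
    by (rule has_strong_integral_apply_iff[OF W]) (simp add: shift_inv_A app_bop space_half_line blinfun.scaleR_left)
  have r': "0 < 1 - r" "1 - r < 1" using r by auto
  have "balakrishnan A r = closure {(S y, ?J y) | y. True}"
    unfolding balakrishnan_def weight_def[symmetric]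
    by (rule arg_cong[where f=closure]) (auto simp: app A_S)
  also have "\<dots> = (bop (neg_pow r))\<inverse>"
  proof (intro equalityI)
    show "closure {(S y, ?J y) | y. True} \<subseteq> (bop (neg_pow r))\<inverse>"
      using neg_pow_law[OF r'] by (intro closure_minimal closed_converse_bop) (auto simp: bop_mem)
    show "(bop (neg_pow r))\<inverse> \<subseteq> closure {(S y, ?J y) | y. True}"
    proof
      fix q assume "q \<in> (bop (neg_pow r))\<inverse>"
      then obtain y where q: "q = (neg_pow r y, y)" by (auto simp: bop_def)
      have "y \<in> closure (Domain A)" by (simp add: A_dense)
      then obtain f :: "nat \<Rightarrow> _" where f: "\<And>n. f n \<in> Domain A" "f \<longlonglongrightarrow> y" unfolding closure_sequential by blast
      have "\<exists>u. f n = S u" for n using f(1)[of n] by (auto simp: A_S)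
      then obtain u where u: "\<And>n. f n = S (u n)" by metis
      have "(neg_pow r (f n), f n) = (S (neg_pow r (u n)), ?J (neg_pow r (u n)))" for n
        using neg_pow_law[OF r, of "u n"] by (simp add: u S_neg_pow[OF r])
      then have "(neg_pow r (f n), f n) \<in> {(S y, ?J y) | y. True}" for n by blast
      moreover have "(\<lambda>n. (neg_pow r (f n), f n)) \<longlonglongrightarrow> q"
        unfolding q by (intro tendsto_Pair blinfun.tendsto tendsto_const f(2))
      ultimately show "q \<in> closure {(S y, ?J y) | y. True}"
        unfolding closure_sequential by (intro exI[of _ "\<lambda>n. (neg_pow r (f n), f n)"]) auto
    qed
  qed
  finally show ?thesis .
qed

text \<open>
  The bounded operator \<open>A\<^sup>-\<^sup>\<alpha>\<close> for \<open>\<alpha> \<ge> 0\<close>.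
\<close>

definition inv_pow :: "real \<Rightarrow> 'a \<Rightarrow>\<^sub>L 'a"
  where "inv_pow \<alpha> = (if frac \<alpha> = 0 then id_blinfun else neg_pow (frac \<alpha>)) o\<^sub>L blinfun_power S (nat \<lfloor>\<alpha>\<rfloor>)"

lemma frac_range: "frac \<alpha> \<noteq> 0 \<Longrightarrow> 0 < frac \<alpha> \<and> frac \<alpha> < 1" for \<alpha> :: real
  using frac_ge_0[of \<alpha>] frac_lt_1[of \<alpha>] by linarith

lemma frac_pow_nonneg_A: "(frac_pow_nonneg A \<alpha>)\<inverse> = bop (inv_pow \<alpha>)"
proof -
  have Y: "(if frac \<alpha> = 0 then Id else balakrishnan A (frac \<alpha>)) = (bop (if frac \<alpha> = 0 then id_blinfun else neg_pow (frac \<alpha>)))\<inverse>"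
    using frac_range[of \<alpha>] by (cases "frac \<alpha> = 0") (simp_all only: if_True if_False bop_id converse_Id balakrishnan_A simp_thms)
  have A: "A ^^ nat \<lfloor>\<alpha>\<rfloor> = (bop (blinfun_power S (nat \<lfloor>\<alpha>\<rfloor>)))\<inverse>"
    unfolding A_eq converse_relpow bop_relpow ..
  show ?thesis
    unfolding frac_pow_nonneg_def Y A converse_relcomp converse_converse inv_pow_def bop_comp[symmetric] ..
qed

lemma inv_pow_commute:
  assumes P: "\<And>s. 0 < s \<Longrightarrow> P o\<^sub>L R s = R s o\<^sub>L P" and PS: "P o\<^sub>L S = S o\<^sub>L P"
  shows "P o\<^sub>L inv_pow \<alpha> = inv_pow \<alpha> o\<^sub>L P"
proof -
  let ?Y = "if frac \<alpha> = 0 then id_blinfun else neg_pow (frac \<alpha>)"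
  have "P o\<^sub>L ?Y = ?Y o\<^sub>L P"
    using frac_range[of \<alpha>] neg_pow_commute[OF _ _ P] by (cases "frac \<alpha> = 0") (simp_all only: if_True if_False blinfun_compose_id simp_thms)
  then have "P o\<^sub>L (?Y o\<^sub>L blinfun_power S n) = ?Y o\<^sub>L (P o\<^sub>L blinfun_power S n)" for n
    by (simp only: blinfun_compose_assoc[symmetric])
  then show ?thesis
    unfolding inv_pow_def by (simp only: blinfun_power_commute[OF PS] blinfun_compose_assoc)
qed

lemma inv_pow_Suc:
  assumes "0 \<le> \<alpha>"
  shows "inv_pow (\<alpha> + 1) = S o\<^sub>L inv_pow \<alpha>"
proof -
  let ?Y = "if frac \<alpha> = 0 then id_blinfun else neg_pow (frac \<alpha>)"
  have "\<lfloor>\<alpha> + 1\<rfloor> = \<lfloor>\<alpha>\<rfloor> + 1" by simp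
  then have n: "nat \<lfloor>\<alpha> + 1\<rfloor> = Suc (nat \<lfloor>\<alpha>\<rfloor>)" using assms by (simp add: nat_add_distrib)
  have f: "frac (\<alpha> + 1) = frac \<alpha>" by (simp add: frac_def)
  have "S o\<^sub>L neg_pow r = neg_pow r o\<^sub>L S" if "0 < r" "r < 1" for r
    using that by (intro blinfun_eqI) (simp add: S_neg_pow)
  then have "?Y o\<^sub>L S = S o\<^sub>L ?Y"
    using frac_range[of \<alpha>] by (cases "frac \<alpha> = 0") (simp_all only: if_True if_False blinfun_compose_id simp_thms)
  then show ?thesis
    unfolding inv_pow_def n f blinfun_power.simps by (simp only: blinfun_compose_assoc[symmetric])
qed

text \<open>
  The second part is \<open>A\<inverse> A\<^sup>\<gamma> \<subseteq> A\<^sup>\<gamma>\<^sup>-\<^sup>1\<close>. For \<open>\<gamma> \<le> 0\<close> the exponents \<open>-\<gamma>\<close> and \<open>1 - \<gamma>\<close> have the same fractional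
  part; for \<open>0 < \<gamma> < 1\<close> the law of exponents for \<open>A\<^sup>-\<^sup>\<gamma>\<close> and \<open>A\<^sup>-\<^sup>(\<^sup>1\<^sup>-\<^sup>\<gamma>\<^sup>)\<close> is needed.
\<close>

lemma frac_pow_A:
  assumes \<gamma>: "\<gamma> \<le> 1"
  shows "frac_pow A (\<gamma> - 1) = bop (inv_pow (1 - \<gamma>))"
    and "(x, y) \<in> frac_pow A \<gamma> \<Longrightarrow> S y = inv_pow (1 - \<gamma>) x"
proof -
  have 0: "frac_pow A 0 = bop (inv_pow 0)"
    by (simp add: frac_pow_def frac_pow_nonneg_def inv_pow_def bop_id blinfun_compose_id)
  have neg: "frac_pow A (- \<alpha>) = bop (inv_pow \<alpha>)" if "0 \<le> \<alpha>" for \<alpha>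
  proof (cases "\<alpha> = 0")
    case False
    then have "\<not> 0 \<le> - \<alpha>" using that by simp
    then show ?thesis unfolding frac_pow_def by (simp only: if_False minus_minus frac_pow_nonneg_A)
  qed (simp add: 0)
  show "frac_pow A (\<gamma> - 1) = bop (inv_pow (1 - \<gamma>))" using neg[of "1 - \<gamma>"] \<gamma> by simp
  assume xy: "(x, y) \<in> frac_pow A \<gamma>"
  consider "\<gamma> \<le> 0" | "0 < \<gamma>" "\<gamma> < 1" | "\<gamma> = 1" using \<gamma> by linarith
  then show "S y = inv_pow (1 - \<gamma>) x"
  proof cases
    case 1
    have "y = inv_pow (- \<gamma>) x" using xy neg[of "- \<gamma>"] 1 by (simp add: bop_mem)
    then show ?thesis using inv_pow_Suc[of "- \<gamma>"] 1 by simp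
  next
    case 2
    have fl: "\<lfloor>\<gamma>\<rfloor> = 0" "\<lfloor>1 - \<gamma>\<rfloor> = 0" using 2 by (auto simp: floor_eq_iff)
    have fr: "frac \<gamma> = \<gamma>" "frac (1 - \<gamma>) = 1 - \<gamma>" using fl by (simp_all add: frac_def)
    have "frac_pow A \<gamma> = (bop (neg_pow \<gamma>))\<inverse>"
      unfolding frac_pow_def frac_pow_nonneg_def fl fr using 2 by (simp add: balakrishnan_A)
    then have "x = neg_pow \<gamma> y" using xy by (simp add: bop_mem)
    moreover have "inv_pow (1 - \<gamma>) = neg_pow (1 - \<gamma>)"
      unfolding inv_pow_def fl fr using 2 by (simp add: blinfun_compose_id)
    ultimately show ?thesis using neg_pow_law[of \<gamma> y] 2 by simp
  next
    case 3
    have "frac_pow A \<gamma> = A" unfolding 3 by (simp add: frac_pow_def frac_pow_nonneg_def frac_def)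
    then have "x = S y" using xy by (simp add: A_S)
    then show ?thesis unfolding 3 by (simp add: inv_pow_def blinfun_compose_id frac_def)
  qed
qed

text \<open>
  The operator \<open>A\<inverse> (s + A\<inverse>)\<inverse> = (1 + s A)\<inverse>\<close>.
\<close>

definition S_res :: "real \<Rightarrow> 'a \<Rightarrow>\<^sub>L 'a"
  where "S_res s = (1 / s) *\<^sub>R R (1 / s)"

lemma S_shift_inv:
  assumes s: "0 < s"
  shows "bop S \<odot> shift_inv s (bop S) = bop (S_res s)"
proof -
  have s': "0 < 1 / s" using s by simp
  have left: "(1 / s) *\<^sub>R D (1 / s) (s *\<^sub>R x + S x) = x" for x
  proof -
    have "(1 / s) *\<^sub>R D (1 / s) (s *\<^sub>R x + S x) = D (1 / s) x + (1 / s) *\<^sub>R R (1 / s) x"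
      using s by (simp add: blinfun.add_right blinfun.scaleR_right scaleR_add_right D_S[OF s'])
    then show ?thesis by (simp add: D_apply)
  qed
  have right: "s *\<^sub>R ((1 / s) *\<^sub>R D (1 / s) w) + S ((1 / s) *\<^sub>R D (1 / s) w) = w" for w
    using s by (simp add: blinfun.scaleR_right S_D[OF s']) (simp add: D_apply)
  have "shift_inv s (bop S) = bop ((1 / s) *\<^sub>R D (1 / s))"
    by (rule shift_inv_bop) (simp_all only: blinfun.scaleR_left left right)
  moreover have "S o\<^sub>L ((1 / s) *\<^sub>R D (1 / s)) = S_res s"
    by (rule blinfun_eqI) (simp add: S_res_def blinfun.scaleR_left blinfun.scaleR_right S_D[OF s'])
  ultimately show ?thesis by (simp only: bop_comp)
qed

text \<open>
  With \<open>z = A\<inverse> x\<close> one has \<open>f(A\<inverse>) x = a A z + b z + \<integral> (1/s) D(1/s) z d\<mu>(s)\<close>. So the roles of \<open>a\<close> and \<open>b\<close> are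
  interchanged, and the pair belonging to \<open>f(A\<inverse>) x\<close> in the cone for \<open>z\<close> and \<open>1/\<tau>\<close> is
  \<open>(f(A\<inverse>) x, f(\<tau>)/\<tau>)\<close>.
\<close>

lemma cbf_op_inverse:
  assumes f: "complete_bernstein f"
  shows "\<exists>G. cbf_op f (A\<inverse>) = bop G \<and> (\<forall>\<tau> x. 0 < \<tau> \<longrightarrow> f \<tau> / \<tau> * norm (R (1 / \<tau>) x) \<le> 2 * M * norm (G x)) \<and>
    (\<forall>P. (\<forall>s>0. P o\<^sub>L R s = R s o\<^sub>L P) \<and> P o\<^sub>L S = S o\<^sub>L P \<longrightarrow> P o\<^sub>L G = G o\<^sub>L P)"
proof -
  obtain a b \<mu> where p: "(SOME p. cbf_triple f p) = (a, b, \<mu>)" by (metis prod_cases3)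
  have ct: "cbf_triple f (a, b, \<mu>)"
    using someI_ex[OF f[unfolded complete_bernstein_def]] by (simp add: p)
  note ct' = cbf_tripleD[OF ct]
  let ?C = "norm S * (1 + M) + M"
  have C: "0 \<le> ?C" using M_ge_1 by simp
  have nS: "norm (S_res s) \<le> ?C / (s + 1)" if s: "0 < s" for s
  proof -
    have "norm (S_res s) = (1 / s) * norm (Q (1 / s))" using s by (simp add: S_res_def Q_def)
    also have "\<dots> \<le> (1 / s) * (?C / (1 + 1 / s))" using s by (intro mult_left_mono Q.bound) auto
    also have "(1 / s) * (c / (1 + 1 / s)) = c / (s + 1)" for c
      using s by (simp add: field_simps)
    finally show ?thesis .
  qed
  have "continuous_on {0<..} (\<lambda>s. R (1 / s))"
    by (rule continuous_on_compose2[OF R_cont]) (auto intro!: continuous_intros)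
  then have cS: "continuous_on {0<..} S_res"
    unfolding S_res_def by (intro continuous_intros) auto
  have "\<exists>G1. has_strong_integral \<mu> S_res G1"
    by (rule has_strong_integral_continuous[OF ct'(3,4) cS cbf_dominated[OF ct nS C]]) (auto intro: exI)
  then obtain G1 where G1: "has_strong_integral \<mu> S_res G1" by (elim exE)
  define G where "G = a *\<^sub>R id_blinfun + b *\<^sub>R S + G1"
  have app: "has_strong_integral \<mu> (\<lambda>s. app (bop S \<odot> shift_inv s (bop S)) x) z \<longleftrightarrow> z = G1 x" for x z
    by (rule has_strong_integral_apply_iff[OF G1]) (simp add: ct'(7) S_shift_inv app_bop)
  have "cbf_op f (A\<inverse>) = closure {(x, G x) | x. x \<in> UNIV}"
    unfolding cbf_op_def p prod.case A_inverse app
    by (rule arg_cong[where f=closure]) (auto simp: G_def blinfun.add_left blinfun.scaleR_left bop_mem)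
  also have "\<dots> = bop G" by (rule closure_graph) simp
  finally have 1: "cbf_op f (A\<inverse>) = bop G" .
  have 2: "f \<tau> / \<tau> * norm (R (1 / \<tau>) x) \<le> 2 * M * norm (G x)" if \<tau>: "0 < \<tau>" for \<tau> x
  proof -
    let ?\<sigma> = "1 / \<tau>"
    have \<sigma>: "0 < ?\<sigma>" using \<tau> by simp
    have "(G1 x, (\<integral> s. 1 / (s + \<tau>) \<partial>\<mu>)) \<in> resolvent_cone ?\<sigma> (S x)"
    proof (rule strong_integral_pair_in_cone[OF ct'(3,4) _ _ has_strong_integral_apply[OF G1] _ _ closed_cone convex_cone_cone])
      show "continuous_on {0<..} (\<lambda>s. S_res s x)" by (intro continuous_intros cS)
      show "(\<integral>\<^sup>+ s. ennreal (norm (S_res s x)) \<partial>\<mu>) < \<infinity>"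
      proof (rule cbf_dominated[OF ct, where C="?C * norm x"])
        show "norm (S_res s x) \<le> ?C * norm x / (s + 1)" if "0 < s" for s
          using order_trans[OF norm_blinfun mult_right_mono[OF nS[OF that] norm_ge_zero]] by simp
      qed (use C in simp)
      show "continuous_on {0<..} (\<lambda>s. 1 / (s + \<tau>))" using \<tau> by (auto intro!: continuous_intros)
      show "(\<integral>\<^sup>+ s. ennreal (norm (1 / (s + \<tau>))) \<partial>\<mu>) < \<infinity>"
      proof (rule cbf_dominated[OF ct, where C="max 1 (1 / \<tau>)"])
        show "norm (1 / (s + \<tau>)) \<le> max 1 (1 / \<tau>) / (s + 1)" if "0 < s" for s
          using stieltjes_kernel_bound[OF \<tau> that] that \<tau> by simp
      qed simp
      show "(S_res s x, 1 / (s + \<tau>)) \<in> resolvent_cone ?\<sigma> (S x)" if s: "0 < s" for s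
      proof -
        have "(1 / s) *\<^sub>R (D (1 / s) (S x), ?\<sigma> / (?\<sigma> + 1 / s)) \<in> resolvent_cone ?\<sigma> (S x)"
          using s by (intro convex_cone_scaleR[OF convex_cone_cone] cone_generator) auto
        moreover have "(1 / s) * (?\<sigma> / (?\<sigma> + 1 / s)) = 1 / (s + \<tau>)"
          using s \<tau> by (simp add: field_simps)
        ultimately show ?thesis using s by (simp add: S_res_def D_S blinfun.scaleR_left)
      qed
    qed
    moreover have "b *\<^sub>R (S x, 1) \<in> resolvent_cone ?\<sigma> (S x)"
      using convex_cone_scaleR[OF convex_cone_cone ct'(2) cone_generator[of 0 "S x" ?\<sigma>]] \<tau> by (simp add: D_0)
    moreover have "a *\<^sub>R (x, ?\<sigma>) \<in> resolvent_cone ?\<sigma> (S x)"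
      by (intro convex_cone_scaleR[OF convex_cone_cone ct'(1)] cone_A \<sigma>) (simp add: A_S)
    ultimately have "a *\<^sub>R (x, ?\<sigma>) + b *\<^sub>R (S x, 1) + (G1 x, (\<integral> s. 1 / (s + \<tau>) \<partial>\<mu>)) \<in> resolvent_cone ?\<sigma> (S x)"
      by (intro convex_cone_add[OF convex_cone_cone])
    moreover have "f \<tau> / \<tau> = a * ?\<sigma> + b + (\<integral> s. 1 / (s + \<tau>) \<partial>\<mu>)"
    proof -
      have "(\<integral> s. \<tau> / (s + \<tau>) \<partial>\<mu>) = \<tau> * (\<integral> s. 1 / (s + \<tau>) \<partial>\<mu>)"
        using Bochner_Integration.integral_mult_right_zero[of \<mu> \<tau> "\<lambda>s. 1 / (s + \<tau>)"] by simp
      then show ?thesis using ct'(6)[OF \<tau>] \<tau> by (simp add: field_simps)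
    qed
    ultimately have "(G x, f \<tau> / \<tau>) \<in> resolvent_cone ?\<sigma> (S x)"
      by (simp add: G_def blinfun.add_left blinfun.scaleR_left)
    from cone_estimate[OF this \<sigma>] show ?thesis by (simp add: D_S[OF \<sigma>])
  qed
  have 3: "P o\<^sub>L G = G o\<^sub>L P" if P: "(\<forall>s>0. P o\<^sub>L R s = R s o\<^sub>L P) \<and> P o\<^sub>L S = S o\<^sub>L P" for P
  proof -
    have "P o\<^sub>L G1 = G1 o\<^sub>L P"
      by (rule has_strong_integral_commute[OF G1]) (use P ct'(7) in \<open>auto simp: S_res_def comp_scaleR\<close>)
    then show ?thesis using P by (simp add: G_def comp_add comp_scaleR blinfun_compose_id)
  qed
  show ?thesis using 1 2 3 by blast
qed

text \<open>
  Let \<open>P\<close> be the bounded operator \<open>A\<^sup>\<gamma> f(A\<inverse>)\<close>, \<open>G = f(A\<inverse>)\<close> and \<open>E = A\<^sup>\<gamma>\<^sup>-\<^sup>1\<close>. Then \<open>A\<inverse> P = E G\<close>, and therefore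
  \<open>P A\<inverse> = E G\<close>. On \<open>u = A\<inverse> v\<close> in \<open>dom A\<close> the estimate for the vector \<open>y = E T(t\<^sub>1) v\<close> applies, since
  \<open>A\<inverse> y = E T(t\<^sub>1) u\<close> and \<open>G y = T(t\<^sub>1) P u\<close>. The density of \<open>dom A\<close> does the rest.
\<close>

lemma lower_bound_inverse:
  assumes f: "complete_bernstein f" and \<gamma>: "\<gamma> \<le> 1"
    and bd: "bounded_op (frac_pow A \<gamma> \<odot> cbf_op f (A\<inverse>))"
    and t: "0 \<le> t1" "0 \<le> t2"
  shows "op_norm (bop (T t1) \<odot> frac_pow A \<gamma> \<odot> cbf_op f (A\<inverse>)) \<ge>
    1 / (2 * M * (1 + M * M)) * (op_norm (bop (T (t1 + t2)) \<odot> frac_pow A (\<gamma> - 1)) / op_norm (bop (T t2) \<odot> A\<inverse>))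
       * f (op_norm (bop (T t2) \<odot> A\<inverse>))"
proof -
  obtain G where G: "cbf_op f (A\<inverse>) = bop G" and Gb: "\<And>\<tau> x. 0 < \<tau> \<Longrightarrow> f \<tau> / \<tau> * norm (R (1 / \<tau>) x) \<le> 2 * M * norm (G x)"
    and Gc: "\<And>P. (\<forall>s>0. P o\<^sub>L R s = R s o\<^sub>L P) \<Longrightarrow> P o\<^sub>L S = S o\<^sub>L P \<Longrightarrow> P o\<^sub>L G = G o\<^sub>L P"
    using cbf_op_inverse[OF f] by blast
  obtain P where P: "frac_pow A \<gamma> \<odot> cbf_op f (A\<inverse>) = bop P" using bd by (auto simp: bounded_op_def)
  define E where "E = inv_pow (1 - \<gamma>)"
  have E: "frac_pow A (\<gamma> - 1) = bop E" unfolding E_def by (rule frac_pow_A(1)[OF \<gamma>])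
  have SP: "S (P x) = E (G x)" for x
  proof -
    have "(x, P x) \<in> frac_pow A \<gamma> \<odot> bop G" using P by (simp add: G bop_mem)
    then have "(G x, P x) \<in> frac_pow A \<gamma>" by (auto simp: bop_mem)
    then show ?thesis unfolding E_def by (rule frac_pow_A(2)[OF \<gamma>])
  qed
  have Rc: "R s o\<^sub>L R s' = R s' o\<^sub>L R s" "R s o\<^sub>L S = S o\<^sub>L R s" if "0 < s" "0 < s'" for s s'
    using that by (auto intro!: blinfun_eqI simp: R_commute R_S)
  have Tc: "T u o\<^sub>L R s' = R s' o\<^sub>L T u" "T u o\<^sub>L S = S o\<^sub>L T u" if "0 \<le> u" "0 < s'" for u s'
    using that by (auto intro!: blinfun_eqI simp: R_T T_S)
  have Sc: "S o\<^sub>L R s = R s o\<^sub>L S" if "0 < s" for s using Rc(2)[OF that that] by simp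
  have ER: "E o\<^sub>L R s = R s o\<^sub>L E" if s: "0 < s" for s
    unfolding E_def by (rule inv_pow_commute[symmetric]) (use Rc s in auto)
  have ES: "E o\<^sub>L S = S o\<^sub>L E"
    unfolding E_def by (rule inv_pow_commute[symmetric]) (use Sc in auto)
  have ET: "E o\<^sub>L T u = T u o\<^sub>L E" if u: "0 \<le> u" for u
    unfolding E_def by (rule inv_pow_commute[symmetric]) (use Tc[OF u] Tc(2)[OF u zero_less_one] in auto)
  have EG: "E o\<^sub>L G = G o\<^sub>L E" by (rule Gc) (use ER ES in auto)
  have TG: "T u o\<^sub>L G = G o\<^sub>L T u" if u: "0 \<le> u" for u
    by (rule Gc) (use Tc[OF u] Tc(2)[OF u zero_less_one] in auto)
  have SG: "S o\<^sub>L G = G o\<^sub>L S" by (rule Gc) (use Sc in auto)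
  have appl: "V (W x) = W (V x)" if "V o\<^sub>L W = W o\<^sub>L V" for V W :: "'a \<Rightarrow>\<^sub>L 'a" and x
    using arg_cong[OF that, of "\<lambda>P. blinfun_apply P x"] by simp
  have PS: "P (S v) = E (G v)" for v
  proof (rule S_inj)
    show "S (P (S v)) = S (E (G v))"
      unfolding SP appl[OF SG, symmetric] by (rule appl[OF ES])
  qed
  define \<tau> where "\<tau> = norm (T t2 o\<^sub>L S)"
  show ?thesis
  proof (cases "\<tau> = 0")
    case True
    then show ?thesis unfolding P E unfolding A_inverse bop_comp op_norm_bop \<tau>_def by simp
  next
    case False
    then have \<tau>: "0 < \<tau>" by (simp add: \<tau>_def)
    have \<sigma>: "0 < 1 / \<tau>" using \<tau> by simp
    obtain p where "cbf_triple f p" using f by (auto simp: complete_bernstein_def)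
    then have f0: "0 \<le> f \<tau>" using cbf_nonneg(1)[OF _ \<tau>] by (cases p) auto
    have key: "norm (T t2 (S y)) \<le> (1 + M) * norm (R (1 / \<tau>) y)" for y
    proof -
      let ?y = "R (1 / \<tau>) y"
      have "S y = (1 / \<tau>) *\<^sub>R S ?y + ?y"
        using S_D[OF \<sigma>, of y] by (simp add: D_apply blinfun.diff_right blinfun.scaleR_right algebra_simps)
      then have "T t2 (S y) = (1 / \<tau>) *\<^sub>R (T t2 o\<^sub>L S) ?y + T t2 ?y"
        by (simp add: blinfun.add_right blinfun.scaleR_right)
      also have "norm \<dots> \<le> (1 / \<tau>) * (\<tau> * norm ?y) + M * norm ?y"
      proof (rule norm_triangle_le, rule add_mono)
        have "norm ((T t2 o\<^sub>L S) ?y) \<le> \<tau> * norm ?y" unfolding \<tau>_def by (rule norm_blinfun)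
        then show "norm ((1 / \<tau>) *\<^sub>R (T t2 o\<^sub>L S) ?y) \<le> (1 / \<tau>) * (\<tau> * norm ?y)"
          using \<tau> by (simp only: norm_scaleR real_norm_def abs_of_pos[OF \<sigma>] mult_left_mono[OF _ less_imp_le[OF \<sigma>]])
      qed (rule T_norm[OF t(2)])
      finally show ?thesis using \<tau> by (simp add: algebra_simps)
    qed
    let ?c = "2 * M * (1 + M * M)"
    have c: "0 < ?c" using M_ge_1 by (simp add: add_pos_nonneg)
    have cM: "(1 + M) * (2 * M) \<le> ?c"
    proof -
      have "M * 1 \<le> M * M" using M_ge_1 by (intro mult_left_mono) auto
      then have "(2 * M) * (1 + M) \<le> (2 * M) * (1 + M * M)" using M_ge_1 by (intro mult_left_mono) auto
      then show ?thesis by (simp add: mult.commute)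
    qed
    \<comment> \<open>the estimate on \<open>dom A\<close>, extended to the whole space by density afterwards\<close>
  have range: "f \<tau> * norm (T (t1 + t2) (E u)) \<le> ?c * \<tau> * norm (T t1 o\<^sub>L P) * norm u" if u: "u \<in> Domain A" for u
    proof -
      obtain v where v: "u = S v" using u by (auto simp: A_S)
      let ?y = "E (T t1 v)"
      have "T (t1 + t2) (E u) = T t2 (T t1 (E (S v)))" using t by (simp add: T_T add.commute v)
      also have "T t1 (E (S v)) = S ?y"
        unfolding appl[OF ET[OF t(1)], symmetric] T_S[OF t(1)] by (rule appl[OF ES])
      finally have "f \<tau> * norm (T (t1 + t2) (E u)) = \<tau> * (f \<tau> / \<tau> * norm (T t2 (S ?y)))" using \<tau> by simp
      also have "\<dots> \<le> \<tau> * (f \<tau> / \<tau> * ((1 + M) * norm (R (1 / \<tau>) ?y)))"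
        using \<tau> f0 by (intro mult_left_mono key) auto
      also have "\<dots> = \<tau> * ((1 + M) * (f \<tau> / \<tau> * norm (R (1 / \<tau>) ?y)))" by simp
      also have "\<dots> \<le> \<tau> * ((1 + M) * (2 * M * norm (G ?y)))"
        using \<tau> M_ge_1 by (intro mult_left_mono Gb) auto
      also have "G ?y = (T t1 o\<^sub>L P) u"
        by (simp add: v PS appl[OF EG, symmetric] appl[OF TG[OF t(1)], symmetric] appl[OF ET[OF t(1)]])
      also have "\<tau> * ((1 + M) * (2 * M * norm ((T t1 o\<^sub>L P) u))) = \<tau> * (((1 + M) * (2 * M)) * norm ((T t1 o\<^sub>L P) u))" by simp
      also have "\<dots> \<le> \<tau> * (?c * (norm (T t1 o\<^sub>L P) * norm u))"
        using \<tau> c by (intro mult_left_mono mult_mono cM norm_blinfun) auto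
      finally show ?thesis by (simp only: mult_ac)
    qed
    have "closed {u. f \<tau> * norm (T (t1 + t2) (E u)) \<le> ?c * \<tau> * norm (T t1 o\<^sub>L P) * norm u}"
      by (intro closed_Collect_le continuous_intros)
    from closure_minimal[OF _ this] range
    have "closure (Domain A) \<subseteq> {u. f \<tau> * norm (T (t1 + t2) (E u)) \<le> ?c * \<tau> * norm (T t1 o\<^sub>L P) * norm u}" by blast
    then have all: "f \<tau> * norm (T (t1 + t2) (E u)) \<le> ?c * \<tau> * norm (T t1 o\<^sub>L P) * norm u" for u
      using A_dense by blast
    have "norm (f \<tau> *\<^sub>R (T (t1 + t2) o\<^sub>L E)) \<le> ?c * \<tau> * norm (T t1 o\<^sub>L P)"
    proof (rule norm_blinfun_bound)
      show "0 \<le> ?c * \<tau> * norm (T t1 o\<^sub>L P)" using c \<tau> by simp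
      show "norm ((f \<tau> *\<^sub>R (T (t1 + t2) o\<^sub>L E)) u) \<le> ?c * \<tau> * norm (T t1 o\<^sub>L P) * norm u" for u
        using all[of u] f0 by (simp add: blinfun.scaleR_left)
    qed
    then have "f \<tau> * norm (T (t1 + t2) o\<^sub>L E) \<le> ?c * \<tau> * norm (T t1 o\<^sub>L P)" using f0 by simp
    from rearrange_bound[OF c \<tau> this] show ?thesis
      unfolding P E unfolding A_inverse bop_comp op_norm_bop \<tau>_def .
  qed
qed

end

theorem theorem4p3:
  fixes T :: "real \<Rightarrow> 'a::banach \<Rightarrow>\<^sub>L 'a" and A :: "'a operator"
  assumes "bounded_C0_semigroup T"
    and "generator T = neg_op A"
    and "\<forall>t>0. \<exists>x y. (x, y) \<in> A \<and> blinfun_apply (T t) y \<noteq> 0"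
  shows "\<exists>c>0.
    (invertible_op A \<longrightarrow>
      (\<forall>f \<gamma>. complete_bernstein f \<and> \<gamma> \<le> 1 \<and> bounded_op (frac_pow A \<gamma> \<odot> cbf_op f (A\<inverse>)) \<longrightarrow>
        (\<forall>t1\<ge>0. \<forall>t2\<ge>0.
          op_norm (bop (T t1) \<odot> frac_pow A \<gamma> \<odot> cbf_op f (A\<inverse>)) \<ge>
            c * (op_norm (bop (T (t1 + t2)) \<odot> frac_pow A (\<gamma> - 1)) / op_norm (bop (T t2) \<odot> A\<inverse>))
              * f (op_norm (bop (T t2) \<odot> A\<inverse>))))) \<and>
    (\<forall>f \<gamma>. complete_bernstein f \<and> bounded (f ` {0<..}) \<and> \<gamma> > 0 \<longrightarrow>
      (\<forall>t1\<ge>0. \<forall>t2\<ge>0.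
        op_norm (bop (T t1) \<odot> frac_pow (B_op A) \<gamma> \<odot> cbf_op f A) \<ge>
          c * (op_norm (bop (T (t1 + t2)) \<odot> frac_pow (B_op A) (\<gamma> + 1)) / op_norm (bop (T t2) \<odot> B_op A))
            * f (op_norm (bop (T t2) \<odot> B_op A))))"
proof -
  obtain M0 where M0: "\<And>t. 0 \<le> t \<Longrightarrow> norm (T t) \<le> M0"
    using assms(1) by (auto simp: bounded_C0_semigroup_def)
  define M where "M = max 1 M0"
  interpret bounded_semigroup T A M
  proof
    show "norm (T t) \<le> M" if "0 \<le> t" for t using M0[OF that] by (simp add: M_def)
  qed (use assms in \<open>auto simp: bounded_C0_semigroup_def M_def\<close>)
  have a: "op_norm (bop (T t1) \<odot> frac_pow A \<gamma> \<odot> cbf_op f (A\<inverse>)) \<ge>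
      1 / (2 * M * (1 + M * M)) * (op_norm (bop (T (t1 + t2)) \<odot> frac_pow A (\<gamma> - 1)) / op_norm (bop (T t2) \<odot> A\<inverse>))
        * f (op_norm (bop (T t2) \<odot> A\<inverse>))"
    if inv: "invertible_op A" and h: "complete_bernstein f" "\<gamma> \<le> 1" "bounded_op (frac_pow A \<gamma> \<odot> cbf_op f (A\<inverse>))" "0 \<le> t1" "0 \<le> t2"
    for f \<gamma> t1 t2
  proof -
    obtain S where "A\<inverse> = bop S" using inv by (auto simp: invertible_op_def bounded_op_def)
    then interpret invertible_bounded_semigroup T A M S by unfold_locales
    from h show ?thesis by (rule lower_bound_inverse)
  qed
  have "0 < 1 / (2 * M * (1 + M * M))" using M_ge_1 by (simp add: add_pos_nonneg)
  then show ?thesis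
    using a lower_bound_bounded by (intro exI[of _ "1 / (2 * M * (1 + M * M))"]) blast
qed

end
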